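(* Let $\mathcal{C}$ be a Cayley algebra over a field $\mathbb{F}$ and let $G$ be an abelian group. Then any nontrivial $G$-grading on $\mathcal{C}$ is isomorphic to one of the following: (1) $\Gamma_{\mathcal{C}_s}(G,\gamma)$ for a triple $\gamma=(g_1,g_2,g_3)\in G^3$ with $g_1g_2g_3=e$ and $\gamma\neq(e,e,e)$, if $\mathcal{C}$ is the split Cayley algebra; (2) $\Gamma_{\mathcal{C}}(G,\mathcal{Q},T)$ for a quaternion division subalgebra $\mathcal{Q}$ of $\mathcal{C}$ and a subgroup $T$ of order $2$ in $G$; (3) $\Gamma_{\mathcal{C}}(G,\mathcal{K},T,\mu)$ for a quadratic separable subfield $\mathcal{K}$ of $\mathcal{C}$, an elementary abelian subgroup $T$ of order $4$ in $G$, and an admissible group homomorphism $\mu\colon T\to\mathbb{F}^\times/n(\mathcal{K}^\times)$; (4) $\Gamma_{\mathcal{C}}(G,\mathbb{F},T,\mu)$ for an elementary abelian subgroup $T$ of order $8$ in $G$ and an admissible group homomorphism $\mu\colon T\to\mathbb{F}^\times/(\mathbb{F}^\times)^2$, if $\mathrm{char}\,\mathbb{F}\neq 2$. Two $G$-gradings in different items are not isomorphic, and (1') $\Gamma_{\mathcal{C}_s}(G,\gamma)$ is isomorphic to $\Gamma_{\mathcal{C}_s}(G,\gamma')$ if and only if $\gamma\sim\gamma'$; (2') $\Gamma_{\mathcal{C}}(G,\mathcal{Q},T)$ is isomorphic to $\Gamma_{\mathcal{C}}(G,\mathcal{Q}',T')$ if and only if $\mathcal{Q}$ is isomorphic to $\mathcal{Q}'$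 and $T=T'$; (3') $\Gamma_{\mathcal{C}}(G,\mathcal{K},T,\mu)$ is isomorphic to $\Gamma_{\mathcal{C}}(G,\mathcal{K}',T',\mu')$ if and only if $\mathcal{K}$ is isomorphic to $\mathcal{K}'$ and $(T,\mu)=(T',\mu')$; (4') $\Gamma_{\mathcal{C}}(G,\mathbb{F},T,\mu)$ is isomorphic to $\Gamma_{\mathcal{C}}(G,\mathbb{F},T',\mu')$ if and only if $(T,\mu)=(T',\mu')$.
   Context: A $G$-grading on an algebra $\mathcal{U}$ is a vector space decomposition $\mathcal{U}=\bigoplus_{g\in G}\mathcal{U}_g$ with $\mathcal{U}_g\mathcal{U}_h\subset\mathcal{U}_{gh}$; it is trivial if $\mathcal{U}=\mathcal{U}_e$. Two $G$-gradings are isomorphic if there is an algebra isomorphism mapping the component of degree $g$ of the first onto the component of degree $g$ of the second for every $g\in G$. A Cayley algebra is an $8$-dimensional unital composition algebra, with norm $n$ (a multiplicative quadratic form with nondegenerate polar form $n(x,y)=n(x+y)-n(x)-n(y)$). The split Cayley algebra $\mathcal{C}_s$ (the unique one whose norm represents $0$ nontrivially) has a good basis $\{e_1,e_2,u_1,u_2,u_3,v_1,v_2,v_3\}$ with $e_i^2=e_i$, $e_1u_j=u_je_2=u_j$, $e_2v_j=v_je_1=v_j$, $u_ju_k=\varepsilon_{jkl}v_l$, $v_jv_k=\varepsilon_{jkl}u_l$ (where $l$ is the remaining index and $\varepsilon_{jkl}$ is the Levi-Civita symbol), $u_jv_j=-e_1$, $v_ju_j=-e_2$, all other products $0$. Notation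 for gradings (orthogonality is with respect to the polar form of $n$): * For $\gamma=(g_1,g_2,g_3)\in G^3$ with $g_1g_2g_3=e$, $\Gamma_{\mathcal{C}_s}(G,\gamma)$ is the $G$-grading on $\mathcal{C}_s$ with $\deg e_1=\deg e_2=e$, $\deg u_i=g_i$, $\deg v_i=g_i^{-1}$ for $i=1,2,3$. Write $\gamma\sim\gamma'$ if there is a permutation $\pi\in\mathrm{Sym}(3)$ such that either $g_i'=g_{\pi(i)}$ for all $i$, or $g_i'=g_{\pi(i)}^{-1}$ for all $i$. * For a quaternion division subalgebra $\mathcal{Q}$ of $\mathcal{C}$ and a subgroup $T=\langle t\rangle$ of order $2$ in $G$, $\Gamma_{\mathcal{C}}(G,\mathcal{Q},T)$ is the $G$-grading with $\mathcal{C}_e=\mathcal{Q}$, $\mathcal{C}_t=\mathcal{Q}^\perp$. * Let $\mathcal{K}$ be a quadratic separable subfield of $\mathcal{C}$ and $T=\{e,t_1,t_2,t_3\}\subset G$ an elementary abelian ($2$-)subgroup of order $4$. A homomorphism $\mu\colon T\to\mathbb{F}^\times/n(\mathcal{K}^\times)$ is admissible if, for representatives $\tilde\mu_i\in\mathbb{F}^\times$ of $\mu(t_i)$, $n$ is isometric to $n_{\mathcal{K}}\perp\tilde\mu_1n_{\mathcal{K}}\perp\tilde\mu_2n_{\mathcal{K}}\perp\tilde\mu_3n_{\mathcal{K}}$, with $n_{\mathcal{K}}=n|_{\mathcal{K}}$. Writing $\mathcal{C}=\mathcal{K}\oplus\mathcal{K}u\oplus\mathcal{K}v\oplus\mathcal{K}(uv)$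 (Cayley–Dickson doubling twice, with nonisotropic $u\in\mathcal{K}^\perp$, $v\in(\mathcal{K}\oplus\mathcal{K}u)^\perp$) with $n(u)\in\mu(t_1)$, $n(v)\in\mu(t_2)$, $\Gamma_{\mathcal{C}}(G,\mathcal{K},T,\mu)$ is the $G$-grading with $\mathcal{C}_e=\mathcal{K}$, $\mathcal{C}_{t_1}=\mathcal{K}u$, $\mathcal{C}_{t_2}=\mathcal{K}v$, $\mathcal{C}_{t_1t_2}=\mathcal{K}(uv)$. Thus $\mu(t)=n(x)n(\mathcal{K}^\times)$ for any nonzero $x\in\mathcal{C}_t$. It depends, up to isomorphism, only on $\mathcal{K},T,\mu$. * Let $\mathrm{char}\,\mathbb{F}\neq2$ and let $T=\{e,t_1,\dots,t_7\}\subset G$ be an elementary abelian ($2$-)subgroup of order $8$. A homomorphism $\mu\colon T\to\mathbb{F}^\times/(\mathbb{F}^\times)^2$ is admissible if, for representatives $\tilde\mu_i$ of $\mu(t_i)$, $n$ is isometric to $\mathrm{diag}(1,\tilde\mu_1,\dots,\tilde\mu_7)$. Choosing generators $s_1,s_2,s_3$ of $T$ and writing $\mathcal{C}=\mathbb{F}\oplus\mathbb{F}u\oplus\mathbb{F}v\oplus\mathbb{F}uv\oplus\mathbb{F}w\oplus\mathbb{F}uw\oplus\mathbb{F}vw\oplus\mathbb{F}(uv)w$ (Cayley–Dickson doubling three times from $\mathbb{F}$) with $n(u)\in\mu(s_1)$, $n(v)\in\mu(s_2)$, $n(w)\in\mu(s_3)$, $\Gamma_{\mathcal{C}}(G,\mathbb{F},T,\mu)$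 is the $G$-grading determined by $\deg u=s_1$, $\deg v=s_2$, $\deg w=s_3$; so $\mu(t)=n(x)(\mathbb{F}^\times)^2$ for nonzero $x\in\mathcal{C}_t$. It depends, up to isomorphism, only on $T,\mu$. *)

theory Defs
  imports
    "HOL-Analysis.Cartesian_Space"
    "HOL-Algebra.Generated_Groups"
    "HOL-Computational_Algebra.Polynomial"
    "HOL-Library.Function_Algebras"
begin

section \<open>Cayley algebras\<close>

definition polar :: "('c::ab_group_add \<Rightarrow> 'f::field) \<Rightarrow> 'c \<Rightarrow> 'c \<Rightarrow> 'f" where
  "polar n x y = n (x + y) - n x - n y"

text \<open>Nondegeneracy of the norm always refers to its polar form, also in characteristic 2.\<close>

locale cayley_algebra = vector_space scale
  for scale :: "'f::field \<Rightarrow> 'c::ab_group_add \<Rightarrow> 'c" +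
  fixes mul :: "'c \<Rightarrow> 'c \<Rightarrow> 'c" and one :: 'c and n :: "'c \<Rightarrow> 'f"
  assumes mul_linear_right: "\<And>x. Vector_Spaces.linear scale scale (\<lambda>y. mul x y)"
    and mul_linear_left: "\<And>y. Vector_Spaces.linear scale scale (\<lambda>x. mul x y)"
    and one_mul: "\<And>x. mul one x = x"
    and mul_one: "\<And>x. mul x one = x"
    and norm_scale: "\<And>a x. n (scale a x) = a ^ 2 * n x"
    and polar_linear: "\<And>x. Vector_Spaces.linear scale (*) (\<lambda>y. polar n x y)"
    and polar_nondegenerate: "\<And>x. (\<And>y. polar n x y = 0) \<Longrightarrow> x = 0"
    and norm_mult: "\<And>x y. n (mul x y) = n x * n y"
    and dim_8: "dim UNIV = 8"

definition is_split :: "('c::ab_group_add \<Rightarrow> 'f::field) \<Rightarrow> bool" where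
  "is_split n \<longleftrightarrow> (\<exists>x. x \<noteq> 0 \<and> n x = 0)"

definition perp :: "('c::ab_group_add \<Rightarrow> 'f::field) \<Rightarrow> 'c set \<Rightarrow> 'c set" where
  "perp n S = {x. \<forall>y\<in>S. polar n x y = 0}"

definition linear_iso_on ::
  "('f::field \<Rightarrow> 'c::ab_group_add \<Rightarrow> 'c) \<Rightarrow> 'c set \<Rightarrow> ('f \<Rightarrow> 'd::ab_group_add \<Rightarrow> 'd) \<Rightarrow> 'd set
    \<Rightarrow> ('c \<Rightarrow> 'd) \<Rightarrow> bool" where
  "linear_iso_on s1 V1 s2 V2 f \<longleftrightarrow>
     bij_betw f V1 V2 \<and>
     (\<forall>x\<in>V1. \<forall>y\<in>V1. f (x + y) = f x + f y) \<and>
     (\<forall>a. \<forall>x\<in>V1. f (s1 a x) = s2 a (f x))"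

definition algebra_iso_on ::
  "('f::field \<Rightarrow> 'c::ab_group_add \<Rightarrow> 'c) \<Rightarrow> ('c \<Rightarrow> 'c \<Rightarrow> 'c) \<Rightarrow> 'c set
    \<Rightarrow> ('f \<Rightarrow> 'd::ab_group_add \<Rightarrow> 'd) \<Rightarrow> ('d \<Rightarrow> 'd \<Rightarrow> 'd) \<Rightarrow> 'd set \<Rightarrow> ('c \<Rightarrow> 'd) \<Rightarrow> bool" where
  "algebra_iso_on s1 m1 A1 s2 m2 A2 f \<longleftrightarrow>
     linear_iso_on s1 A1 s2 A2 f \<and> (\<forall>x\<in>A1. \<forall>y\<in>A1. f (m1 x y) = m2 (f x) (f y))"

definition isomorphic_subalgebras ::
  "('f::field \<Rightarrow> 'c::ab_group_add \<Rightarrow> 'c) \<Rightarrow> ('c \<Rightarrow> 'c \<Rightarrow> 'c) \<Rightarrow> 'c set \<Rightarrow> 'c set \<Rightarrow> bool" where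
  "isomorphic_subalgebras s m A B \<longleftrightarrow> (\<exists>f. algebra_iso_on s m A s m B f)"

definition isometric ::
  "('f::field \<Rightarrow> 'c::ab_group_add \<Rightarrow> 'c) \<Rightarrow> 'c set \<Rightarrow> ('c \<Rightarrow> 'f)
    \<Rightarrow> ('f \<Rightarrow> 'd::ab_group_add \<Rightarrow> 'd) \<Rightarrow> 'd set \<Rightarrow> ('d \<Rightarrow> 'f) \<Rightarrow> bool" where
  "isometric s1 V1 q1 s2 V2 q2 \<longleftrightarrow>
     (\<exists>f. linear_iso_on s1 V1 s2 V2 f \<and> (\<forall>x\<in>V1. q2 (f x) = q1 x))"


section \<open>Subalgebras\<close>

definition unital_subalgebra ::
  "('f::field \<Rightarrow> 'c::ab_group_add \<Rightarrow> 'c) \<Rightarrow> ('c \<Rightarrow> 'c \<Rightarrow> 'c) \<Rightarrow> 'c \<Rightarrow> 'c set \<Rightarrow> bool" where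
  "unital_subalgebra s m e A \<longleftrightarrow>
     module.subspace s A \<and> e \<in> A \<and> (\<forall>x\<in>A. \<forall>y\<in>A. m x y \<in> A)"

definition all_nonzero_invertible ::
  "('c::ab_group_add \<Rightarrow> 'c \<Rightarrow> 'c) \<Rightarrow> 'c \<Rightarrow> 'c set \<Rightarrow> bool" where
  "all_nonzero_invertible m e A \<longleftrightarrow> (\<forall>x\<in>A. x \<noteq> 0 \<longrightarrow> (\<exists>y\<in>A. m x y = e \<and> m y x = e))"

text \<open>A quaternion algebra is a unital composition algebra of dimension 4; the restriction of the
  norm is automatically multiplicative, so only its nondegeneracy has to be required.\<close>

definition quaternion_division_subalgebra ::
  "('f::field \<Rightarrow> 'c::ab_group_add \<Rightarrow> 'c) \<Rightarrow> ('c \<Rightarrow> 'c \<Rightarrow> 'c) \<Rightarrow> 'c \<Rightarrow> ('c \<Rightarrow> 'f) \<Rightarrow> 'c set \<Rightarrow> bool" where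
  "quaternion_division_subalgebra s m e n Q \<longleftrightarrow>
     unital_subalgebra s m e Q \<and> vector_space.dim s Q = 4 \<and>
     (\<forall>x\<in>Q. (\<forall>y\<in>Q. polar n x y = 0) \<longrightarrow> x = 0) \<and>
     all_nonzero_invertible m e Q"

definition poly_eval ::
  "('f::field \<Rightarrow> 'c::ab_group_add \<Rightarrow> 'c) \<Rightarrow> ('c \<Rightarrow> 'c \<Rightarrow> 'c) \<Rightarrow> 'c \<Rightarrow> 'f poly \<Rightarrow> 'c \<Rightarrow> 'c" where
  "poly_eval s m e p x = (\<Sum>i\<le>degree p. s (coeff p i) ((m x ^^ i) e))"

text \<open>Up to a nonzero scalar, an irreducible polynomial vanishing at \<open>x\<close> is the minimal polynomial
  of \<open>x\<close>; it is separable iff it is coprime to its derivative.\<close>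

definition separable_element ::
  "('f::field \<Rightarrow> 'c::ab_group_add \<Rightarrow> 'c) \<Rightarrow> ('c \<Rightarrow> 'c \<Rightarrow> 'c) \<Rightarrow> 'c \<Rightarrow> 'c \<Rightarrow> bool" where
  "separable_element s m e x \<longleftrightarrow>
     (\<exists>p. irreducible p \<and> coprime p (pderiv p) \<and> poly_eval s m e p x = 0)"

definition quadratic_separable_subfield ::
  "('f::field \<Rightarrow> 'c::ab_group_add \<Rightarrow> 'c) \<Rightarrow> ('c \<Rightarrow> 'c \<Rightarrow> 'c) \<Rightarrow> 'c \<Rightarrow> 'c set \<Rightarrow> bool" where
  "quadratic_separable_subfield s m e K \<longleftrightarrow>
     unital_subalgebra s m e K \<and> vector_space.dim s K = 2 \<and>
     (\<forall>x\<in>K. \<forall>y\<in>K. m x y = m y x) \<and>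
     (\<forall>x\<in>K. \<forall>y\<in>K. \<forall>z\<in>K. m (m x y) z = m x (m y z)) \<and>
     all_nonzero_invertible m e K \<and>
     (\<forall>x\<in>K. separable_element s m e x)"


section \<open>Gradings\<close>

text \<open>A grading is represented by its family of homogeneous components; values of the family outside
  the carrier of the group are irrelevant.\<close>

definition direct_sum_decomposition :: "'g set \<Rightarrow> ('g \<Rightarrow> 'c::ab_group_add set) \<Rightarrow> bool" where
  "direct_sum_decomposition I U \<longleftrightarrow>
     (\<forall>x. \<exists>!f. (\<forall>i\<in>I. f i \<in> U i) \<and> (\<forall>i. i \<notin> I \<longrightarrow> f i = 0) \<and>
               finite {i. f i \<noteq> 0} \<and> x = (\<Sum>i | f i \<noteq> 0. f i))"

definition is_grading ::
  "('g, 'z) monoid_scheme \<Rightarrow> ('f::field \<Rightarrow> 'c::ab_group_add \<Rightarrow> 'c) \<Rightarrow> ('c \<Rightarrow> 'c \<Rightarrow> 'c)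
    \<Rightarrow> ('g \<Rightarrow> 'c set) \<Rightarrow> bool" where
  "is_grading G s m U \<longleftrightarrow>
     (\<forall>g\<in>carrier G. module.subspace s (U g)) \<and>
     direct_sum_decomposition (carrier G) U \<and>
     (\<forall>g\<in>carrier G. \<forall>h\<in>carrier G. \<forall>x\<in>U g. \<forall>y\<in>U h. m x y \<in> U (g \<otimes>\<^bsub>G\<^esub> h))"

definition trivial_grading :: "('g, 'z) monoid_scheme \<Rightarrow> ('g \<Rightarrow> 'c set) \<Rightarrow> bool" where
  "trivial_grading G U \<longleftrightarrow> U \<one>\<^bsub>G\<^esub> = UNIV"

definition isomorphic_gradings ::
  "('g, 'z) monoid_scheme
    \<Rightarrow> ('f::field \<Rightarrow> 'c::ab_group_add \<Rightarrow> 'c) \<Rightarrow> ('c \<Rightarrow> 'c \<Rightarrow> 'c) \<Rightarrow> ('g \<Rightarrow> 'c set)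
    \<Rightarrow> ('f \<Rightarrow> 'd::ab_group_add \<Rightarrow> 'd) \<Rightarrow> ('d \<Rightarrow> 'd \<Rightarrow> 'd) \<Rightarrow> ('g \<Rightarrow> 'd set) \<Rightarrow> bool" where
  "isomorphic_gradings G s1 m1 U1 s2 m2 U2 \<longleftrightarrow>
     (\<exists>f. algebra_iso_on s1 m1 UNIV s2 m2 UNIV f \<and> (\<forall>g\<in>carrier G. f ` U1 g = U2 g))"


section \<open>The split Cayley algebra and its gradings\<close>

text \<open>Index set of a good basis \<open>e\<^sub>1, e\<^sub>2, u\<^sub>1, u\<^sub>2, u\<^sub>3, v\<^sub>1, v\<^sub>2, v\<^sub>3\<close>. The indices 1, 2, 3 are elements
  of the numeral type \<open>3\<close>, in which arithmetic is modulo 3.\<close>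

datatype good_index = Ix_e1 | Ix_e2 | Ix_u 3 | Ix_v 3

instance good_index :: finite
proof
  have "(UNIV :: good_index set) = {Ix_e1, Ix_e2} \<union> range Ix_u \<union> range Ix_v"
    by (auto intro: good_index.exhaust)
  then show "finite (UNIV :: good_index set)"
    by (metis finite.emptyI finite.insertI finite_UnI finite_imageI finite)
qed

definition levi_civita :: "3 \<Rightarrow> 3 \<Rightarrow> 3 \<Rightarrow> 'f::field" where
  "levi_civita j k l =
     (if k = j + 1 \<and> l = j + 2 then 1 else if k = j + 2 \<and> l = j + 1 then - 1 else 0)"

fun good_table :: "good_index \<Rightarrow> good_index \<Rightarrow> 'f::field ^ good_index" where
  "good_table Ix_e1 Ix_e1 = axis Ix_e1 1"
| "good_table Ix_e2 Ix_e2 = axis Ix_e2 1"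
| "good_table Ix_e1 (Ix_u j) = axis (Ix_u j) 1"
| "good_table (Ix_u j) Ix_e2 = axis (Ix_u j) 1"
| "good_table Ix_e2 (Ix_v j) = axis (Ix_v j) 1"
| "good_table (Ix_v j) Ix_e1 = axis (Ix_v j) 1"
| "good_table (Ix_u j) (Ix_u k) = (\<Sum>l\<in>UNIV. levi_civita j k l *s axis (Ix_v l) 1)"
| "good_table (Ix_v j) (Ix_v k) = (\<Sum>l\<in>UNIV. levi_civita j k l *s axis (Ix_u l) 1)"
| "good_table (Ix_u j) (Ix_v k) = (if j = k then - axis Ix_e1 1 else 0)"
| "good_table (Ix_v j) (Ix_u k) = (if j = k then - axis Ix_e2 1 else 0)"
| "good_table _ _ = 0"

definition split_mul ::
  "'f::field ^ good_index \<Rightarrow> 'f ^ good_index \<Rightarrow> 'f ^ good_index" where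
  "split_mul x y = (\<Sum>i\<in>UNIV. \<Sum>j\<in>UNIV. (x $ i * y $ j) *s good_table i j)"

fun good_degree :: "('g, 'z) monoid_scheme \<Rightarrow> (3 \<Rightarrow> 'g) \<Rightarrow> good_index \<Rightarrow> 'g" where
  "good_degree G \<gamma> Ix_e1 = \<one>\<^bsub>G\<^esub>"
| "good_degree G \<gamma> Ix_e2 = \<one>\<^bsub>G\<^esub>"
| "good_degree G \<gamma> (Ix_u i) = \<gamma> i"
| "good_degree G \<gamma> (Ix_v i) = inv\<^bsub>G\<^esub> (\<gamma> i)"

definition Gamma_split ::
  "('g, 'z) monoid_scheme \<Rightarrow> (3 \<Rightarrow> 'g) \<Rightarrow> 'g \<Rightarrow> ('f::field ^ good_index) set" where
  "Gamma_split G \<gamma> g = vec.span {axis b 1 | b. good_degree G \<gamma> b = g}"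

definition triple_of_product_one :: "('g, 'z) monoid_scheme \<Rightarrow> (3 \<Rightarrow> 'g) \<Rightarrow> bool" where
  "triple_of_product_one G \<gamma> \<longleftrightarrow>
     (\<forall>i. \<gamma> i \<in> carrier G) \<and> \<gamma> 1 \<otimes>\<^bsub>G\<^esub> \<gamma> 2 \<otimes>\<^bsub>G\<^esub> \<gamma> 3 = \<one>\<^bsub>G\<^esub>"

definition triple_equiv :: "('g, 'z) monoid_scheme \<Rightarrow> (3 \<Rightarrow> 'g) \<Rightarrow> (3 \<Rightarrow> 'g) \<Rightarrow> bool" where
  "triple_equiv G \<gamma> \<gamma>' \<longleftrightarrow>
     (\<exists>\<pi>. bij \<pi> \<and> ((\<forall>i. \<gamma>' i = \<gamma> (\<pi> i)) \<or> (\<forall>i. \<gamma>' i = inv\<^bsub>G\<^esub> (\<gamma> (\<pi> i)))))"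


section \<open>Gradings supported on elementary abelian 2-subgroups\<close>

definition elementary_abelian_2_subgroup ::
  "('g, 'z) monoid_scheme \<Rightarrow> nat \<Rightarrow> 'g set \<Rightarrow> bool" where
  "elementary_abelian_2_subgroup G k T \<longleftrightarrow>
     subgroup T G \<and> card T = k \<and> (\<forall>t\<in>T. t \<otimes>\<^bsub>G\<^esub> t = \<one>\<^bsub>G\<^esub>)"

definition field_units :: "'f::field monoid" where
  "field_units = \<lparr>carrier = - {0}, monoid.mult = (*), one = 1\<rparr>"

definition norm_group :: "('c::ab_group_add \<Rightarrow> 'f::field) \<Rightarrow> 'c set \<Rightarrow> 'f set" where
  "norm_group n K = n ` (K - {0})"

definition square_group :: "'f::field set" where
  "square_group = (\<lambda>a. a ^ 2) ` (- {0})"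

definition Gamma_Q ::
  "('g, 'z) monoid_scheme \<Rightarrow> ('c::ab_group_add \<Rightarrow> 'f::field) \<Rightarrow> 'c set \<Rightarrow> 'g set
    \<Rightarrow> 'g \<Rightarrow> 'c set" where
  "Gamma_Q G n Q T g =
     (if g = \<one>\<^bsub>G\<^esub> then Q else if g \<in> T then perp n Q else {0})"

text \<open>Admissibility: \<open>r\<close> chooses representatives of the classes \<open>\<mu> t\<close>, normalised by \<open>r \<one> = 1\<close>. The
  orthogonal sum of the forms \<open>r t \<cdot> n\<^sub>K\<close> (respectively \<open>r t \<cdot> X\<^sup>2\<close>) over \<open>t \<in> T\<close> is modelled on the
  space of functions \<open>T \<rightarrow> K\<close> (respectively \<open>T \<rightarrow> F\<close>), extended by 0 outside \<open>T\<close>.\<close>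

definition admissible_K ::
  "('f::field \<Rightarrow> 'c::ab_group_add \<Rightarrow> 'c) \<Rightarrow> ('c \<Rightarrow> 'f) \<Rightarrow> ('g, 'z) monoid_scheme \<Rightarrow> 'c set \<Rightarrow> 'g set
    \<Rightarrow> ('g \<Rightarrow> 'f set) \<Rightarrow> bool" where
  "admissible_K s n G K T \<mu> \<longleftrightarrow>
     \<mu> \<in> hom (G\<lparr>carrier := T\<rparr>) (field_units Mod norm_group n K) \<and>
     (\<exists>r. r \<one>\<^bsub>G\<^esub> = 1 \<and> (\<forall>t\<in>T. r t \<in> \<mu> t) \<and>
        isometric s UNIV n
          (\<lambda>a f t. s a (f t)) {f. (\<forall>t\<in>T. f t \<in> K) \<and> (\<forall>t. t \<notin> T \<longrightarrow> f t = 0)}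
          (\<lambda>f. \<Sum>t\<in>T. r t * n (f t)))"

definition admissible_F ::
  "('f::field \<Rightarrow> 'c::ab_group_add \<Rightarrow> 'c) \<Rightarrow> ('c \<Rightarrow> 'f) \<Rightarrow> ('g, 'z) monoid_scheme \<Rightarrow> 'g set
    \<Rightarrow> ('g \<Rightarrow> 'f set) \<Rightarrow> bool" where
  "admissible_F s n G T \<mu> \<longleftrightarrow>
     \<mu> \<in> hom (G\<lparr>carrier := T\<rparr>) (field_units Mod square_group) \<and>
     (\<exists>r. r \<one>\<^bsub>G\<^esub> = 1 \<and> (\<forall>t\<in>T. r t \<in> \<mu> t) \<and>
        isometric s UNIV n
          (\<lambda>a f t. a * f t) {f. \<forall>t. t \<notin> T \<longrightarrow> f t = 0}
          (\<lambda>f. \<Sum>t\<in>T. r t * (f t) ^ 2))"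

text \<open>The gradings obtained from Cayley--Dickson doubling depend, up to isomorphism, only on
  \<open>K\<close>, \<open>T\<close> and \<open>\<mu>\<close>; a fixed choice of generators of \<open>T\<close> and of the elements \<open>u\<close>, \<open>v\<close> (and \<open>w\<close>)
  therefore represents them.\<close>

definition doubling_grading_K ::
  "('c::ab_group_add \<Rightarrow> 'c \<Rightarrow> 'c) \<Rightarrow> ('c \<Rightarrow> 'f::field) \<Rightarrow> ('g, 'z) monoid_scheme \<Rightarrow> 'c set \<Rightarrow> 'g set
    \<Rightarrow> ('g \<Rightarrow> 'f set) \<Rightarrow> ('g \<Rightarrow> 'c set) \<Rightarrow> bool" where
  "doubling_grading_K m n G K T \<mu> U \<longleftrightarrow>
     (\<exists>t1 t2 u v.
        T = {\<one>\<^bsub>G\<^esub>, t1, t2, t1 \<otimes>\<^bsub>G\<^esub> t2} \<and>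
        u \<in> perp n K \<and> n u \<noteq> 0 \<and>
        v \<in> perp n (K \<union> (\<lambda>x. m x u) ` K) \<and> n v \<noteq> 0 \<and>
        n u \<in> \<mu> t1 \<and> n v \<in> \<mu> t2 \<and>
        U = (\<lambda>g. if g = \<one>\<^bsub>G\<^esub> then K
                 else if g = t1 then (\<lambda>x. m x u) ` K
                 else if g = t2 then (\<lambda>x. m x v) ` K
                 else if g = t1 \<otimes>\<^bsub>G\<^esub> t2 then (\<lambda>x. m x (m u v)) ` K
                 else {0}))"

definition Gamma_K ::
  "('c::ab_group_add \<Rightarrow> 'c \<Rightarrow> 'c) \<Rightarrow> ('c \<Rightarrow> 'f::field) \<Rightarrow> ('g, 'z) monoid_scheme \<Rightarrow> 'c set \<Rightarrow> 'g set
    \<Rightarrow> ('g \<Rightarrow> 'f set) \<Rightarrow> 'g \<Rightarrow> 'c set" where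
  "Gamma_K m n G K T \<mu> = (SOME U. doubling_grading_K m n G K T \<mu> U)"

definition doubling_grading_F ::
  "('f::field \<Rightarrow> 'c::ab_group_add \<Rightarrow> 'c) \<Rightarrow> ('c \<Rightarrow> 'c \<Rightarrow> 'c) \<Rightarrow> 'c \<Rightarrow> ('c \<Rightarrow> 'f)
    \<Rightarrow> ('g, 'z) monoid_scheme \<Rightarrow> 'g set \<Rightarrow> ('g \<Rightarrow> 'f set) \<Rightarrow> ('g \<Rightarrow> 'c set) \<Rightarrow> bool" where
  "doubling_grading_F s m e n G T \<mu> U \<longleftrightarrow>
     (\<exists>s1 s2 s3 u v w.
        s1 \<in> T \<and> s2 \<in> T \<and> s3 \<in> T \<and> generate G {s1, s2, s3} = T \<and>
        u \<in> perp n {e} \<and> n u \<noteq> 0 \<and>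
        v \<in> perp n {e, u} \<and> n v \<noteq> 0 \<and>
        w \<in> perp n {e, u, v, m u v} \<and> n w \<noteq> 0 \<and>
        n u \<in> \<mu> s1 \<and> n v \<in> \<mu> s2 \<and> n w \<in> \<mu> s3 \<and>
        U = (\<lambda>g. module.span s {x. (x, g) \<in>
               {(e, \<one>\<^bsub>G\<^esub>), (u, s1), (v, s2), (m u v, s1 \<otimes>\<^bsub>G\<^esub> s2),
                (w, s3), (m u w, s1 \<otimes>\<^bsub>G\<^esub> s3), (m v w, s2 \<otimes>\<^bsub>G\<^esub> s3),
                (m (m u v) w, s1 \<otimes>\<^bsub>G\<^esub> s2 \<otimes>\<^bsub>G\<^esub> s3)}}))"

definition Gamma_F ::
  "('f::field \<Rightarrow> 'c::ab_group_add \<Rightarrow> 'c) \<Rightarrow> ('c \<Rightarrow> 'c \<Rightarrow> 'c) \<Rightarrow> 'c \<Rightarrow> ('c \<Rightarrow> 'f)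
    \<Rightarrow> ('g, 'z) monoid_scheme \<Rightarrow> 'g set \<Rightarrow> ('g \<Rightarrow> 'f set) \<Rightarrow> 'g \<Rightarrow> 'c set" where
  "Gamma_F s m e n G T \<mu> = (SOME U. doubling_grading_F s m e n G T \<mu> U)"

end

theory Submission
  imports Defs "HOL-Library.Multiset"
begin

text \<open>
Let \<open>W\<close> be a nontrivial grading of a Cayley algebra. The quadratic equation of a homogeneous element
shows that conjugation preserves degrees. Hence components of degrees \<open>g\<close> and \<open>h\<close> are orthogonal
unless \<open>g h\<close> is the identity, and the norm is nondegenerate on the identity component \<open>W \<one>\<close>. What the
grading looks like is decided by whether the norm is isotropic there.

If it is, \<open>W \<one>\<close> contains an idempotent \<open>e1\<close> of norm 0 and trace 1. The Peirce decomposition for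
\<open>e1\<close> and \<open>one - e1\<close> is then a graded one, and the alternating trilinear form that sends \<open>x, y, z\<close> to
the polar form of \<open>xy\<close> and \<open>z\<close> is nonzero on the first Peirce space
(\<open>peirce_trilinear_nonzero\<close>). Three homogeneous vectors on which it takes the value 1, their products
and the two idempotents form a homogeneous good basis (\<open>peirce_good_system\<close>, \<open>split_grading\<close>). In
the other direction the dimensions of the components of such a grading determine the three degrees
up to inverting some of them; as both triples have product \<open>\<one>\<close>, the inversions can be taken to
be all or none (\<open>sign_pattern\<close>).

If the norm is anisotropic on \<open>W \<one>\<close>, every nonzero homogeneous element is invertible. Then all
degrees in the support square to \<open>\<one>\<close>, every component is \<open>W \<one>\<close> times one of its elements, and
different components are orthogonal; the locale \<open>division_grading\<close> collects these properties.
Since the order of the support times the dimension of \<open>W \<one>\<close> is 8, the nontrivial supports have order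
2, 4 or 8, and the identity component is a quaternion algebra, a quadratic field or the ground field.

Two division gradings with the same support are isomorphic as soon as their identity components
are, and corresponding components represent a common norm (\<open>division_gradings_isomorphic\<close>): an
isomorphism already defined over a subgroup \<open>S\<close> of the support extends over \<open>S\<close> and one more degree
by Cayley--Dickson doubling (\<open>doubling_iso\<close>). As isomorphisms preserve norms, this classifies the
gradings whose identity component is commutative by the classes of norms \<open>\<mu>\<close>. For quaternion identity
components the common norm comes from a vector orthogonal to both of them; there is one because both
contain \<open>one\<close>.

Finally, an admissible \<open>\<mu>\<close> has to be realized by elements \<open>u, v\<close> (and \<open>w\<close>) in prescribed
orthogonal complements. Admissibility supplies an orthogonal frame with the right norms, but in the
wrong place. Reflections move it (\<open>witt_vector\<close>, \<open>witt_plane\<close>); in characteristic 2 this succeeds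
because separability of the quadratic subfield makes a discriminant nonzero.
\<close>

section \<open>Composition algebra identities\<close>

context cayley_algebra
begin

abbreviation b :: "'c \<Rightarrow> 'c \<Rightarrow> 'f" where
  "b \<equiv> polar n"

definition cnj :: "'c \<Rightarrow> 'c" where
  "cnj x = scale (b x one) one - x"

lemma mul_add_right: "mul x (y + z) = mul x y + mul x z"
  and mul_scale_right: "mul x (scale a y) = scale a (mul x y)"
  using mul_linear_right[of x] unfolding Vector_Spaces.linear_iff by blast+

lemma mul_add_left: "mul (x + y) z = mul x z + mul y z"
  and mul_scale_left: "mul (scale a x) y = scale a (mul x y)"
  using mul_linear_left[of z] mul_linear_left[of y] unfolding Vector_Spaces.linear_iff by blast+

lemma mul_zero_right [simp]: "mul x 0 = 0"
  using mul_scale_right[of x 0 0] by simp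

lemma mul_zero_left [simp]: "mul 0 x = 0"
  using mul_scale_left[of 0 0 x] by simp

lemma mul_minus_right: "mul x (- y) = - mul x y"
  using mul_add_right[of x y "- y"] by (simp add: eq_neg_iff_add_eq_0 add.commute)

lemma mul_minus_left: "mul (- x) y = - mul x y"
  using mul_add_left[of x "- x" y] by (simp add: eq_neg_iff_add_eq_0 add.commute)

lemma mul_diff_right: "mul x (y - z) = mul x y - mul x z"
  using mul_add_right[of x y "- z"] unfolding mul_minus_right by simp

lemma mul_diff_left: "mul (x - y) z = mul x z - mul y z"
  using mul_add_left[of x "- y" z] unfolding mul_minus_left by simp

lemma mul_sum_right: "mul x (\<Sum>i\<in>I. f i) = (\<Sum>i\<in>I. mul x (f i))"
  by (induction I rule: infinite_finite_induct) (auto simp: mul_add_right)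

lemma mul_sum_left: "mul (\<Sum>i\<in>I. f i) x = (\<Sum>i\<in>I. mul (f i) x)"
  by (induction I rule: infinite_finite_induct) (auto simp: mul_add_left)

lemmas mul_simps = mul_add_right mul_add_left mul_scale_right mul_scale_left mul_minus_right
  mul_minus_left mul_diff_right mul_diff_left one_mul mul_one

lemma b_commute: "b x y = b y x"
  by (simp add: polar_def add.commute algebra_simps)

lemma b_add_right: "b x (y + z) = b x y + b x z"
  and b_scale_right: "b x (scale a y) = a * b x y"
proof -
  have "\<And>y z. b x (y + z) = b x y + b x z" "\<And>a y. b x (scale a y) = a * b x y"
    using polar_linear[of x] unfolding Vector_Spaces.linear_iff by blast+
  then show "b x (y + z) = b x y + b x z" "b x (scale a y) = a * b x y" by blast+
qed

lemma b_add_left: "b (x + y) z = b x z + b y z"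
  and b_scale_left: "b (scale a x) z = a * b x z"
  using b_add_right[of z] b_scale_right[of z] by (simp_all add: b_commute[of _ z])

lemma b_zero_right [simp]: "b x 0 = 0"
  using b_scale_right[of x 0 0] by simp

lemma b_zero_left [simp]: "b 0 x = 0"
  using b_commute[of 0 x] by simp

lemma b_minus_right: "b x (- y) = - b x y"
  using b_add_right[of x y "- y"] by (simp add: eq_neg_iff_add_eq_0 add.commute)

lemma b_minus_left: "b (- x) y = - b x y"
  using b_minus_right[of y x] by (simp add: b_commute[of _ y])

lemma b_diff_right: "b x (y - z) = b x y - b x z"
  using b_add_right[of x y "- z"] unfolding b_minus_right by simp

lemma b_diff_left: "b (x - y) z = b x z - b y z"
  using b_add_left[of x "- y" z] unfolding b_minus_left by simp

lemma b_sum_right: "b x (\<Sum>i\<in>I. f i) = (\<Sum>i\<in>I. b x (f i))"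
  by (induction I rule: infinite_finite_induct) (auto simp: b_add_right)

lemma b_sum_left: "b (\<Sum>i\<in>I. f i) x = (\<Sum>i\<in>I. b (f i) x)"
  by (induction I rule: infinite_finite_induct) (auto simp: b_add_left)

lemmas b_simps = b_add_right b_add_left b_scale_right b_scale_left b_minus_right
  b_minus_left b_diff_right b_diff_left

lemma norm_zero [simp]: "n 0 = 0"
  using norm_scale[of 0 0] by simp

lemma norm_minus [simp]: "n (- x) = n x"
  using norm_scale[of "- 1" x] by simp

lemma norm_add: "n (x + y) = n x + n y + b x y"
  by (simp add: polar_def)

lemma norm_diff: "n (x - y) = n x + n y - b x y"
  using norm_add[of x "- y"] by (simp add: b_minus_right)

lemma b_self: "b x x = 2 * n x"
proof -
  have "n (x + x) = 4 * n x"
    using norm_scale[of 2 x] scale_left_distrib[of 1 1 x] by simp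
  then show ?thesis by (simp add: polar_def)
qed

lemma b_eqI: "(\<And>z. b x z = b y z) \<Longrightarrow> x = y"
  using polar_nondegenerate[of "x - y"] by (simp add: b_diff_left)

lemma nonzero_exists: "\<exists>x::'c. x \<noteq> 0"
proof (rule ccontr)
  assume "\<not> (\<exists>x::'c. x \<noteq> 0)"
  then have "UNIV = {0::'c}" by auto
  then have "UNIV \<subseteq> span ({}::'c set)" by simp
  then have "dim UNIV \<le> card ({}::'c set)"
    by (rule dim_le_card) simp
  then show False using dim_8 by simp
qed

lemma norm_one [simp]: "n one = 1"
proof -
  have "n one \<noteq> 0"
  proof
    assume "n one = 0"
    then have "n x = 0" for x :: 'c
      using norm_mult[of one x] by (simp add: one_mul)
    then have "x = 0" for x :: 'c
      using polar_nondegenerate[of x] by (simp add: polar_def)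
    then show False using nonzero_exists by blast
  qed
  moreover have "n one * n one = n one"
    using norm_mult[of one one] by (simp add: one_mul)
  ultimately show ?thesis by simp
qed

lemma one_neq_zero [simp]: "one \<noteq> 0" "0 \<noteq> one"
  using norm_one norm_zero by force+

text \<open>Polarizing multiplicativity of the norm in one factor and then in the other yields all identities
  below: elements with the same inner products coincide, so they are checked inside the polar form.\<close>

lemma b_mul_left: "b (mul x y) (mul x z) = n x * b y z"
  using norm_mult[of x "y + z"] by (simp add: norm_add norm_mult mul_add_right algebra_simps)

lemma b_mul_right: "b (mul x z) (mul y z) = b x y * n z"
  using norm_mult[of "x + y" z] by (simp add: norm_add norm_mult mul_add_left algebra_simps)

lemma b_mul_mul: "b (mul x y) (mul z w) + b (mul x w) (mul z y) = b x z * b y w"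
  using b_mul_left[of "x + z" y w]
  by (simp add: mul_add_left b_add_left b_add_right b_mul_left norm_add
      b_commute[of "mul x w"] algebra_simps)

lemma adjoint_left: "b (mul x y) z = b y (mul (cnj x) z)"
  using b_mul_mul[of x y one z]
  by (simp add: cnj_def mul_simps b_simps b_commute[of y] algebra_simps)

lemma adjoint_right: "b (mul x y) z = b x (mul z (cnj y))"
  using b_mul_mul[of x y z one]
  by (simp add: cnj_def mul_simps b_simps algebra_simps)

lemma b_one_one: "b one one = 2"
  by (simp add: b_self)

lemma b_cnj_one: "b (cnj x) one = b x one"
  by (simp add: cnj_def b_simps b_one_one)

lemma cnj_cnj [simp]: "cnj (cnj x) = x"
  unfolding cnj_def[of "cnj x"] b_cnj_one by (simp add: cnj_def)

lemma norm_cnj [simp]: "n (cnj x) = n x"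
  by (simp add: cnj_def norm_diff norm_scale b_simps b_commute[of one x] b_one_one power2_eq_square algebra_simps)

lemma cnj_add: "cnj (x + y) = cnj x + cnj y"
  by (simp add: cnj_def b_simps scale_left_distrib)

lemma cnj_one [simp]: "cnj one = one"
  using scale_left_distrib[of 1 1 one] by (simp add: cnj_def b_one_one)

lemma b_cnj_cnj: "b (cnj x) (cnj y) = b x y"
  using norm_cnj[of "x + y"] by (simp add: cnj_add norm_add)

lemma b_cnj: "b (cnj x) y = b x (cnj y)"
  using b_cnj_cnj[of x "cnj y"] by simp

lemma cnj_mul_cancel: "mul (cnj x) (mul x y) = scale (n x) y"
proof (rule b_eqI)
  fix z
  have "b (mul (cnj x) (mul x y)) z = b (mul x y) (mul x z)"
    using adjoint_left[of "cnj x" "mul x y" z] by simp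
  then show "b (mul (cnj x) (mul x y)) z = b (scale (n x) y) z"
    by (simp add: b_mul_left b_simps)
qed

lemma mul_cnj_cancel: "mul (mul y x) (cnj x) = scale (n x) y"
proof (rule b_eqI)
  fix z
  have "b (mul (mul y x) (cnj x)) z = b (mul y x) (mul z x)"
    using adjoint_right[of "mul y x" "cnj x" z] by simp
  then show "b (mul (mul y x) (cnj x)) z = b (scale (n x) y) z"
    by (simp add: b_mul_right b_simps mult.commute)
qed

lemma mul_mul_cnj_cancel: "mul (mul y (cnj x)) x = scale (n x) y"
  using mul_cnj_cancel[of y "cnj x"] by simp

lemma mul_cnj: "mul x (cnj x) = scale (n x) one"
  using mul_cnj_cancel[of one x] by (simp add: one_mul)

lemma cnj_mul: "mul (cnj x) x = scale (n x) one"
  using mul_cnj[of "cnj x"] by simp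

lemma quadratic: "mul x x = scale (b x one) x - scale (n x) one"
  using mul_cnj[of x] by (simp add: cnj_def mul_simps algebra_simps)

lemma cnj_mul_distrib: "cnj (mul x y) = mul (cnj y) (cnj x)"
proof (rule b_eqI)
  fix z
  have "b (mul (cnj y) (cnj x)) z = b (mul y z) (cnj x)"
    using adjoint_left[of "cnj y" "cnj x" z] by (simp add: b_commute)
  also have "\<dots> = b y (mul (cnj x) (cnj z))"
    by (rule adjoint_right)
  also have "\<dots> = b (mul x y) (cnj z)"
    by (simp add: adjoint_left)
  finally show "b (cnj (mul x y)) z = b (mul (cnj y) (cnj x)) z"
    by (simp add: b_cnj)
qed

lemma left_linearized: "mul (cnj x) (mul z y) + mul (cnj z) (mul x y) = scale (b x z) y"
  using cnj_mul_cancel[of "x + z" y]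
  by (simp add: cnj_add mul_simps cnj_mul_cancel norm_add scale_left_distrib algebra_simps)

lemma right_linearized: "mul (mul y x) (cnj z) + mul (mul y z) (cnj x) = scale (b x z) y"
  using mul_cnj_cancel[of y "x + z"]
  by (simp add: cnj_add mul_simps mul_cnj_cancel norm_add scale_left_distrib algebra_simps)

lemma cnj_trace_zero: "b x one = 0 \<Longrightarrow> cnj x = - x"
  by (simp add: cnj_def)

lemma mul_eq_zero_anisotropic: "n x \<noteq> 0 \<Longrightarrow> mul y x = 0 \<Longrightarrow> y = 0"
  using mul_cnj_cancel[of y x] by simp

section \<open>Cayley--Dickson products\<close>

text \<open>For \<open>u\<close> orthogonal to a unital subalgebra \<open>A\<close>, the next four lemmas compute in \<open>A + Au\<close> by
  the Cayley--Dickson rule, so that the product there is determined by that of \<open>A\<close> and by \<open>n u\<close>.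
  The hypotheses list the orthogonality relations between \<open>u\<close> and \<open>A\<close> that enter.\<close>

lemma mul_perp_commute:
  assumes "b u one = 0" "b u (cnj d) = 0"
  shows "mul d u = mul u (cnj d)"
proof -
  have "b (mul d u) one = 0"
    using adjoint_left[of d u one] assms by (simp add: mul_one)
  then have "mul d u = - cnj (mul d u)"
    by (simp add: cnj_trace_zero)
  also have "\<dots> = mul u (cnj d)"
    using assms by (simp add: cnj_mul_distrib cnj_trace_zero mul_minus_left)
  finally show ?thesis .
qed

lemma doubling_left:
  assumes "b u one = 0" "b u (cnj d) = 0" "b u (cnj a) = 0" "b u (cnj (mul d a)) = 0"
  shows "mul a (mul d u) = mul (mul d a) u"
proof -
  have "mul a (mul u (cnj d)) + mul (cnj u) (mul (cnj a) (cnj d)) = 0"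
    using left_linearized[of "cnj a" u "cnj d"] assms(3) by (simp add: b_commute)
  then have "mul a (mul u (cnj d)) = mul u (mul (cnj a) (cnj d))"
    using assms(1) by (simp add: cnj_trace_zero mul_simps)
  then show ?thesis
    using assms by (simp add: mul_perp_commute cnj_mul_distrib)
qed

lemma doubling_right:
  assumes "b u one = 0" "b u (cnj c) = 0"
  shows "mul (mul a u) c = mul (mul a (cnj c)) u"
  using right_linearized[of a u "cnj c"] assms by (simp add: cnj_trace_zero mul_minus_right)

lemma doubling_both:
  assumes "b u one = 0" "b u (cnj a) = 0" "b u (mul (cnj a) d) = 0"
  shows "mul (mul a u) (mul d u) = - scale (n u) (mul (cnj d) a)"
proof -
  have tr: "b (mul a u) one = 0"
    using assms by (simp add: adjoint_left mul_one)
  have orth: "b (mul a u) d = 0"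
    using assms by (simp add: adjoint_left)
  have "mul (mul a u) (mul d u) = mul (cnj d) (mul (mul a u) u)"
    using left_linearized[of "mul a u" d u] tr orth
    by (simp add: cnj_trace_zero mul_minus_left)
  moreover have "mul (mul a u) u = - scale (n u) a"
    using mul_cnj_cancel[of a u, symmetric] assms(1)
    by (simp add: cnj_trace_zero mul_minus_right)
  ultimately show ?thesis by (simp add: mul_simps)
qed

section \<open>Dimensions and orthogonal complements\<close>

definition std_basis :: "'c set" where
  "std_basis = (SOME B. finite B \<and> independent B \<and> span B = UNIV)"

lemma std_basis: "finite std_basis \<and> independent std_basis \<and> span std_basis = UNIV"
proof -
  obtain B :: "'c set" where B: "independent B" "UNIV \<subseteq> span B" "card B = dim (UNIV :: 'c set)"
    using basis_exists[of UNIV] by metis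
  then have "finite B" using dim_8 by (metis card.infinite zero_neq_numeral)
  then show ?thesis
    unfolding std_basis_def
    using someI[of "\<lambda>B. finite B \<and> independent B \<and> span B = UNIV" B] B by auto
qed

sublocale fd: finite_dimensional_vector_space scale std_basis
  by unfold_locales (use std_basis in auto)

lemma subspace_functional: "subspace {x. b a x = 0}"
  by (rule subspaceI) (auto simp: b_simps)

lemma perp_span: "perp n (span S) = perp n S"
proof -
  have "b x y = 0" if "\<forall>y\<in>S. b x y = 0" "y \<in> span S" for x y
    using that(2) span_minimal[OF _ subspace_functional[of x], of S] that(1) by auto
  then show ?thesis unfolding perp_def using span_base by fastforce
qed

lemma subspace_perp: "subspace (perp n S)"
  by (rule subspaceI) (auto simp: perp_def b_simps)

text \<open>Cutting with the kernel of one functional lowers the dimension by at most one; iterating this over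
  a basis of \<open>S\<close> bounds the dimension of its orthogonal complement from below.\<close>

lemma dim_kernel: "subspace V \<Longrightarrow> dim V \<le> Suc (dim {x\<in>V. b a x = 0})"
proof (cases "\<forall>x\<in>V. b a x = 0")
  case True
  then have "{x\<in>V. b a x = 0} = V" by auto
  then show ?thesis by simp
next
  case False
  assume V: "subspace V"
  from False obtain s where s: "s \<in> V" "b a s \<noteq> 0" by auto
  have "V \<subseteq> span (insert s {x\<in>V. b a x = 0})"
  proof
    fix x assume x: "x \<in> V"
    let ?c = "b a x / b a s"
    have "x - scale ?c s \<in> {x\<in>V. b a x = 0}"
      using x s V by (auto simp: b_simps subspace_diff subspace_scale)
    then have "x - scale ?c s \<in> span {x\<in>V. b a x = 0}" by (rule span_base)
    then show "x \<in> span (insert s {x\<in>V. b a x = 0})"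
      unfolding in_span_insert span_insert by auto
  qed
  then have "dim V \<le> dim (insert s {x\<in>V. b a x = 0})" by (rule fd.dim_mono)
  also have "\<dots> \<le> Suc (dim {x\<in>V. b a x = 0})" by (simp add: fd.dim_insert)
  finally show ?thesis .
qed

lemma dim_perp_finite: "finite B \<Longrightarrow> 8 \<le> card B + dim (perp n B)"
proof (induction rule: finite_induct)
  case empty
  show ?case using dim_8 by (simp add: perp_def)
next
  case (insert a B)
  have "perp n (insert a B) = {x \<in> perp n B. b a x = 0}"
    by (auto simp: perp_def b_commute)
  then show ?case
    using insert dim_kernel[OF subspace_perp[of B], of a] by simp
qed

lemma dim_perp: "8 \<le> dim S + dim (perp n S)"
proof -
  obtain B where B: "B \<subseteq> S" "independent B" "S \<subseteq> span B" "card B = dim S"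
    using basis_exists by metis
  have "finite B" using B(2) by (rule fd.finiteI_independent)
  moreover have "perp n B = perp n S"
    using B by (metis order_antisym perp_span span_mono span_span)
  ultimately show ?thesis using dim_perp_finite[of B] B by simp
qed

lemma nonzero_perp_exists:
  assumes "dim S < 8"
  obtains x where "x \<in> perp n S" "x \<noteq> 0"
proof -
  have "dim (perp n S) \<noteq> 0" using dim_perp[of S] assms by linarith
  then have "\<not> perp n S \<subseteq> {0}" using fd.dim_eq_0[of "perp n S"] by metis
  then show ?thesis using that by auto
qed

end

section \<open>Isomorphisms and Cayley--Dickson doubling\<close>

context cayley_algebra
begin

lemma iso_one:
  assumes "unital_subalgebra scale mul one A" "unital_subalgebra scale mul one A'"
    and f: "algebra_iso_on scale mul A scale mul A' f"
  shows "f one = one"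
proof -
  have A: "one \<in> A" "one \<in> A'" using assms by (auto simp: unital_subalgebra_def)
  have bij: "bij_betw f A A'" and hom: "\<And>x y. x \<in> A \<Longrightarrow> y \<in> A \<Longrightarrow> f (mul x y) = mul (f x) (f y)"
    using f by (auto simp: algebra_iso_on_def linear_iso_on_def)
  from bij A obtain e where e: "e \<in> A" "f e = one" by (metis bij_betw_iff_bijections)
  have "f e = f (mul e one)" by (simp add: mul_one)
  also have "\<dots> = f one" using hom[OF e(1) A(1)] e by (simp add: one_mul)
  finally show ?thesis using e by simp
qed

text \<open>The norm is determined by the multiplication: outside of the scalars the coefficients of the
  quadratic equation of an element are unique.\<close>

lemma iso_norm:
  assumes A: "unital_subalgebra scale mul one A" and A': "unital_subalgebra scale mul one A'"
    and f: "algebra_iso_on scale mul A scale mul A' f" and x: "x \<in> A"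
  shows "n (f x) = n x" "b (f x) one = b x one" "f (cnj x) = cnj (f x)"
proof -
  have sub: "subspace A" and oneA: "one \<in> A" and closed: "\<And>x y. x \<in> A \<Longrightarrow> y \<in> A \<Longrightarrow> mul x y \<in> A"
    using A by (auto simp: unital_subalgebra_def)
  have inj: "inj_on f A" and add: "\<And>x y. x \<in> A \<Longrightarrow> y \<in> A \<Longrightarrow> f (x + y) = f x + f y"
    and sc: "\<And>a x. x \<in> A \<Longrightarrow> f (scale a x) = scale a (f x)"
    and hom: "\<And>x y. x \<in> A \<Longrightarrow> y \<in> A \<Longrightarrow> f (mul x y) = mul (f x) (f y)"
    using f by (auto simp: algebra_iso_on_def linear_iso_on_def bij_betw_def)
  note f1 = iso_one[OF A A' f]
  have diff: "f (x - y) = f x - f y" if "x \<in> A" "y \<in> A" for x y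
  proof -
    have "f (x + scale (-1) y) = f x + scale (-1) (f y)"
      using that add[of x "scale (-1) y"] sc[of y "-1"] subspace_scale[OF sub, of y "-1"] by auto
    then show ?thesis by simp
  qed
  have *: "n (f x) = n x \<and> b (f x) one = b x one"
  proof (cases "\<exists>a. x = scale a one")
    case True
    then obtain a where "x = scale a one" by blast
    then show ?thesis using sc[OF oneA] f1 by simp
  next
    case False
    have "f (mul x x) = scale (b x one) (f x) - scale (n x) one"
      using x oneA sub by (simp add: quadratic diff sc f1 subspace_scale)
    then have "scale (b (f x) one - b x one) (f x) = scale (n (f x) - n x) one"
      using hom[OF x x] quadratic[of "f x"] by (simp add: scale_left_diff_distrib algebra_simps)
    then have eq: "scale (b (f x) one - b x one) (f x) = scale (n (f x) - n x) (f one)"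
      by (simp add: f1)
    have "b (f x) one = b x one"
    proof (rule ccontr)
      assume "b (f x) one \<noteq> b x one"
      then have c: "b (f x) one - b x one \<noteq> 0" by simp
      let ?c = "b (f x) one - b x one"
      have "scale (inverse ?c) (scale ?c (f x)) = scale (inverse ?c) (scale (n (f x) - n x) (f one))"
        using eq by simp
      then have "f x = f (scale (inverse ?c * (n (f x) - n x)) one)"
        using c sc[OF oneA] by simp
      then have "x = scale (inverse ?c * (n (f x) - n x)) one"
        using inj x oneA sub by (auto simp: inj_on_def subspace_scale)
      then show False using False by blast
    qed
    with eq show ?thesis by (simp add: f1)
  qed
  then show "n (f x) = n x" "b (f x) one = b x one" by auto
  show "f (cnj x) = cnj (f x)"
    using * x oneA sub by (simp add: cnj_def diff sc f1 subspace_scale)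
qed

definition double :: "'c set \<Rightarrow> 'c \<Rightarrow> 'c set" where
  "double A u = {x + mul y u | x y. x \<in> A \<and> y \<in> A}"

lemma cnj_closed_subalgebra: "unital_subalgebra scale mul one A \<Longrightarrow> x \<in> A \<Longrightarrow> cnj x \<in> A"
  by (simp add: unital_subalgebra_def cnj_def subspace_diff subspace_scale)

lemma perp_mul:
  assumes "unital_subalgebra scale mul one A" "u \<in> perp n A" "x \<in> A" "y \<in> A"
  shows "b x (mul y u) = 0" "b (mul y u) x = 0"
proof -
  have "mul (cnj y) x \<in> A"
    using assms cnj_closed_subalgebra by (auto simp: unital_subalgebra_def)
  then show "b (mul y u) x = 0" using assms by (simp add: adjoint_left perp_def)
  then show "b x (mul y u) = 0" by (simp add: b_commute)
qed

text \<open>An element of \<open>A\<close> that also lies in \<open>Au\<close> is orthogonal to \<open>A\<close>, so nondegeneracy of \<open>A\<close> makes the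
  sum \<open>A + Au\<close> direct.\<close>

lemma double_unique:
  assumes A: "unital_subalgebra scale mul one A"
    and nondeg: "\<And>x. x \<in> A \<Longrightarrow> (\<And>y. y \<in> A \<Longrightarrow> b x y = 0) \<Longrightarrow> x = 0"
    and u: "u \<in> perp n A" "n u \<noteq> 0"
    and xy: "x \<in> A" "y \<in> A" "x' \<in> A" "y' \<in> A" "x + mul y u = x' + mul y' u"
  shows "x = x' \<and> y = y'"
proof -
  have sub: "subspace A" using A by (simp add: unital_subalgebra_def)
  have eq: "x - x' = mul (y' - y) u" using xy(5) by (simp add: mul_simps algebra_simps)
  have "x - x' = 0"
  proof (rule nondeg)
    show "x - x' \<in> A" using sub xy by (simp add: subspace_diff)
    show "b (x - x') z = 0" if "z \<in> A" for z
      unfolding eq by (rule perp_mul(2)[OF A u(1) that]) (use sub xy in \<open>simp add: subspace_diff\<close>)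
  qed
  moreover then have "y' - y = 0" using eq mul_eq_zero_anisotropic[OF u(2)] by metis
  ultimately show ?thesis by simp
qed

lemma double_mul:
  assumes A: "unital_subalgebra scale mul one A" and u: "u \<in> perp n A"
    and "x \<in> A" "y \<in> A" "z \<in> A" "w \<in> A"
  shows "mul (x + mul y u) (z + mul w u)
    = (mul x z - scale (n u) (mul (cnj w) y)) + mul (mul w x + mul y (cnj z)) u"
proof -
  have closed: "\<And>x y. x \<in> A \<Longrightarrow> y \<in> A \<Longrightarrow> mul x y \<in> A" "one \<in> A"
    using A by (auto simp: unital_subalgebra_def)
  note closed = closed cnj_closed_subalgebra[OF A]
  have p: "\<And>x. x \<in> A \<Longrightarrow> b u x = 0" using u by (auto simp: perp_def)
  have "mul x (mul w u) = mul (mul w x) u"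
    by (rule doubling_left) (intro p closed assms)+
  moreover have "mul (mul y u) z = mul (mul y (cnj z)) u"
    by (rule doubling_right) (intro p closed assms)+
  moreover have "mul (mul y u) (mul w u) = - scale (n u) (mul (cnj w) y)"
    by (rule doubling_both) (intro p closed assms)+
  ultimately show ?thesis by (simp add: mul_simps algebra_simps)
qed

text \<open>By \<open>double_mul\<close> the structure constants of \<open>A + Au\<close> involve only \<open>A\<close>, its conjugation and \<open>n u\<close>;
  isomorphisms respect the first two, and the last is assumed to agree.\<close>

lemma doubling_iso:
  assumes A: "unital_subalgebra scale mul one A" and A': "unital_subalgebra scale mul one A'"
    and nondeg: "\<And>x. x \<in> A \<Longrightarrow> (\<And>y. y \<in> A \<Longrightarrow> b x y = 0) \<Longrightarrow> x = 0"
    and nondeg': "\<And>x. x \<in> A' \<Longrightarrow> (\<And>y. y \<in> A' \<Longrightarrow> b x y = 0) \<Longrightarrow> x = 0"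
    and f: "algebra_iso_on scale mul A scale mul A' f"
    and u: "u \<in> perp n A" "n u \<noteq> 0" and u': "u' \<in> perp n A'" "n u' = n u"
  shows "\<exists>F. algebra_iso_on scale mul (double A u) scale mul (double A' u') F \<and>
           (\<forall>x\<in>A. F x = f x) \<and> (\<forall>x\<in>A. F (mul x u) = mul (f x) u')"
proof -
  define F where "F z = (SOME w. \<exists>x\<in>A. \<exists>y\<in>A. z = x + mul y u \<and> w = f x + mul (f y) u')" for z
  have sub: "subspace A" and oneA: "one \<in> A" and closed: "\<And>x y. x \<in> A \<Longrightarrow> y \<in> A \<Longrightarrow> mul x y \<in> A"
    using A by (auto simp: unital_subalgebra_def)
  have sub': "subspace A'" using A' by (auto simp: unital_subalgebra_def)
  have inj: "inj_on f A" and surj: "f ` A = A'"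
    and add: "\<And>x y. x \<in> A \<Longrightarrow> y \<in> A \<Longrightarrow> f (x + y) = f x + f y"
    and sc: "\<And>a x. x \<in> A \<Longrightarrow> f (scale a x) = scale a (f x)"
    and hom: "\<And>x y. x \<in> A \<Longrightarrow> y \<in> A \<Longrightarrow> f (mul x y) = mul (f x) (f y)"
    using f by (auto simp: algebra_iso_on_def linear_iso_on_def bij_betw_def)
  have fA: "\<And>x. x \<in> A \<Longrightarrow> f x \<in> A'" using surj by auto
  have diff: "f (x - y) = f x - f y" if "x \<in> A" "y \<in> A" for x y
  proof -
    have "f (x + scale (-1) y) = f x + scale (-1) (f y)"
      using that add[of x "scale (-1) y"] sc[of y "-1"] subspace_scale[OF sub, of y "-1"] by auto
    then show ?thesis by simp
  qed
  have F: "F (x + mul y u) = f x + mul (f y) u'" if "x \<in> A" "y \<in> A" for x y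
    unfolding F_def
  proof (rule someI2[where a = "f x + mul (f y) u'"])
    show "\<exists>xa\<in>A. \<exists>ya\<in>A. x + mul y u = xa + mul ya u \<and> f x + mul (f y) u' = f xa + mul (f ya) u'"
      using that by blast
  next
    fix w assume "\<exists>xa\<in>A. \<exists>ya\<in>A. x + mul y u = xa + mul ya u \<and> w = f xa + mul (f ya) u'"
    then show "w = f x + mul (f y) u'"
      using double_unique[OF A nondeg u] that by metis
  qed
  have f0: "f 0 = 0" using sc[OF oneA, of 0] by simp
  have zA: "0 \<in> A" using sub by (rule subspace_0)
  have ex: "\<exists>x\<in>A. \<exists>y\<in>A. z = x + mul y u" if "z \<in> double A u" for z
    using that by (auto simp: double_def)
  have F1: "inj_on F (double A u)"
  proof (rule inj_onI)
    fix z z' assume "z \<in> double A u" "z' \<in> double A u" and eq: "F z = F z'"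
    then obtain x y x' y' where xy: "x \<in> A" "y \<in> A" "x' \<in> A" "y' \<in> A"
      "z = x + mul y u" "z' = x' + mul y' u" by (metis ex)
    then have "f x = f x' \<and> f y = f y'"
      using eq F u' u(2) by (intro double_unique[OF A' nondeg' u'(1)]) (auto simp: fA)
    then show "z = z'" using xy inj by (auto simp: inj_on_def)
  qed
  have F2: "F ` double A u = double A' u'"
  proof
    show "F ` double A u \<subseteq> double A' u'"
      unfolding double_def using F fA by fastforce
    show "double A' u' \<subseteq> F ` double A u"
    proof
      fix z assume "z \<in> double A' u'"
      then obtain x y where "x \<in> A" "y \<in> A" "z = f x + mul (f y) u'"
        unfolding double_def using surj by auto
      then have "z = F (x + mul y u)" "x + mul y u \<in> double A u"
        using F by (auto simp: double_def)
      then show "z \<in> F ` double A u" by blast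
    qed
  qed
  have F3: "F (z + z') = F z + F z'" if "z \<in> double A u" "z' \<in> double A u" for z z'
  proof -
    from that obtain x y x' y' where xy: "x \<in> A" "y \<in> A" "x' \<in> A" "y' \<in> A"
      "z = x + mul y u" "z' = x' + mul y' u" by (metis ex)
    then have "z + z' = (x + x') + mul (y + y') u" by (simp add: mul_simps algebra_simps)
    then show ?thesis
      using F[of "x + x'" "y + y'"] F[of x y] F[of x' y'] xy sub
      by (simp add: add subspace_add mul_simps algebra_simps)
  qed
  have F4: "F (scale a z) = scale a (F z)" if "z \<in> double A u" for a z
  proof -
    from that obtain x y where xy: "x \<in> A" "y \<in> A" "z = x + mul y u" by (metis ex)
    then have "scale a z = scale a x + mul (scale a y) u" by (simp add: mul_simps scale_right_distrib)
    then show ?thesis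
      using F[of "scale a x" "scale a y"] F[of x y] xy sub
      by (simp add: sc subspace_scale mul_simps scale_right_distrib)
  qed
  have F5: "F (mul p q) = mul (F p) (F q)" if "p \<in> double A u" "q \<in> double A u" for p q
  proof -
    from that obtain x y z w where xy: "x \<in> A" "y \<in> A" "z \<in> A" "w \<in> A"
      "p = x + mul y u" "q = z + mul w u" by (metis ex)
    note cl = closed cnj_closed_subalgebra[OF A] subspace_diff[OF sub] subspace_scale[OF sub] subspace_add[OF sub]
    have "F (mul p q) = f (mul x z - scale (n u) (mul (cnj w) y)) + mul (f (mul w x + mul y (cnj z))) u'"
      unfolding xy double_mul[OF A u(1) xy(1-4)] using xy by (intro F cl) auto
    also have "\<dots> = mul (f x + mul (f y) u') (f z + mul (f w) u')"
      using xy by (subst double_mul[OF A' u'(1)])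
        (auto simp: fA diff add sc hom cl iso_norm(3)[OF A A' f] u')
    finally show ?thesis using F xy by simp
  qed
  have F6: "F x = f x" "F (mul x u) = mul (f x) u'" if "x \<in> A" for x
    using F[of x 0] F[of 0 x] that zA f0 by auto
  have "algebra_iso_on scale mul (double A u) scale mul (double A' u') F"
    unfolding algebra_iso_on_def linear_iso_on_def bij_betw_def using F1 F2 F3 F4 F5 by simp
  then show ?thesis using F6 by blast
qed

end

section \<open>Division gradings\<close>

lemma (in comm_group) adjoin_involution:
  assumes H: "subgroup H G" and s: "s \<in> carrier G" "s \<otimes> s = \<one>"
  shows "subgroup (H \<union> (\<lambda>h. h \<otimes> s) ` H) G"
proof -
  interpret H: subgroup H G by fact
  have inv_s: "inv s = s" using s by (simp add: inv_equality)
  show ?thesis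
  proof
    show "H \<union> (\<lambda>h. h \<otimes> s) ` H \<subseteq> carrier G" using H.subset s by auto
    show "\<one> \<in> H \<union> (\<lambda>h. h \<otimes> s) ` H" by auto
    show "inv x \<in> H \<union> (\<lambda>h. h \<otimes> s) ` H" if "x \<in> H \<union> (\<lambda>h. h \<otimes> s) ` H" for x
      using that s inv_s by (auto simp: inv_mult)
    show "x \<otimes> y \<in> H \<union> (\<lambda>h. h \<otimes> s) ` H"
      if "x \<in> H \<union> (\<lambda>h. h \<otimes> s) ` H" "y \<in> H \<union> (\<lambda>h. h \<otimes> s) ` H" for x y
    proof -
      have "(h \<otimes> s) \<otimes> (k \<otimes> s) = h \<otimes> k" if "h \<in> H" "k \<in> H" for h k
      proof -
        have "(h \<otimes> s) \<otimes> (k \<otimes> s) = (h \<otimes> k) \<otimes> (s \<otimes> s)"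
          using that s H.subset by (simp add: m_ac subset_iff)
        then show ?thesis using that s by simp
      qed
      moreover have "(h \<otimes> s) \<otimes> k = (h \<otimes> k) \<otimes> s" "h \<otimes> (k \<otimes> s) = (h \<otimes> k) \<otimes> s"
        if "h \<in> H" "k \<in> H" for h k
        using that s H.subset by (simp_all add: m_ac subset_iff)
      ultimately show ?thesis using that by auto
    qed
  qed
qed

locale cayley_grading_group = cayley_algebra scale mul one n + G: comm_group G
  for scale :: "'f::field \<Rightarrow> 'c::ab_group_add \<Rightarrow> 'c" and mul one n
    and G :: "('g, 'z) monoid_scheme" (structure)

text \<open>Gradings over a subgroup \<open>H\<close> of exponent 2 with anisotropic components. The components need not add
  up to the whole algebra, so that the notion applies to each stage of an iterated doubling.\<close>

locale division_grading = cayley_grading_group scale mul one n G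
  for scale :: "'f::field \<Rightarrow> 'c::ab_group_add \<Rightarrow> 'c" and mul one n
    and G :: "('g, 'z) monoid_scheme" (structure) +
  fixes H :: "'g set" and U :: "'g \<Rightarrow> 'c set"
  assumes H_subgroup: "subgroup H G" and H_finite: "finite H"
    and H_square: "\<And>h. h \<in> H \<Longrightarrow> h \<otimes> h = \<one>"
    and one_in: "one \<in> U \<one>"
    and sub: "\<And>h. h \<in> H \<Longrightarrow> subspace (U h)"
    and nonzero: "\<And>h. h \<in> H \<Longrightarrow> \<exists>x\<in>U h. x \<noteq> 0"
    and orthogonal: "\<And>g h x y. \<lbrakk>g \<in> H; h \<in> H; g \<noteq> h; x \<in> U g; y \<in> U h\<rbrakk> \<Longrightarrow> b x y = 0"
    and mul_closed: "\<And>g h x y. \<lbrakk>g \<in> H; h \<in> H; x \<in> U g; y \<in> U h\<rbrakk> \<Longrightarrow> mul x y \<in> U (g \<otimes> h)"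
    and anisotropic: "\<And>h x. h \<in> H \<Longrightarrow> x \<in> U h \<Longrightarrow> x \<noteq> 0 \<Longrightarrow> n x \<noteq> 0"
    and nondeg_one: "\<And>x. x \<in> U \<one> \<Longrightarrow> (\<And>y. y \<in> U \<one> \<Longrightarrow> b x y = 0) \<Longrightarrow> x = 0"
begin

sublocale H: subgroup H G by (rule H_subgroup)

definition total :: "'c set" where
  "total = span (\<Union>h\<in>H. U h)"

lemma in_carrier [simp]: "h \<in> H \<Longrightarrow> h \<in> carrier G"
  using H.subset by auto

lemma mul_square_cancel: "g \<in> carrier G \<Longrightarrow> h \<in> H \<Longrightarrow> (g \<otimes> h) \<otimes> h = g"
  using H_square[of h] by (simp add: G.m_assoc)

lemma cnj_closed: "h \<in> H \<Longrightarrow> x \<in> U h \<Longrightarrow> cnj x \<in> U h"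
proof (cases "h = \<one>")
  case True
  assume "x \<in> U h"
  then show ?thesis
    using True one_in sub[of \<one>] by (auto simp: cnj_def intro!: subspace_diff subspace_scale)
next
  case False
  assume "h \<in> H" "x \<in> U h"
  then show ?thesis
    using False one_in sub[of h] orthogonal[of h \<one> x one]
    by (auto simp: cnj_trace_zero intro!: subspace_neg)
qed

text \<open>Right multiplication by a nonzero homogeneous \<open>x\<close> is inverted, up to the factor \<open>n x\<close>, by right
  multiplication by \<open>cnj x\<close>, which has the same degree.\<close>

lemma component_eq:
  assumes "g \<in> H" "h \<in> H" "x \<in> U h" "x \<noteq> 0"
  shows "U (g \<otimes> h) = (\<lambda>a. mul a x) ` U g"
proof
  show "(\<lambda>a. mul a x) ` U g \<subseteq> U (g \<otimes> h)" using mul_closed assms by auto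
  show "U (g \<otimes> h) \<subseteq> (\<lambda>a. mul a x) ` U g"
  proof
    fix y assume y: "y \<in> U (g \<otimes> h)"
    have nx: "n x \<noteq> 0" using anisotropic assms by auto
    have "mul y (cnj x) \<in> U ((g \<otimes> h) \<otimes> h)"
      using assms y cnj_closed by (intro mul_closed) auto
    then have "scale (1 / n x) (mul y (cnj x)) \<in> U g"
      using mul_square_cancel assms sub by (simp add: subspace_scale)
    moreover have "y = mul (scale (1 / n x) (mul y (cnj x))) x"
      using nx by (simp add: mul_simps mul_mul_cnj_cancel)
    ultimately show "y \<in> (\<lambda>a. mul a x) ` U g" by blast
  qed
qed

lemma component_eq_one:
  assumes "h \<in> H" "x \<in> U h" "x \<noteq> 0"
  shows "U h = (\<lambda>a. mul a x) ` U \<one>"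
  using component_eq[of \<one> h x] assms by simp

lemma nondeg:
  assumes h: "h \<in> H" and x: "x \<in> U h" and perp: "\<And>y. y \<in> U h \<Longrightarrow> b x y = 0"
  shows "x = 0"
proof -
  obtain y0 where y0: "y0 \<in> U h" "y0 \<noteq> 0" using nonzero h by auto
  note eq = component_eq_one[OF h y0]
  from x eq obtain a where a: "a \<in> U \<one>" "x = mul a y0" by auto
  have "a = 0"
  proof (rule nondeg_one[OF a(1)])
    fix c assume "c \<in> U \<one>"
    then have "b (mul a y0) (mul c y0) = 0" using perp eq a by auto
    then show "b a c = 0" using b_mul_right anisotropic[OF h y0] by simp
  qed
  then show ?thesis using a by simp
qed

lemma dim_component: "h \<in> H \<Longrightarrow> dim (U h) = dim (U \<one>)"
proof -
  assume h: "h \<in> H"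
  then obtain x where x: "x \<in> U h" "x \<noteq> 0" using nonzero by auto
  interpret fdp: finite_dimensional_vector_space_pair_1 scale std_basis scale by unfold_locales
  have "dim ((\<lambda>a. mul a x) ` U \<one>) = dim (U \<one>)"
  proof (rule fdp.dim_image_eq[OF mul_linear_left])
    show "inj_on (\<lambda>a. mul a x) (span (U \<one>))"
    proof (rule inj_onI)
      fix a c assume "mul a x = mul c x"
      then have "mul (a - c) x = 0" by (simp add: mul_simps)
      then show "a = c" using mul_eq_zero_anisotropic[of x "a - c"] anisotropic[OF h x] by simp
    qed
  qed
  then show ?thesis using component_eq_one[OF h x] by simp
qed

lemma perp_other_components:
  assumes "S \<subseteq> H" "k \<in> H" "k \<notin> S" "y \<in> U k"
  shows "y \<in> perp n (span (\<Union>h\<in>S. U h))"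
proof -
  have "b y x = 0" if "h \<in> S" "x \<in> U h" for h x
    by (rule orthogonal[of k h]) (use assms that in auto)
  then show ?thesis unfolding perp_span by (auto simp: perp_def)
qed

lemma dim_partial_total:
  assumes "S \<subseteq> H"
  shows "dim (span (\<Union>h\<in>S. U h)) = card S * dim (U \<one>)"
proof -
  have "finite S" using assms H_finite finite_subset by blast
  then show ?thesis using assms
  proof (induction rule: finite_induct)
    case (insert k S)
    let ?V = "span (\<Union>h\<in>S. U h)"
    have k: "k \<in> H" "S \<subseteq> H" using insert by auto
    have "?V \<inter> U k = {0}"
    proof
      show "?V \<inter> U k \<subseteq> {0}"
      proof
        fix x assume x: "x \<in> ?V \<inter> U k"
        have "b x y = 0" if "y \<in> U k" for y
          using perp_other_components[OF k(2,1) insert(2) that] x by (auto simp: perp_def b_commute)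
        then show "x \<in> {0}" using nondeg[OF k(1)] x by auto
      qed
    qed (use sub[OF k(1)] in \<open>auto simp: span_zero subspace_0\<close>)
    then have "dim {x + y |x y. x \<in> ?V \<and> y \<in> U k} = dim ?V + dim (U k)"
      using fd.dim_sums_Int[of ?V "U k"] sub[OF k(1)] by simp
    moreover have "{x + y |x y. x \<in> ?V \<and> y \<in> U k} = span (\<Union>h\<in>insert k S. U h)"
    proof -
      have "(\<Union>h\<in>insert k S. U h) = (\<Union>h\<in>S. U h) \<union> U k" by auto
      then show ?thesis
        using span_Un[of "\<Union>h\<in>S. U h" "U k"] sub[OF k(1)] by (simp add: span_eq_iff[THEN iffD2])
    qed
    ultimately show ?case
      using insert k dim_component[OF k(1)] by simp
  qed simp
qed

lemma dim_total: "dim total = card H * dim (U \<one>)"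
  unfolding total_def by (rule dim_partial_total) simp

lemma total_eq_UNIV: "total = UNIV \<longleftrightarrow> card H * dim (U \<one>) = 8"
proof -
  have "total = UNIV \<longleftrightarrow> dim total = fd.dimension"
    using fd.dim_eq_full[of total] span_span[of "\<Union>h\<in>H. U h"] by (simp only: total_def)
  moreover have "fd.dimension = 8" using dim_8 fd.dim_UNIV by (simp add: fd.dimension_def)
  ultimately show ?thesis by (simp add: dim_total)
qed

lemma decompose:
  assumes "x \<in> total"
  shows "\<exists>f. (\<forall>h\<in>H. f h \<in> U h) \<and> x = (\<Sum>h\<in>H. f h)"
proof -
  let ?S = "{x. \<exists>f. (\<forall>h\<in>H. f h \<in> U h) \<and> x = (\<Sum>h\<in>H. f h)}"
  have "subspace ?S"
  proof (rule subspaceI)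
    show "0 \<in> ?S" using subspace_0[OF sub] by (auto intro!: exI[of _ "\<lambda>_. 0"])
  next
    fix x y assume "x \<in> ?S" "y \<in> ?S"
    then obtain f g where "\<forall>h\<in>H. f h \<in> U h" "x = (\<Sum>h\<in>H. f h)"
      "\<forall>h\<in>H. g h \<in> U h" "y = (\<Sum>h\<in>H. g h)" by auto
    then have "(\<forall>h\<in>H. f h + g h \<in> U h) \<and> x + y = (\<Sum>h\<in>H. f h + g h)"
      using subspace_add[OF sub] by (simp add: sum.distrib)
    then show "x + y \<in> ?S" unfolding mem_Collect_eq by (rule exI[of _ "\<lambda>h. f h + g h"])
  next
    fix a x assume "x \<in> ?S"
    then obtain f where "\<forall>h\<in>H. f h \<in> U h" "x = (\<Sum>h\<in>H. f h)" by auto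
    then have "(\<forall>h\<in>H. scale a (f h) \<in> U h) \<and> scale a x = (\<Sum>h\<in>H. scale a (f h))"
      using subspace_scale[OF sub] by (simp add: scale_sum_right)
    then show "scale a x \<in> ?S" unfolding mem_Collect_eq by (rule exI[of _ "\<lambda>h. scale a (f h)"])
  qed
  moreover have "(\<Union>h\<in>H. U h) \<subseteq> ?S"
  proof
    fix x assume "x \<in> (\<Union>h\<in>H. U h)"
    then obtain k where "k \<in> H" "x \<in> U k" by auto
    then have "(\<forall>h\<in>H. (if h = k then x else 0) \<in> U h) \<and> x = (\<Sum>h\<in>H. if h = k then x else 0)"
      using subspace_0[OF sub] H_finite by simp
    then show "x \<in> ?S" unfolding mem_Collect_eq by (rule exI[of _ "\<lambda>h. if h = k then x else 0"])
  qed
  ultimately have "total \<subseteq> ?S" unfolding total_def by (rule span_minimal[rotated])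
  then show ?thesis using assms by auto
qed

lemma nondeg_total: "x \<in> total \<Longrightarrow> (\<And>y. y \<in> total \<Longrightarrow> b x y = 0) \<Longrightarrow> x = 0"
proof -
  assume x: "x \<in> total" and perp: "\<And>y. y \<in> total \<Longrightarrow> b x y = 0"
  from decompose[OF x] obtain f where f: "\<forall>h\<in>H. f h \<in> U h" "x = (\<Sum>h\<in>H. f h)" by blast
  have "f k = 0" if k: "k \<in> H" for k
  proof (rule nondeg[OF k])
    show "f k \<in> U k" using f k by blast
    fix y assume y: "y \<in> U k"
    have "0 = b x y" using perp y k unfolding total_def by (auto intro!: span_base)
    also have "\<dots> = (\<Sum>h\<in>H. b (f h) y)" by (simp add: f b_sum_left)
    also have "\<dots> = (\<Sum>h\<in>H. if h = k then b (f k) y else 0)"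
      using f k y orthogonal by (intro sum.cong) auto
    finally show "b (f k) y = 0" using k H_finite by simp
  qed
  then show ?thesis using f by simp
qed

lemma total_subalgebra: "unital_subalgebra scale mul one total"
proof -
  have "mul x y \<in> total" if xy: "x \<in> total" "y \<in> total" for x y
  proof -
    from decompose xy obtain f g where f: "\<forall>h\<in>H. f h \<in> U h" "x = (\<Sum>h\<in>H. f h)"
      and g: "\<forall>h\<in>H. g h \<in> U h" "y = (\<Sum>h\<in>H. g h)" by metis
    have "mul x y = (\<Sum>i\<in>H. mul (f i) y)" unfolding f(2) by (rule mul_sum_left)
    also have "\<dots> = (\<Sum>i\<in>H. \<Sum>j\<in>H. mul (f i) (g j))" unfolding g(2) mul_sum_right ..
    also have "\<dots> \<in> total"
      unfolding total_def using f g mul_closed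
      by (intro span_sum) (auto intro!: span_base)
    finally show ?thesis .
  qed
  moreover have "one \<in> total" unfolding total_def using one_in H.one_closed by (blast intro: span_base)
  ultimately show ?thesis unfolding unital_subalgebra_def by (simp add: total_def)
qed

lemma restrict:
  assumes "subgroup H' G" "H' \<subseteq> H"
  shows "division_grading scale mul one n G H' U"
proof (intro division_grading.intro division_grading_axioms.intro cayley_grading_group_axioms)
  show "subgroup H' G" by fact
  show "finite H'" using assms H_finite finite_subset by blast
  show "one \<in> U \<one>" by (rule one_in)
  show "h \<otimes> h = \<one>" "subspace (U h)" "\<exists>x\<in>U h. x \<noteq> 0" if "h \<in> H'" for h
    using that assms H_square sub nonzero by auto
  show "b x y = 0" if "g \<in> H'" "h \<in> H'" "g \<noteq> h" "x \<in> U g" "y \<in> U h" for g h x y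
    by (rule orthogonal[of g h]) (use that assms in auto)
  show "mul x y \<in> U (g \<otimes> h)" if "g \<in> H'" "h \<in> H'" "x \<in> U g" "y \<in> U h" for g h x y
    by (rule mul_closed) (use that assms in auto)
  show "n x \<noteq> 0" if "h \<in> H'" "x \<in> U h" "x \<noteq> 0" for h x
    by (rule anisotropic[of h]) (use that assms in auto)
  show "x = 0" if "x \<in> U \<one>" "\<And>y. y \<in> U \<one> \<Longrightarrow> b x y = 0" for x
    using nondeg_one that by auto
qed

lemma total_adjoin:
  assumes s: "s \<in> carrier G"
    and U': "\<And>h. h \<in> H \<Longrightarrow> U' h = U h" "\<And>h. h \<in> H \<Longrightarrow> U' (h \<otimes> s) = (\<lambda>x. mul x u) ` U h"
  shows "span (\<Union>h\<in>H \<union> (\<lambda>h. h \<otimes> s) ` H. U' h) = double total u"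
proof -
  interpret lin: Vector_Spaces.linear scale scale "\<lambda>x. mul x u" by (rule mul_linear_left)
  have "(\<Union>h\<in>H \<union> (\<lambda>h. h \<otimes> s) ` H. U' h) = (\<Union>h\<in>H. U h) \<union> (\<lambda>x. mul x u) ` (\<Union>h\<in>H. U h)"
    using U' by auto
  moreover have "span ((\<lambda>x. mul x u) ` (\<Union>h\<in>H. U h)) = (\<lambda>x. mul x u) ` total"
    unfolding total_def by (rule lin.span_image)
  ultimately have "span (\<Union>h\<in>H \<union> (\<lambda>h. h \<otimes> s) ` H. U' h)
      = {x + y |x y. x \<in> total \<and> y \<in> (\<lambda>x. mul x u) ` total}"
    by (simp only: span_Un total_def)
  then show ?thesis unfolding double_def by blast
qed

text \<open>One step of Cayley--Dickson doubling turns a division grading over \<open>H\<close> into one over the subgroup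
  generated by \<open>H\<close> and \<open>s\<close>, with \<open>u\<close> placed in degree \<open>s\<close>.\<close>

lemma adjoin:
  assumes s: "s \<in> carrier G" "s \<notin> H" "s \<otimes> s = \<one>"
    and u: "u \<in> perp n (\<Union>h\<in>H. U h)" "n u \<noteq> 0"
    and U': "\<And>h. h \<in> H \<Longrightarrow> U' h = U h" "\<And>h. h \<in> H \<Longrightarrow> U' (h \<otimes> s) = (\<lambda>x. mul x u) ` U h"
  shows "division_grading scale mul one n G (H \<union> (\<lambda>h. h \<otimes> s) ` H) U'"
proof -
  note A = total_subalgebra
  have uA: "u \<in> perp n total" using u(1) by (simp add: total_def perp_span)
  have in_total: "x \<in> total" if "h \<in> H" "x \<in> U h" for h x
    using that unfolding total_def by (auto intro!: span_base)
  have mixed: "b x (mul y u) = 0" "b (mul y u) x = 0" if "x \<in> U g" "y \<in> U h" "g \<in> H" "h \<in> H" for x y g h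
    using perp_mul[OF A uA in_total in_total] that by auto
  have hs: "h \<otimes> s \<notin> H" if "h \<in> H" for h
  proof
    assume "h \<otimes> s \<in> H"
    then have "inv h \<otimes> (h \<otimes> s) \<in> H" using that by blast
    then show False using that s by (simp add: G.m_assoc[symmetric])
  qed
  have cancel: "h = k" if "h \<otimes> s = k \<otimes> s" "h \<in> H" "k \<in> H" for h k
    using that s by (simp add: G.right_cancel)
  show ?thesis
  proof (intro division_grading.intro division_grading_axioms.intro cayley_grading_group_axioms)
    show "subgroup (H \<union> (\<lambda>h. h \<otimes> s) ` H) G" using G.adjoin_involution[OF H_subgroup] s by simp
    show "finite (H \<union> (\<lambda>h. h \<otimes> s) ` H)" using H_finite by simp
    show "one \<in> U' \<one>" using U'(1)[of \<one>] one_in by simp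
    show "x = 0" if "x \<in> U' \<one>" "\<And>y. y \<in> U' \<one> \<Longrightarrow> b x y = 0" for x
      using that U'(1)[of \<one>] nondeg_one by simp
  next
    fix h assume "h \<in> H \<union> (\<lambda>h. h \<otimes> s) ` H"
    then consider "h \<in> H" | k where "k \<in> H" "h = k \<otimes> s" by auto
    then show "h \<otimes> h = \<one>"
    proof cases
      case 2
      have "(k \<otimes> s) \<otimes> (k \<otimes> s) = (k \<otimes> k) \<otimes> (s \<otimes> s)"
        using 2 s by (simp add: G.m_ac)
      then show ?thesis using 2 s H_square by simp
    qed (use H_square in auto)
  next
    fix h assume "h \<in> H \<union> (\<lambda>h. h \<otimes> s) ` H"
    then consider "h \<in> H" | k where "k \<in> H" "h = k \<otimes> s" by auto
    then show "subspace (U' h)"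
    proof cases
      case 2
      interpret lin: Vector_Spaces.linear scale scale "\<lambda>x. mul x u" by (rule mul_linear_left)
      show ?thesis using 2 U'(2) sub lin.subspace_image by simp
    qed (use U' sub in auto)
  next
    fix h assume "h \<in> H \<union> (\<lambda>h. h \<otimes> s) ` H"
    then consider "h \<in> H" | k where "k \<in> H" "h = k \<otimes> s" by auto
    then show "\<exists>x\<in>U' h. x \<noteq> 0"
    proof cases
      case 2
      then show ?thesis using nonzero[of k] U'(2)[of k] mul_eq_zero_anisotropic[OF u(2)] by auto
    qed (use U' nonzero in auto)
  next
    fix h x assume "h \<in> H \<union> (\<lambda>h. h \<otimes> s) ` H" and x: "x \<in> U' h" "x \<noteq> 0"
    then consider "h \<in> H" | k where "k \<in> H" "h = k \<otimes> s" by auto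
    then show "n x \<noteq> 0"
    proof cases
      case 2
      then obtain y where y: "x = mul y u" "y \<in> U k" using x U'(2)[of k] by auto
      then have "y \<noteq> 0" using x by auto
      then show ?thesis using anisotropic 2 y u by (simp add: norm_mult)
    qed (use U' anisotropic x in auto)
  next
    fix g h x y
    assume g: "g \<in> H \<union> (\<lambda>h. h \<otimes> s) ` H" and h: "h \<in> H \<union> (\<lambda>h. h \<otimes> s) ` H"
      and ne: "g \<noteq> h" and x: "x \<in> U' g" and y: "y \<in> U' h"
    have cases: "(k \<in> H \<and> z \<in> U k) \<or> (\<exists>l a. l \<in> H \<and> k = l \<otimes> s \<and> z = mul a u \<and> a \<in> U l)"
      if "k \<in> H \<union> (\<lambda>h. h \<otimes> s) ` H" "z \<in> U' k" for k z
      using that U' by auto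
    from cases[OF g x] consider "g \<in> H" "x \<in> U g"
      | k a where "k \<in> H" "g = k \<otimes> s" "x = mul a u" "a \<in> U k" by blast
    note g_cases = this
    from cases[OF h y] consider "h \<in> H" "y \<in> U h"
      | l d where "l \<in> H" "h = l \<otimes> s" "y = mul d u" "d \<in> U l" by blast
    then show "b x y = 0"
    proof cases
      case 1
      note h1 = this
      from g_cases show ?thesis
      proof cases
        case 1
        then show ?thesis using orthogonal[of g h] h1 ne by simp
      next
        case (2 k a)
        then show ?thesis using mixed(2)[of y h a k] h1 by simp
      qed
    next
      case (2 l d)
      note h2 = this
      from g_cases show ?thesis
      proof cases
        case 1
        then show ?thesis using mixed(1)[of x g d l] h2 by simp
      next
        case (2 k a)
        then show ?thesis using orthogonal[of k l a d] h2 ne by (auto simp: b_mul_right)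
      qed
    qed
  next
    fix g h x y
    assume g: "g \<in> H \<union> (\<lambda>h. h \<otimes> s) ` H" and h: "h \<in> H \<union> (\<lambda>h. h \<otimes> s) ` H"
      and x: "x \<in> U' g" and y: "y \<in> U' h"
    have p: "b u x = 0" if "x \<in> U h" "h \<in> H" for x h using u(1) that by (auto simp: perp_def)
    have p1: "b u one = 0" by (rule p[OF one_in]) simp
    have pc: "b u (cnj x) = 0" if "x \<in> U h" "h \<in> H" for x h
      by (rule p[of _ h]) (use that cnj_closed in auto)
    from g consider "g \<in> H" | k where "k \<in> H" "g = k \<otimes> s" by auto
    then show "mul x y \<in> U' (g \<otimes> h)"
    proof cases
      case 1
      note g = 1
      from h consider "h \<in> H" | k where "k \<in> H" "h = k \<otimes> s" by auto
      then show ?thesis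
      proof cases
        case 1
        then show ?thesis using g x y U' mul_closed by auto
      next
        case (2 k)
        then obtain d where d: "d \<in> U k" "y = mul d u" using y U' by auto
        have x: "x \<in> U g" using x g U' by simp
        have "mul x (mul d u) = mul (mul d x) u"
          by (rule doubling_left[OF p1 pc[OF d(1) 2(1)] pc[OF x g]
                pc[OF mul_closed[OF 2(1) g d(1) x] H.m_closed[OF 2(1) g]]])
        moreover have "mul d x \<in> U (k \<otimes> g)" using d x 2 g mul_closed by auto
        moreover have "g \<otimes> h = (k \<otimes> g) \<otimes> s" using 2 g s by (simp add: G.m_ac)
        ultimately show ?thesis using 2 g d U'(2)[of "k \<otimes> g"] by auto
      qed
    next
      case (2 k)
      then obtain a where a: "a \<in> U k" "x = mul a u" using x U' by auto
      note g = 2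
      from h consider "h \<in> H" | l where "l \<in> H" "h = l \<otimes> s" by auto
      then show ?thesis
      proof cases
        case 1
        then have y: "y \<in> U h" using y U' by simp
        have "mul (mul a u) y = mul (mul a (cnj y)) u"
          by (rule doubling_right[OF p1 pc[OF y 1]])
        moreover have "mul a (cnj y) \<in> U (k \<otimes> h)" using a 1 y g cnj_closed mul_closed by auto
        moreover have "g \<otimes> h = (k \<otimes> h) \<otimes> s" using 1 g s by (simp add: G.m_ac)
        ultimately show ?thesis using 1 g a U'(2)[of "k \<otimes> h"] by auto
      next
        case (2 l)
        then obtain d where d: "d \<in> U l" "y = mul d u" using y U' by auto
        have "mul (mul a u) (mul d u) = - scale (n u) (mul (cnj d) a)"
          by (rule doubling_both[OF p1 pc[OF a(1) g(1)]
                p[OF mul_closed[OF g(1) 2(1) cnj_closed[OF g(1) a(1)] d(1)] H.m_closed[OF g(1) 2(1)]]])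
        moreover have "mul (cnj d) a \<in> U (l \<otimes> k)" using a d g 2 cnj_closed mul_closed by auto
        moreover have "g \<otimes> h = (l \<otimes> k) \<otimes> (s \<otimes> s)" using 2 g s by (simp add: G.m_ac)
        ultimately show ?thesis
          using 2 g a d s U'(1)[of "l \<otimes> k"] sub[of "l \<otimes> k"] by (auto intro!: subspace_neg subspace_scale)
      qed
    qed
  qed
qed

end

section \<open>Isomorphism of division gradings\<close>

context cayley_grading_group
begin

text \<open>Among the subgroups of \<open>T\<close> over which the two gradings are isomorphic, the trivial one being provided
  by \<open>f\<close>, take a largest one, \<open>S\<close>. If some degree \<open>s\<close> were left out, elements of degree \<open>s\<close> of equal
  norm would allow a doubling step to the larger subgroup generated by \<open>S\<close> and \<open>s\<close>.\<close>

lemma division_gradings_isomorphic: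
  assumes U: "division_grading scale mul one n G T U"
    and V: "division_grading scale mul one n G T V"
    and full: "card T * dim (U \<one>) = 8" "card T * dim (V \<one>) = 8"
    and f: "algebra_iso_on scale mul (U \<one>) scale mul (V \<one>) f"
    and norms: "\<And>t. t \<in> T \<Longrightarrow> \<exists>x\<in>U t. \<exists>x'\<in>V t. n x \<noteq> 0 \<and> n x' = n x"
  shows "\<exists>F. algebra_iso_on scale mul UNIV scale mul UNIV F \<and> (\<forall>t\<in>T. F ` U t = V t)"
proof -
  interpret U: division_grading scale mul one n G T U by fact
  interpret V: division_grading scale mul one n G T V by fact
  define P where "P S \<longleftrightarrow> subgroup S G \<and> S \<subseteq> T \<and>
    (\<exists>F. algebra_iso_on scale mul (span (\<Union>h\<in>S. U h)) scale mul (span (\<Union>h\<in>S. V h)) F \<and>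
         (\<forall>h\<in>S. F ` U h = V h))" for S
  have span_one: "span (U \<one>) = U \<one>" "span (V \<one>) = V \<one>"
    using U.sub[of \<one>] V.sub[of \<one>] span_eq_iff U.H.one_closed by blast+
  have "f ` U \<one> = V \<one>"
    using f by (auto simp: algebra_iso_on_def linear_iso_on_def bij_betw_def)
  moreover have "algebra_iso_on scale mul (span (U \<one>)) scale mul (span (V \<one>)) f"
    unfolding span_one by (rule f)
  ultimately have "P {\<one>}"
    unfolding P_def using G.triv_subgroup by (auto intro!: exI[of _ f])
  moreover have "\<forall>S. P S \<longrightarrow> card S < Suc (card T)"
    unfolding P_def using card_mono[OF U.H_finite] by (simp add: less_Suc_eq_le)
  ultimately have "\<exists>S. P S \<and> (\<forall>S'. P S' \<longrightarrow> card S' \<le> card S)"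
    by (rule ex_has_greatest_nat)
  then obtain S where S: "P S" and max: "\<And>S'. P S' \<Longrightarrow> card S' \<le> card S" by auto
  from S obtain F where F: "algebra_iso_on scale mul (span (\<Union>h\<in>S. U h)) scale mul (span (\<Union>h\<in>S. V h)) F"
      "\<And>h. h \<in> S \<Longrightarrow> F ` U h = V h" and sS: "subgroup S G" "S \<subseteq> T"
    unfolding P_def by blast
  have "S = T"
  proof (rule ccontr)
    assume "S \<noteq> T"
    then obtain s where s: "s \<in> T" "s \<notin> S" using sS by auto
    interpret SU: division_grading scale mul one n G S U using U.restrict sS by simp
    interpret SV: division_grading scale mul one n G S V using V.restrict sS by simp
    have tot: "span (\<Union>h\<in>S. U h) = SU.total" "span (\<Union>h\<in>S. V h) = SV.total"
      by (simp_all add: SU.total_def SV.total_def)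
    obtain x x' where x: "x \<in> U s" "x' \<in> V s" "n x \<noteq> 0" "n x' = n x"
      using norms[OF s(1)] by blast
    have x0: "x \<noteq> 0" "x' \<noteq> 0" using x by auto
    have xp: "x \<in> perp n SU.total" "x' \<in> perp n SV.total"
      unfolding tot[symmetric]
      using U.perp_other_components[OF sS(2) s x(1)] V.perp_other_components[OF sS(2) s x(2)] by auto
    obtain F' where F': "algebra_iso_on scale mul (double SU.total x) scale mul (double SV.total x') F'"
      "\<And>y. y \<in> SU.total \<Longrightarrow> F' y = F y" "\<And>y. y \<in> SU.total \<Longrightarrow> F' (mul y x) = mul (F y) x'"
      using doubling_iso[OF SU.total_subalgebra SV.total_subalgebra SU.nondeg_total SV.nondeg_total
          F(1)[unfolded tot] xp(1) x(3) xp(2) x(4)] by blast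
    let ?S = "S \<union> (\<lambda>h. h \<otimes> s) ` S"
    have eqU: "U (h \<otimes> s) = (\<lambda>y. mul y x) ` U h" if "h \<in> S" for h
      using U.component_eq[of h s x] that s sS x x0 by auto
    have eqV: "V (h \<otimes> s) = (\<lambda>y. mul y x') ` V h" if "h \<in> S" for h
      using V.component_eq[of h s x'] that s sS x x0 by auto
    have sc: "s \<in> carrier G" using s by simp
    have in_tot: "y \<in> SU.total" if "y \<in> U h" "h \<in> S" for y h
      using that unfolding SU.total_def by (blast intro: span_base)
    have "P ?S"
      unfolding P_def
    proof (intro conjI exI[of _ F'])
      show "subgroup ?S G"
        using G.adjoin_involution[OF sS(1) sc] U.H_square[OF s(1)] by simp
      show "?S \<subseteq> T" using sS s by auto
      show "algebra_iso_on scale mul (span (\<Union>h\<in>?S. U h)) scale mul (span (\<Union>h\<in>?S. V h)) F'"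
        using F'(1) SU.total_adjoin[OF sc, of U x] SV.total_adjoin[OF sc, of V x'] eqU eqV by simp
      show "\<forall>h\<in>?S. F' ` U h = V h"
      proof
        fix h assume "h \<in> ?S"
        then consider "h \<in> S" | k where "k \<in> S" "h = k \<otimes> s" by auto
        then show "F' ` U h = V h"
        proof cases
          case 1
          then have "F' ` U h = F ` U h" using F'(2) in_tot by (intro image_cong) auto
          then show ?thesis using F(2) 1 by simp
        next
          case 2
          have "F' ` U h = (\<lambda>y. mul (F y) x') ` U k"
            unfolding 2 eqU[OF 2(1)] image_image using F'(3) in_tot 2 by (intro image_cong) auto
          also have "\<dots> = (\<lambda>y. mul y x') ` (F ` U k)" by (simp add: image_image)
          finally show ?thesis using F(2)[OF 2(1)] eqV[OF 2(1)] 2 by simp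
        qed
      qed
    qed
    then have "card ?S \<le> card S" by (rule max)
    moreover have "s \<in> ?S" using SU.H.one_closed sc by (auto intro!: image_eqI[of _ _ \<one>])
    moreover have "finite ?S" using SU.H_finite by simp
    ultimately have "?S = S" by (intro card_subset_eq[symmetric]) (auto intro: card_mono le_antisym)
    then show False using s \<open>s \<in> ?S\<close> by simp
  qed
  moreover have "span (\<Union>h\<in>T. U h) = UNIV" "span (\<Union>h\<in>T. V h) = UNIV"
    using U.total_eq_UNIV V.total_eq_UNIV full unfolding U.total_def V.total_def by auto
  ultimately show ?thesis using F by (intro exI[of _ F]) simp
qed

end

section \<open>Homogeneous components\<close>

locale cayley_graded = cayley_grading_group scale mul one n G
  for scale :: "'f::field \<Rightarrow> 'c::ab_group_add \<Rightarrow> 'c" and mul one n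
    and G :: "('g, 'z) monoid_scheme" (structure) +
  fixes W :: "'g \<Rightarrow> 'c set"
  assumes grading: "is_grading G scale mul W"
begin

lemma sub: "g \<in> carrier G \<Longrightarrow> subspace (W g)"
  using grading by (simp add: is_grading_def)

lemma mul_closed: "g \<in> carrier G \<Longrightarrow> h \<in> carrier G \<Longrightarrow> x \<in> W g \<Longrightarrow> y \<in> W h \<Longrightarrow> mul x y \<in> W (g \<otimes> h)"
  using grading unfolding is_grading_def by blast

text \<open>The families whose unique existence defines a direct sum decomposition; \<open>comp x g\<close> below is the
  homogeneous component of \<open>x\<close> of degree \<open>g\<close>.\<close>

definition decomposes :: "'c \<Rightarrow> ('g \<Rightarrow> 'c) \<Rightarrow> bool" where
  "decomposes x f \<longleftrightarrow> (\<forall>i\<in>carrier G. f i \<in> W i) \<and> (\<forall>i. i \<notin> carrier G \<longrightarrow> f i = 0) \<and>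
     finite {i. f i \<noteq> 0} \<and> x = (\<Sum>i | f i \<noteq> 0. f i)"

definition comp :: "'c \<Rightarrow> 'g \<Rightarrow> 'c" where
  "comp x = (THE f. decomposes x f)"

lemma ex1_decomposes: "\<exists>!f. decomposes x f"
  using grading unfolding is_grading_def direct_sum_decomposition_def decomposes_def by blast

lemma decomposes_comp: "decomposes x (comp x)"
  unfolding comp_def by (rule theI'[OF ex1_decomposes])

lemma comp_unique: "decomposes x f \<Longrightarrow> comp x = f"
  using ex1_decomposes decomposes_comp by blast

lemma comp_in: "g \<in> carrier G \<Longrightarrow> comp x g \<in> W g"
  and comp_out: "g \<notin> carrier G \<Longrightarrow> comp x g = 0"
  and finite_comp: "finite {g. comp x g \<noteq> 0}"
  and comp_sum: "x = (\<Sum>g | comp x g \<noteq> 0. comp x g)"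
  using decomposes_comp[of x] unfolding decomposes_def by blast+

lemma comp_homogeneous:
  assumes "g \<in> carrier G" "x \<in> W g"
  shows "comp x = (\<lambda>h. if h = g then x else 0)"
proof (rule comp_unique)
  have "{h. (if h = g then x else 0) \<noteq> 0} = (if x = 0 then {} else {g})" by auto
  then show "decomposes x (\<lambda>h. if h = g then x else 0)"
    using assms subspace_0[OF sub] by (auto simp: decomposes_def)
qed

lemma comp_add: "comp (x + y) g = comp x g + comp y g"
proof -
  have "decomposes (x + y) (\<lambda>g. comp x g + comp y g)"
    unfolding decomposes_def
  proof (intro conjI ballI allI impI)
    let ?S = "{g. comp x g \<noteq> 0} \<union> {g. comp y g \<noteq> 0}"
    have fin: "finite ?S" using finite_comp by simp
    have subset: "{g. comp x g + comp y g \<noteq> 0} \<subseteq> ?S" by auto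
    show "finite {g. comp x g + comp y g \<noteq> 0}" using finite_subset[OF subset fin] .
    have x: "x = (\<Sum>g\<in>?S. comp x g)"
      using fin by (subst comp_sum[of x]) (auto intro!: sum.mono_neutral_left)
    have y: "y = (\<Sum>g\<in>?S. comp y g)"
      using fin by (subst comp_sum[of y]) (auto intro!: sum.mono_neutral_left)
    have "x + y = (\<Sum>g\<in>?S. comp x g) + (\<Sum>g\<in>?S. comp y g)" using x y by simp
    also have "\<dots> = (\<Sum>g\<in>?S. comp x g + comp y g)" by (rule sum.distrib[symmetric])
    also have "(\<Sum>g\<in>?S. comp x g + comp y g) = (\<Sum>g | comp x g + comp y g \<noteq> 0. comp x g + comp y g)"
      using fin subset by (intro sum.mono_neutral_right) auto
    finally show "x + y = (\<Sum>g | comp x g + comp y g \<noteq> 0. comp x g + comp y g)" .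
  qed (auto simp: comp_out comp_in intro!: subspace_add[OF sub])
  from comp_unique[OF this] show ?thesis by simp
qed

lemma comp_zero [simp]: "comp 0 g = 0"
  using comp_add[of 0 0 g] by simp

lemma comp_sum_distrib: "comp (\<Sum>i\<in>I. f i) g = (\<Sum>i\<in>I. comp (f i) g)"
  by (induction I rule: infinite_finite_induct) (auto simp: comp_add)

lemma homogeneous_disjoint:
  assumes "x \<in> W g" "x \<in> W h" "g \<in> carrier G" "h \<in> carrier G" "g \<noteq> h"
  shows "x = 0"
proof -
  have "comp x g = x" using comp_homogeneous[OF assms(3,1)] by simp
  moreover have "comp x g = 0" using comp_homogeneous[OF assms(4,2)] assms(5) by simp
  ultimately show ?thesis by simp
qed

lemma homogeneous_induct:
  assumes "\<And>g x. g \<in> carrier G \<Longrightarrow> x \<in> W g \<Longrightarrow> P x" "P 0" "\<And>x y. P x \<Longrightarrow> P y \<Longrightarrow> P (x + y)"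
  shows "P x"
proof -
  have "P (comp x g)" for g
    using assms comp_in[of g x] comp_out[of g x] by (cases "g \<in> carrier G") auto
  then have "P (\<Sum>g\<in>S. comp x g)" for S
    by (induction S rule: infinite_finite_induct) (auto simp: assms)
  then show ?thesis using comp_sum[of x] by metis
qed

text \<open>The degree \<open>\<one>\<close> component of \<open>one\<close> is a left identity: compare the components of degree \<open>h\<close> in
  \<open>one \<cdot> x = x\<close> for \<open>x\<close> of degree \<open>h\<close>.\<close>

lemma one_in: "one \<in> W \<one>"
proof -
  let ?e = "comp one \<one>"
  have hom: "mul ?e x = x" if h: "h \<in> carrier G" and x: "x \<in> W h" for h x
  proof -
    let ?S = "{g. comp one g \<noteq> 0}"
    have "x = mul (\<Sum>g\<in>?S. comp one g) x" using comp_sum[of one] by (simp add: one_mul)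
    also have "\<dots> = (\<Sum>g\<in>?S. mul (comp one g) x)" by (rule mul_sum_left)
    finally have "comp x h = comp (\<Sum>g\<in>?S. mul (comp one g) x) h" by simp
    then have "x = (\<Sum>g\<in>?S. comp (mul (comp one g) x) h)"
      using comp_homogeneous[OF h x] by (simp add: comp_sum_distrib)
    also have "\<dots> = (\<Sum>g\<in>?S. if g = \<one> then mul ?e x else 0)"
    proof (rule sum.cong[OF refl])
      fix g assume "g \<in> ?S"
      then have g: "g \<in> carrier G" using comp_out by force
      have "mul (comp one g) x \<in> W (g \<otimes> h)" using mul_closed[OF g h comp_in[OF g] x] .
      then have "comp (mul (comp one g) x) h = (if h = g \<otimes> h then mul (comp one g) x else 0)"
        using comp_homogeneous[OF G.m_closed[OF g h]] by simp
      then show "comp (mul (comp one g) x) h = (if g = \<one> then mul ?e x else 0)"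
        using g h by (auto simp: G.r_cancel_one')
    qed
    also have "\<dots> = mul ?e x" using finite_comp[of one] by auto
    finally show ?thesis by simp
  qed
  have "mul ?e x = x" for x
    by (induction x rule: homogeneous_induct) (auto simp: hom mul_add_right)
  from this[of one] have "?e = one" by (simp add: mul_one)
  then show ?thesis using comp_in[of \<one> one] by simp
qed

text \<open>In the quadratic equation of \<open>x\<close> the linear term is the only one of degree \<open>g\<close>, as \<open>g\<^sup>2\<close> and \<open>\<one>\<close>
  differ from \<open>g\<close>.\<close>

lemma trace_zero:
  assumes g: "g \<in> carrier G" "g \<noteq> \<one>" and x: "x \<in> W g"
  shows "b x one = 0"
proof -
  have "scale (b x one) x = mul x x + scale (n x) one" by (simp add: quadratic)
  then have "comp (scale (b x one) x) g = comp (mul x x) g + comp (scale (n x) one) g"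
    by (simp add: comp_add)
  moreover have "comp (scale (b x one) x) g = scale (b x one) x"
    using comp_homogeneous[OF g(1) subspace_scale[OF sub[OF g(1)] x]] by simp
  moreover have "comp (mul x x) g = 0"
    using comp_homogeneous[OF _ mul_closed[OF g(1) g(1) x x]] g by simp
  moreover have "comp (scale (n x) one) g = 0"
    using comp_homogeneous[OF _ subspace_scale[OF sub one_in]] g by simp
  ultimately show ?thesis by auto
qed

lemma cnj_in: "g \<in> carrier G \<Longrightarrow> x \<in> W g \<Longrightarrow> cnj x \<in> W g"
proof (cases "g = \<one>")
  case True
  assume "x \<in> W g"
  then show ?thesis using True one_in sub[of \<one>] by (auto simp: cnj_def intro!: subspace_diff subspace_scale)
next
  case False
  assume "g \<in> carrier G" "x \<in> W g"
  then show ?thesis using False trace_zero sub[of g] by (auto simp: cnj_trace_zero intro!: subspace_neg)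
qed

lemma b_eq_trace: "b x y = b (mul x (cnj y)) one"
  using adjoint_right[of x "cnj y" one] by (simp add: one_mul)

text \<open>The polar form of \<open>x\<close> and \<open>y\<close> is the trace of \<open>x \<cdot> cnj y\<close>, which is homogeneous of degree \<open>g h\<close>.\<close>

lemma b_orthogonal:
  assumes "g \<in> carrier G" "h \<in> carrier G" "g \<otimes> h \<noteq> \<one>" "x \<in> W g" "y \<in> W h"
  shows "b x y = 0"
  unfolding b_eq_trace[of x y] by (rule trace_zero[OF _ assms(3)]) (auto intro!: mul_closed cnj_in assms)

lemma norm_homogeneous_zero:
  assumes "g \<in> carrier G" "g \<otimes> g \<noteq> \<one>" "x \<in> W g"
  shows "n x = 0"
proof -
  have "mul x (cnj x) \<in> W (g \<otimes> g)" using assms by (intro mul_closed cnj_in) auto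
  then have "scale (n x) one \<in> W (g \<otimes> g)" by (simp add: mul_cnj)
  moreover have "scale (n x) one \<in> W \<one>" using one_in sub by (simp add: subspace_scale)
  ultimately have "scale (n x) one = 0" 
    by (rule homogeneous_disjoint) (use assms in auto)
  then show ?thesis by simp
qed

lemma nondeg_pairing:
  assumes g: "g \<in> carrier G" and x: "x \<in> W g" and perp: "\<And>y. y \<in> W (inv g) \<Longrightarrow> b x y = 0"
  shows "x = 0"
proof (rule polar_nondegenerate)
  fix y
  show "b x y = 0"
  proof (induction y rule: homogeneous_induct)
    case (1 h y)
    show ?case
    proof (cases "g \<otimes> h = \<one>")
      case True
      then have "h = inv g" using g 1 G.inv_equality[of h g] G.m_comm[of g h] by simp
      then show ?thesis using perp 1 by simp
    qed (use b_orthogonal g 1 x in blast)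
  qed (auto simp: b_simps)
qed

definition support :: "'g set" where
  "support = {g \<in> carrier G. \<exists>x\<in>W g. x \<noteq> 0}"

text \<open>A nonzero homogeneous \<open>x\<close> pairs nontrivially with some \<open>y\<close> of inverse degree; then \<open>x \<cdot> cnj y\<close> is a
  nonzero element of degree \<open>\<one>\<close>, and its norm \<open>n x * n y\<close> does not vanish. This passes anisotropy from
  \<open>W \<one>\<close> to all components.\<close>

lemma anisotropic_components:
  assumes aniso: "\<And>x. x \<in> W \<one> \<Longrightarrow> x \<noteq> 0 \<Longrightarrow> n x \<noteq> 0"
    and g: "g \<in> carrier G" and x: "x \<in> W g" "x \<noteq> 0"
  shows "n x \<noteq> 0" "g \<otimes> g = \<one>"
proof -
  obtain y where y: "y \<in> W (inv g)" "b x y \<noteq> 0" using nondeg_pairing[OF g x(1)] x(2) by blast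
  have "mul x (cnj y) \<in> W (g \<otimes> inv g)" using g x y by (intro mul_closed cnj_in) auto
  moreover have "mul x (cnj y) \<noteq> 0" using y(2) unfolding b_eq_trace[of x y] by auto
  ultimately have "n (mul x (cnj y)) \<noteq> 0" using aniso g by simp
  then show "n x \<noteq> 0" by (auto simp: norm_mult)
  then show "g \<otimes> g = \<one>" using norm_homogeneous_zero g x by blast
qed

text \<open>A homogeneous element whose degree occurs in no vector of a basis is orthogonal to that basis, since
  here all degrees are their own inverses.\<close>

lemma finite_support_anisotropic:
  assumes aniso: "\<And>x. x \<in> W \<one> \<Longrightarrow> x \<noteq> 0 \<Longrightarrow> n x \<noteq> 0"
  shows "finite support"
proof (rule finite_subset)
  let ?S = "\<Union>z\<in>std_basis. {g. comp z g \<noteq> 0}"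
  show "finite ?S" by (rule finite_UN_I) (use finite_comp std_basis in simp_all)
  show "support \<subseteq> ?S"
  proof (rule ccontr)
    assume "\<not> support \<subseteq> ?S"
    then obtain g x where g: "g \<in> carrier G" "g \<notin> ?S" and x: "x \<in> W g" "x \<noteq> 0"
      by (auto simp: support_def)
    have gg: "g \<otimes> g = \<one>" using anisotropic_components[OF aniso g(1) x] by simp
    have "b x z = 0" if z: "z \<in> std_basis" for z
    proof -
      have "b x z = (\<Sum>h | comp z h \<noteq> 0. b x (comp z h))"
        by (subst comp_sum[of z]) (rule b_sum_right)
      also have "\<dots> = 0"
      proof (rule sum.neutral, rule ballI)
        fix h assume h: "h \<in> {h. comp z h \<noteq> 0}"
        then have hc: "h \<in> carrier G" using comp_out by force
        have "h \<noteq> g" using h g z by auto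
        then have "g \<otimes> h \<noteq> \<one>" using gg[symmetric] g hc by simp
        then show "b x (comp z h) = 0" using b_orthogonal g x hc comp_in by blast
      qed
      finally show ?thesis .
    qed
    then have "x \<in> perp n (span std_basis)" unfolding perp_span by (simp add: perp_def)
    then have "b x y = 0" for y using std_basis by (simp add: perp_def)
    then show False using polar_nondegenerate x by blast
  qed
qed

lemma division_grading_support:
  assumes aniso: "\<And>x. x \<in> W \<one> \<Longrightarrow> x \<noteq> 0 \<Longrightarrow> n x \<noteq> 0"
  shows "division_grading scale mul one n G support W"
proof (intro division_grading.intro division_grading_axioms.intro cayley_grading_group_axioms)
  have c: "g \<in> carrier G" if "g \<in> support" for g using that by (simp add: support_def)
  have sq: "g \<otimes> g = \<one>" if "g \<in> support" for g
    using that anisotropic_components[OF aniso] by (auto simp: support_def)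
  show "subgroup support G"
  proof
    show "support \<subseteq> carrier G" using c by auto
    show "\<one> \<in> support" unfolding support_def using one_in one_neq_zero(1) G.one_closed by blast
    show "inv g \<in> support" if "g \<in> support" for g
      using that sq[OF that] c[OF that] G.inv_equality[of g g] by simp
    show "g \<otimes> h \<in> support" if gh: "g \<in> support" "h \<in> support" for g h
    proof -
      from gh obtain x y where "x \<in> W g" "x \<noteq> 0" "y \<in> W h" "y \<noteq> 0" by (auto simp: support_def)
      moreover from this have "n x \<noteq> 0" "n y \<noteq> 0"
        using anisotropic_components(1)[OF aniso c[OF gh(1)]] anisotropic_components(1)[OF aniso c[OF gh(2)]]
        by auto
      then have "mul x y \<noteq> 0" using norm_mult[of x y] by auto
      moreover from calculation have "mul x y \<in> W (g \<otimes> h)"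
        by (intro mul_closed c gh) auto
      moreover have "g \<otimes> h \<in> carrier G" using c gh by simp
      ultimately show ?thesis unfolding support_def by blast
    qed
  qed
  show "finite support" by (rule finite_support_anisotropic[OF aniso])
  show "h \<otimes> h = \<one>" if "h \<in> support" for h by (rule sq[OF that])
  show "one \<in> W \<one>" by (rule one_in)
  show "subspace (W h)" if "h \<in> support" for h by (rule sub[OF c[OF that]])
  show "\<exists>x\<in>W h. x \<noteq> 0" if "h \<in> support" for h using that by (simp add: support_def)
  show "b x y = 0" if "g \<in> support" "h \<in> support" "g \<noteq> h" "x \<in> W g" "y \<in> W h" for g h x y
  proof (rule b_orthogonal[OF c c _ that(4,5)])
    show "g \<otimes> h \<noteq> \<one>"
      using that(3) sq[OF that(1), symmetric] c[OF that(1)] c[OF that(2)] by simp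
  qed (use that in auto)
  show "mul x y \<in> W (g \<otimes> h)" if "g \<in> support" "h \<in> support" "x \<in> W g" "y \<in> W h" for g h x y
    by (rule mul_closed[OF c c]) (use that in auto)
  show "n x \<noteq> 0" if "h \<in> support" "x \<in> W h" "x \<noteq> 0" for h x
    by (rule anisotropic_components(1)[OF aniso c]) (use that in auto)
  show "x = 0" if "x \<in> W \<one>" "\<And>y. y \<in> W \<one> \<Longrightarrow> b x y = 0" for x
    using nondeg_pairing[of \<one> x] that by simp
qed

lemma span_support: "span (\<Union>g\<in>support. W g) = UNIV"
proof -
  have "x \<in> span (\<Union>g\<in>support. W g)" for x
  proof (induction x rule: homogeneous_induct)
    case (1 g x)
    show ?case
    proof (cases "x = 0")
      case True
      then show ?thesis by (simp only: span_zero)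
    next
      case False
      then have "g \<in> support" using 1 by (auto simp: support_def)
      then have "x \<in> (\<Union>g\<in>support. W g)" using 1 by blast
      then show ?thesis by (rule span_base)
    qed
  qed (auto simp: span_zero span_add)
  then show ?thesis by auto
qed

end

section \<open>Quaternion subalgebras and quadratic subfields\<close>

lemma coprime_irreducible:
  fixes p q :: "'f::field poly"
  assumes p: "irreducible p" and nd: "\<not> p dvd q"
  shows "coprime p q"
proof (rule coprimeI)
  fix c assume c: "c dvd p" "c dvd q"
  then obtain d where d: "p = c * d" by (elim dvdE)
  show "is_unit c"
  proof (rule ccontr)
    assume "\<not> is_unit c"
    then have "is_unit d" using irreducibleD[OF p d] by blast
    then have "p dvd c" unfolding d by (simp add: mult_unit_dvd_iff)
    then show False using c nd dvd_trans by blast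
  qed
qed

lemma irreducible_small_degree:
  fixes p :: "'f::field poly"
  assumes deg: "degree p = 1 \<or> degree p = 2 \<and> (\<forall>c. poly p c \<noteq> 0)"
  shows "irreducible p"
proof (rule irreducibleI)
  show p0: "p \<noteq> 0" using deg by auto
  show "\<not> is_unit p" using deg p0 by (auto simp: is_unit_iff_degree)
  fix q r assume p: "p = q * r"
  then have qr: "q \<noteq> 0" "r \<noteq> 0" "degree p = degree q + degree r" using p0 by (auto simp: degree_mult_eq)
  have root: "\<exists>c. poly s c = 0" if "degree s = 1" for s :: "'f poly"
  proof -
    define c d where "c = coeff s 0" and "d = coeff s 1"
    have s: "s = [:c, d:]"
      by (intro poly_eqI) (use that in \<open>auto simp: c_def d_def coeff_pCons coeff_eq_0 split: nat.splits\<close>)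
    then have "d \<noteq> 0" using that by auto
    then have "poly s (- c / d) = 0" using s by simp
    then show ?thesis by blast
  qed
  have "degree q \<noteq> 1 \<or> degree r \<noteq> 1"
    using root[of q] p deg qr(3) by auto
  then have "degree q = 0 \<or> degree r = 0" using deg qr(3) by auto
  then show "is_unit q \<or> is_unit r" using qr by (auto simp: is_unit_iff_degree)
qed

context cayley_algebra
begin

lemma norm_invertible:
  assumes "all_nonzero_invertible mul one A" "x \<in> A" "x \<noteq> 0"
  shows "n x \<noteq> 0"
proof -
  obtain y where "mul x y = one" using assms by (auto simp: all_nonzero_invertible_def)
  then have "n x * n y = 1" using norm_mult[of x y] by simp
  then show ?thesis by auto
qed

lemma invertible_anisotropic:
  assumes A: "unital_subalgebra scale mul one A" and aniso: "\<And>x. x \<in> A \<Longrightarrow> x \<noteq> 0 \<Longrightarrow> n x \<noteq> 0"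
  shows "all_nonzero_invertible mul one A"
  unfolding all_nonzero_invertible_def
proof (intro ballI impI)
  fix x assume x: "x \<in> A" "x \<noteq> 0"
  let ?y = "scale (1 / n x) (cnj x)"
  have "?y \<in> A" using A cnj_closed_subalgebra[OF A x(1)] by (simp add: unital_subalgebra_def subspace_scale)
  moreover have "mul x ?y = one" "mul ?y x = one"
    using aniso[OF x] by (simp_all add: mul_simps mul_cnj cnj_mul)
  ultimately show "\<exists>y\<in>A. mul x y = one \<and> mul y x = one" by blast
qed

lemma perp_complement:
  assumes A: "subspace A" and nondeg: "\<And>x. x \<in> A \<Longrightarrow> (\<And>y. y \<in> A \<Longrightarrow> b x y = 0) \<Longrightarrow> x = 0"
  shows "dim A + dim (perp n A) = 8" "\<exists>a\<in>A. \<exists>p\<in>perp n A. x = a + p"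
proof -
  have int: "A \<inter> perp n A = {0}"
    using nondeg subspace_0[OF A] by (auto simp: perp_def)
  let ?S = "{x + y |x y. x \<in> A \<and> y \<in> perp n A}"
  have sum: "dim ?S = dim A + dim (perp n A)"
    using fd.dim_sums_Int[OF A subspace_perp[of A]] int by simp
  have le: "dim ?S \<le> 8" using fd.dim_subset[of ?S UNIV] dim_8 by simp
  show eq: "dim A + dim (perp n A) = 8" using dim_perp[of A] sum le by linarith
  have "span ?S = UNIV"
    using fd.dim_eq_full[of ?S] sum eq dim_8 fd.dim_UNIV by (simp add: fd.dimension_def)
  moreover have "span ?S = ?S" using subspace_sums[OF A subspace_perp] by (simp only: span_eq_iff)
  ultimately have "x \<in> ?S" by (metis UNIV_I)
  then show "\<exists>a\<in>A. \<exists>p\<in>perp n A. x = a + p" by blast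
qed

text \<open>The norm cannot vanish identically on the complement of \<open>A\<close>, because the polar form does not.\<close>

lemma perp_nonisotropic:
  assumes A: "subspace A" and nondeg: "\<And>x. x \<in> A \<Longrightarrow> (\<And>y. y \<in> A \<Longrightarrow> b x y = 0) \<Longrightarrow> x = 0"
    and dim: "dim A < 8"
  obtains u where "u \<in> perp n A" "n u \<noteq> 0"
proof -
  obtain u where u: "u \<in> perp n A" "u \<noteq> 0" using nonzero_perp_exists[OF dim] by blast
  then obtain y where y: "b u y \<noteq> 0" using polar_nondegenerate by blast
  obtain a p where ap: "a \<in> A" "p \<in> perp n A" "y = a + p"
    using perp_complement(2)[OF A nondeg, of y] by blast
  have "b u a = 0" using u(1) ap(1) unfolding perp_def by blast
  then have "b u p \<noteq> 0" using y ap(3) by (simp add: b_simps)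
  then have "n u \<noteq> 0 \<or> n p \<noteq> 0 \<or> n (u + p) \<noteq> 0" by (auto simp: norm_add)
  moreover have "u + p \<in> perp n A" using u ap subspace_add[OF subspace_perp] by blast
  ultimately show ?thesis using that u ap by blast
qed

lemma double_perp:
  assumes A: "unital_subalgebra scale mul one A"
    and nondeg: "\<And>x. x \<in> A \<Longrightarrow> (\<And>y. y \<in> A \<Longrightarrow> b x y = 0) \<Longrightarrow> x = 0"
    and dim: "dim A = 4" and u: "u \<in> perp n A" "n u \<noteq> 0"
  shows "perp n A = (\<lambda>x. mul x u) ` A"
proof -
  have sub: "subspace A" using A by (simp add: unital_subalgebra_def)
  interpret lin: Vector_Spaces.linear scale scale "\<lambda>x. mul x u" by (rule mul_linear_left)
  interpret fdp: finite_dimensional_vector_space_pair_1 scale std_basis scale by unfold_locales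
  have "dim ((\<lambda>x. mul x u) ` A) = dim A"
  proof (rule fdp.dim_image_eq[OF mul_linear_left], rule inj_onI)
    fix x y assume "mul x u = mul y u"
    then have "mul (x - y) u = 0" by (simp add: mul_simps)
    then show "x = y" using mul_eq_zero_anisotropic[OF u(2)] by force
  qed
  moreover have "dim (perp n A) = 4" using perp_complement(1)[OF sub nondeg] dim by simp
  moreover have "(\<lambda>x. mul x u) ` A \<subseteq> perp n A"
    using perp_mul(2)[OF A u(1)] by (auto simp: perp_def)
  ultimately have "(\<lambda>x. mul x u) ` A = perp n A"
    by (intro fd.subspace_dim_equal lin.subspace_image sub subspace_perp) (simp_all add: dim)
  then show ?thesis by simp
qed

lemma poly_eval_bound:
  assumes "degree p \<le> N"
  shows "poly_eval scale mul one p x = (\<Sum>i\<le>N. scale (coeff p i) ((mul x ^^ i) one))"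
  unfolding poly_eval_def
  by (rule sum.mono_neutral_left) (use assms in \<open>auto simp: coeff_eq_0\<close>)

lemma poly_eval_add: "poly_eval scale mul one (p + q) x = poly_eval scale mul one p x + poly_eval scale mul one q x"
proof -
  let ?N = "max (degree p) (degree q)"
  have "degree (p + q) \<le> ?N" by (simp add: degree_add_le)
  then show ?thesis
    using poly_eval_bound[of "p + q" ?N x] poly_eval_bound[of p ?N x] poly_eval_bound[of q ?N x]
    by (simp add: scale_left_distrib sum.distrib)
qed

lemma poly_eval_smult: "poly_eval scale mul one (smult a p) x = scale a (poly_eval scale mul one p x)"
  using poly_eval_bound[of "smult a p" "degree p" x] poly_eval_bound[of p "degree p" x]
  by (simp add: scale_sum_right)

lemma poly_eval_pCons: "poly_eval scale mul one (pCons a p) x = scale a one + mul x (poly_eval scale mul one p x)"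
proof -
  have "poly_eval scale mul one (pCons a p) x
      = (\<Sum>i\<le>Suc (degree p). scale (coeff (pCons a p) i) ((mul x ^^ i) one))"
    by (rule poly_eval_bound) (simp add: degree_pCons_le)
  also have "\<dots> = scale a one + (\<Sum>i\<le>degree p. mul x (scale (coeff p i) ((mul x ^^ i) one)))"
    by (simp add: sum.atMost_Suc_shift mul_scale_right del: sum.atMost_Suc)
  finally show ?thesis unfolding poly_eval_def by (simp add: mul_sum_right)
qed

lemma poly_eval_0: "poly_eval scale mul one 0 x = 0"
  by (simp add: poly_eval_def)

lemma poly_eval_mult_zero:
  assumes "poly_eval scale mul one q x = 0"
  shows "poly_eval scale mul one (q * p) x = 0"
proof (induction p)
  case 0
  show ?case by (simp add: poly_eval_0)
next
  case (pCons a p)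
  have "q * pCons a p = smult a q + pCons 0 (q * p)" by (simp add: mult_pCons_right)
  then show ?case using pCons assms by (simp add: poly_eval_add poly_eval_smult poly_eval_pCons)
qed

lemma char_poly_root: "poly_eval scale mul one [:n x, - b x one, 1:] x = 0"
  by (simp add: poly_eval_pCons poly_eval_0 mul_simps quadratic)

text \<open>Up to a scalar the quadratic equation is the minimal polynomial of a nonscalar \<open>x\<close>, the remainder on division by it
  having degree at most 1.\<close>

lemma char_poly_dvd:
  assumes x: "\<And>a. x \<noteq> scale a one" and p: "poly_eval scale mul one p x = 0"
  shows "[:n x, - b x one, 1:] dvd p"
proof -
  let ?q = "[:n x, - b x one, 1:]"
  have q0: "?q \<noteq> 0" by simp
  obtain r0 r1 where r: "p mod ?q = [:r0, r1:]"
  proof -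
    have "p mod ?q = 0 \<or> degree (p mod ?q) < degree ?q" using degree_mod_less[OF q0] .
    then have "degree (p mod ?q) \<le> 1" by auto
    then have "p mod ?q = [:coeff (p mod ?q) 0, coeff (p mod ?q) 1:]"
      by (intro poly_eqI) (auto simp: coeff_pCons coeff_eq_0 split: nat.splits)
    then show ?thesis using that by blast
  qed
  have "p = ?q * (p div ?q) + [:r0, r1:]" unfolding r[symmetric] by (metis mult_div_mod_eq)
  then have "poly_eval scale mul one [:r0, r1:] x = 0"
    using p poly_eval_mult_zero[OF char_poly_root[of x]] by (metis poly_eval_add add_0)
  then have eq: "scale r0 one + scale r1 x = 0" by (simp add: poly_eval_pCons poly_eval_0 mul_simps)
  have "r1 = 0"
  proof (rule ccontr)
    assume r1: "r1 \<noteq> 0"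
    have "scale r1 x = scale (- r0) one" using eq by (simp add: eq_neg_iff_add_eq_0 add.commute)
    then have "scale (inverse r1) (scale r1 x) = scale (inverse r1) (scale (- r0) one)" by simp
    then have "x = scale (inverse r1 * - r0) one" using r1 by simp
    then show False using x by blast
  qed
  moreover from this have "r0 = 0" using eq by simp
  ultimately have "p mod ?q = 0" using r by simp
  then show ?thesis by (simp add: mod_eq_0_iff_dvd)
qed

lemma subfield_dim2_not_scalar:
  assumes "subspace K" "one \<in> K" "dim K = 2"
  obtains a where "a \<in> K" "\<And>c. a \<noteq> scale c one"
proof -
  have "\<not> K \<subseteq> span {one}"
  proof
    assume "K \<subseteq> span {one}"
    then have "dim K \<le> card {one}" by (rule dim_le_card) simp
    then show False using assms by simp
  qed
  then obtain a where "a \<in> K" "a \<notin> span {one}" by blast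
  then show ?thesis using that by (auto simp: span_singleton)
qed

lemma dim2_span:
  assumes "subspace K" "one \<in> K" "dim K = 2" "a \<in> K" "\<And>c. a \<noteq> scale c one" "x \<in> K"
  shows "\<exists>c d. x = scale c one + scale d a"
proof -
  have "a \<notin> span {one}" using assms(5) by (auto simp: span_singleton)
  then have ind: "independent {a, one}" "a \<noteq> one"
    by (auto simp: independent_insert dependent_single intro: span_base)
  then have "dim (span {a, one}) = 2" by (subst dim_span_eq_card_independent) auto
  then have "span {a, one} = K"
    using fd.subspace_dim_equal[of "span {a, one}" K] assms span_minimal[of "{a, one}" K] by auto
  then have "x \<in> span {a, one}" using assms by simp
  then obtain k where "x - scale k a \<in> span {one}" unfolding span_insert[of a] by auto
  then obtain c where "x - scale k a = scale c one" by (auto simp: span_singleton)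
  then have "x = scale c one + scale k a" by (simp add: algebra_simps)
  then show ?thesis by blast
qed

text \<open>Were the norm of \<open>K\<close> degenerate, all traces on \<open>K\<close> would vanish, including that of \<open>one\<close>, so the
  characteristic would be 2. The minimal polynomial of a nonscalar \<open>a\<close> would be \<open>X\<^sup>2 + n a\<close>, with
  derivative 0, contradicting separability.\<close>

lemma quadratic_subfield_nondeg:
  assumes K: "quadratic_separable_subfield scale mul one K" and x: "x \<in> K"
    and perp: "\<And>y. y \<in> K \<Longrightarrow> b x y = 0"
  shows "x = 0"
proof (rule ccontr)
  assume x0: "x \<noteq> 0"
  have sub: "subspace K" and oneK: "one \<in> K" and dimK: "dim K = 2"
    and closed: "\<And>x y. x \<in> K \<Longrightarrow> y \<in> K \<Longrightarrow> mul x y \<in> K"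
    and inv: "all_nonzero_invertible mul one K" and sep: "\<And>y. y \<in> K \<Longrightarrow> separable_element scale mul one y"
    and A: "unital_subalgebra scale mul one K"
    using K by (auto simp: quadratic_separable_subfield_def unital_subalgebra_def)
  have nx: "n x \<noteq> 0" using norm_invertible[OF inv x x0] .
  have tr: "b y one = 0" if "y \<in> K" for y
  proof -
    have "b (mul one x) (mul y x) = 0" using perp[OF closed[OF that x]] by (simp add: one_mul)
    then show ?thesis using nx by (simp only: b_mul_right) (simp add: b_commute)
  qed
  have char2: "(2::'f) = 0" using tr[OF oneK] by (simp add: b_one_one)
  obtain a where a: "a \<in> K" "\<And>c. a \<noteq> scale c one"
    using subfield_dim2_not_scalar[OF sub oneK dimK] by blast
  obtain p where p: "irreducible p" "coprime p (pderiv p)" "poly_eval scale mul one p a = 0"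
    using sep[OF a(1)] by (auto simp: separable_element_def)
  let ?q = "[:n a, - b a one, 1:]"
  have q: "?q = [:n a, 0, 1:]" using tr[OF a(1)] by simp
  obtain c where c: "p = ?q * c" using char_poly_dvd[OF a(2) p(3)] by (elim dvdE)
  have "\<not> is_unit ?q" by (simp add: is_unit_iff_degree)
  then have "is_unit c" using irreducibleD[OF p(1) c] by blast
  then obtain d where "c = [:d:]" by (metis is_unit_poly_iff)
  then have "p = smult d [:n a, 0, 1:]" using c q by simp
  then have "pderiv p = smult d (pderiv [:n a, 0, 1:])" by (simp only: pderiv_smult)
  then have "pderiv p = 0" using char2 by (simp add: pderiv_pCons)
  then have "is_unit p" using p(2) by simp
  then show False using p(1) by (simp add: irreducible_not_unit)
qed

text \<open>Conversely, the quadratic equation of a nonscalar \<open>x\<close> is irreducible because a root would give an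
  isotropic element of \<open>K\<close>, and its derivative vanishes only if \<open>one\<close> is orthogonal to \<open>K\<close>.\<close>

lemma quadratic_subfieldI:
  assumes A: "unital_subalgebra scale mul one K" and dimK: "dim K = 2"
    and aniso: "\<And>x. x \<in> K \<Longrightarrow> x \<noteq> 0 \<Longrightarrow> n x \<noteq> 0"
    and nondeg: "\<And>x. x \<in> K \<Longrightarrow> (\<And>y. y \<in> K \<Longrightarrow> b x y = 0) \<Longrightarrow> x = 0"
  shows "quadratic_separable_subfield scale mul one K"
proof -
  have sub: "subspace K" and oneK: "one \<in> K"
    using A by (auto simp: unital_subalgebra_def)
  obtain a where a: "a \<in> K" "\<And>c. a \<noteq> scale c one"
    using subfield_dim2_not_scalar[OF sub oneK dimK] by blast
  note sp = dim2_span[OF sub oneK dimK a]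
  have comm: "mul x y = mul y x" if xy: "x \<in> K" "y \<in> K" for x y
  proof -
    obtain c d c' d' where "x = scale c one + scale d a" "y = scale c' one + scale d' a"
      using sp[OF xy(1)] sp[OF xy(2)] by blast
    then show ?thesis by (simp add: mul_simps scale_right_distrib ac_simps)
  qed
  have assoc: "mul (mul x y) z = mul x (mul y z)" if xyz: "x \<in> K" "y \<in> K" "z \<in> K" for x y z
  proof -
    obtain c d c' d' c'' d'' where "x = scale c one + scale d a" "y = scale c' one + scale d' a"
      "z = scale c'' one + scale d'' a"
      using sp[OF xyz(1)] sp[OF xyz(2)] sp[OF xyz(3)] by blast
    moreover have "mul (mul a a) a = mul a (mul a a)"
      by (simp add: quadratic mul_simps)
    ultimately show ?thesis
      by (simp add: mul_simps scale_right_distrib ac_simps)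
  qed
  have "separable_element scale mul one x" if x: "x \<in> K" for x
  proof (cases "\<exists>c. x = scale c one")
    case True
    then obtain c where c: "x = scale c one" by blast
    have "irreducible [:- c, 1:]" by (rule irreducible_small_degree) simp
    moreover have "poly_eval scale mul one [:- c, 1:] x = 0"
      by (simp add: c poly_eval_pCons poly_eval_0 mul_simps)
    moreover have "coprime [:- c, 1:] (pderiv [:- c, 1:])" by (simp add: pderiv_pCons flip: one_pCons)
    ultimately show ?thesis unfolding separable_element_def by blast
  next
    case False
    let ?q = "[:n x, - b x one, 1:]"
    have "poly ?q c \<noteq> 0" for c
    proof
      assume "poly ?q c = 0"
      then have "n (x - scale c one) = 0"
        by (simp add: norm_diff norm_scale b_simps power2_eq_square algebra_simps)
      moreover have "x - scale c one \<in> K" using sub x oneK by (simp add: subspace_diff subspace_scale)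
      ultimately have "x - scale c one = 0" using aniso by blast
      then show False using False by simp
    qed
    then have irr: "irreducible ?q"
      by (intro irreducible_small_degree) simp
    have "pderiv ?q = [:- b x one, 2:]" by (simp add: pderiv_pCons)
    moreover have "[:- b x one, 2:] \<noteq> 0"
    proof
      assume "[:- b x one, 2:] = 0"
      then have z: "b x one = 0" "(2::'f) = 0" by auto
      have "b one y = 0" if y: "y \<in> K" for y
      proof -
        obtain c d where "y = scale c one + scale d x"
          using dim2_span[OF sub oneK dimK x _ y] False by blast
        then show ?thesis using z b_commute[of one x] by (simp add: b_simps b_one_one)
      qed
      then have "one = 0" using nondeg[OF oneK] by blast
      then show False by simp
    qed
    ultimately have "pderiv ?q \<noteq> 0" "degree (pderiv ?q) < degree ?q" by auto
    then have "\<not> ?q dvd pderiv ?q" by (metis dvd_imp_degree_le not_le)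
    then have "coprime ?q (pderiv ?q)" using irr coprime_irreducible by blast
    then show ?thesis unfolding separable_element_def using irr char_poly_root by blast
  qed
  then show ?thesis
    unfolding quadratic_separable_subfield_def
    using A dimK comm assoc invertible_anisotropic[OF A aniso] by blast
qed

end

section \<open>Elementary abelian 2-groups of order 4 and 8\<close>

context comm_group
begin

lemma adjoin_disjoint:
  assumes H: "subgroup H G" and s: "s \<in> carrier G" "s \<notin> H"
  shows "H \<inter> (\<lambda>h. h \<otimes> s) ` H = {}"
proof -
  interpret H: subgroup H G by fact
  have "h \<otimes> s \<notin> H" if "h \<in> H" for h
  proof
    assume "h \<otimes> s \<in> H"
    then have "inv h \<otimes> (h \<otimes> s) \<in> H" using that by blast
    moreover have "inv h \<otimes> (h \<otimes> s) = s"
      using that s H.subset by (simp add: m_assoc[symmetric] subset_iff)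
    ultimately show False using s by simp
  qed
  then show ?thesis by auto
qed

lemma card_adjoin:
  assumes H: "subgroup H G" "finite H" and s: "s \<in> carrier G" "s \<notin> H"
  shows "card (H \<union> (\<lambda>h. h \<otimes> s) ` H) = 2 * card H"
proof -
  interpret H: subgroup H G by fact
  have "inj_on (\<lambda>h. h \<otimes> s) H"
  proof (rule inj_onI)
    fix g h assume "g \<in> H" "h \<in> H" "g \<otimes> s = h \<otimes> s"
    then show "g = h" using right_cancel[OF s(1) H.mem_carrier H.mem_carrier] by blast
  qed
  then have "card ((\<lambda>h. h \<otimes> s) ` H) = card H" by (rule card_image)
  then show ?thesis
    using card_Un_disjoint[of H "(\<lambda>h. h \<otimes> s) ` H"] adjoin_disjoint[OF H(1) s] H(2) by simp
qed

lemma klein_subgroup: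
  assumes "s1 \<in> carrier G" "s1 \<otimes> s1 = \<one>" "s2 \<in> carrier G" "s2 \<otimes> s2 = \<one>"
  shows "subgroup {\<one>, s1} G" "subgroup {\<one>, s1, s2, s1 \<otimes> s2} G"
proof -
  have eq: "{\<one>} \<union> (\<lambda>h. h \<otimes> s1) ` {\<one>} = {\<one>, s1}" using assms by auto
  then show 1: "subgroup {\<one>, s1} G" using adjoin_involution[OF triv_subgroup assms(1,2)] by simp
  have "{\<one>, s1} \<union> (\<lambda>h. h \<otimes> s2) ` {\<one>, s1} = {\<one>, s1, s2, s1 \<otimes> s2}" using assms by auto
  then show "subgroup {\<one>, s1, s2, s1 \<otimes> s2} G" using adjoin_involution[OF 1 assms(3,4)] by simp
qed

lemma three_involutions:
  assumes s: "s1 \<in> carrier G" "s1 \<otimes> s1 = \<one>" "s2 \<in> carrier G" "s2 \<otimes> s2 = \<one>"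
    "s3 \<in> carrier G" "s3 \<otimes> s3 = \<one>"
  shows "{\<one>, s1, s2, s1 \<otimes> s2} \<union> (\<lambda>h. h \<otimes> s3) ` {\<one>, s1, s2, s1 \<otimes> s2}
      = {\<one>, s1, s2, s1 \<otimes> s2, s3, s1 \<otimes> s3, s2 \<otimes> s3, s1 \<otimes> s2 \<otimes> s3}" (is "?L = ?R")
    and "generate G {s1, s2, s3}
      = {\<one>, s1, s2, s1 \<otimes> s2, s3, s1 \<otimes> s3, s2 \<otimes> s3, s1 \<otimes> s2 \<otimes> s3}"
proof -
  show eq: "?L = ?R" using s by auto
  have sub: "subgroup ?R G"
    using adjoin_involution[OF klein_subgroup(2)[OF s(1-4)] s(5,6)] eq by simp
  interpret gen: subgroup "generate G {s1, s2, s3}" G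
    by (rule generate_is_subgroup) (use s in auto)
  have "s1 \<in> generate G {s1, s2, s3}" "s2 \<in> generate G {s1, s2, s3}" "s3 \<in> generate G {s1, s2, s3}"
    by (auto intro: generate.incl)
  then have "?R \<subseteq> generate G {s1, s2, s3}" by auto
  moreover have "generate G {s1, s2, s3} \<subseteq> ?R"
    by (rule generate_subgroup_incl[OF _ sub]) auto
  ultimately show "generate G {s1, s2, s3} = ?R" by blast
qed

lemma klein_generators:
  assumes T: "subgroup T G" "card T = 4" and sq: "\<And>t. t \<in> T \<Longrightarrow> t \<otimes> t = \<one>"
  obtains t1 t2 where "t1 \<in> T" "t2 \<in> T" "T = {\<one>, t1, t2, t1 \<otimes> t2}"
proof -
  interpret T: subgroup T G by fact
  have fin: "finite T" using T(2) by (metis card.infinite zero_neq_numeral)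
  have ex: "\<exists>t\<in>T. t \<notin> S" if "finite S" "card S < 4" for S
    using that T(2) by (metis card_mono not_le subsetI)
  obtain t1 where t1: "t1 \<in> T" "t1 \<notin> {\<one>}" using ex[of "{\<one>}"] by auto
  have c1: "card {\<one>, t1} = 2" using t1 by auto
  obtain t2 where t2: "t2 \<in> T" "t2 \<notin> {\<one>, t1}" using ex[of "{\<one>, t1}"] c1 by auto
  have car: "t1 \<in> carrier G" "t2 \<in> carrier G" using t1 t2 T.subset by auto
  have "{\<one>, t1} \<union> (\<lambda>h. h \<otimes> t2) ` {\<one>, t1} = {\<one>, t1, t2, t1 \<otimes> t2}" using car by auto
  then have "card {\<one>, t1, t2, t1 \<otimes> t2} = 4"
    using card_adjoin[OF klein_subgroup(1)[OF car(1) sq[OF t1(1)] car(2) sq[OF t2(1)]] _ car(2) t2(2)] c1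
    by simp
  moreover have "{\<one>, t1, t2, t1 \<otimes> t2} \<subseteq> T" using t1 t2 by auto
  ultimately have "T = {\<one>, t1, t2, t1 \<otimes> t2}" using card_subset_eq[OF fin] T(2) by metis
  then show ?thesis using that t1 t2 by blast
qed

lemma order8_generators:
  assumes T: "subgroup T G" "card T = 8" and sq: "\<And>t. t \<in> T \<Longrightarrow> t \<otimes> t = \<one>"
  obtains s1 s2 s3 where "s1 \<in> T" "s2 \<in> T" "s3 \<in> T" "generate G {s1, s2, s3} = T"
proof -
  interpret T: subgroup T G by fact
  have fin: "finite T" using T(2) by (metis card.infinite zero_neq_numeral)
  have ex: "\<exists>t\<in>T. t \<notin> S" if "finite S" "card S < 8" for S
    using that T(2) by (metis card_mono not_le subsetI)
  obtain t1 where t1: "t1 \<in> T" "t1 \<notin> {\<one>}" using ex[of "{\<one>}"] by auto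
  have c1: "card {\<one>, t1} = 2" using t1 by auto
  obtain t2 where t2: "t2 \<in> T" "t2 \<notin> {\<one>, t1}" using ex[of "{\<one>, t1}"] c1 by auto
  have car: "t1 \<in> carrier G" "t2 \<in> carrier G" using t1 t2 T.subset by auto
  have "{\<one>, t1} \<union> (\<lambda>h. h \<otimes> t2) ` {\<one>, t1} = {\<one>, t1, t2, t1 \<otimes> t2}" using car by auto
  then have c2: "card {\<one>, t1, t2, t1 \<otimes> t2} = 4"
    using card_adjoin[OF klein_subgroup(1)[OF car(1) sq[OF t1(1)] car(2) sq[OF t2(1)]] _ car(2) t2(2)] c1
    by simp
  obtain t3 where t3: "t3 \<in> T" "t3 \<notin> {\<one>, t1, t2, t1 \<otimes> t2}"
    using ex[of "{\<one>, t1, t2, t1 \<otimes> t2}"] c2 by auto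
  have car3: "t3 \<in> carrier G" using t3 T.subset by auto
  note three = three_involutions[OF car(1) sq[OF t1(1)] car(2) sq[OF t2(1)] car3 sq[OF t3(1)]]
  have "card (generate G {t1, t2, t3}) = 8"
    unfolding three(2) three(1)[symmetric]
    using card_adjoin[OF klein_subgroup(2)[OF car(1) sq[OF t1(1)] car(2) sq[OF t2(1)]] _ car3 t3(2)] c2
    by simp
  moreover have "generate G {t1, t2, t3} \<subseteq> T"
    by (rule generate_subgroup_incl[OF _ T(1)]) (use t1 t2 t3 in auto)
  ultimately have "generate G {t1, t2, t3} = T" using card_subset_eq[OF fin] T(2) by metis
  then show ?thesis using that t1 t2 t3 by blast
qed

end

section \<open>Cosets of norm groups\<close>

lemma field_units_simps [simp]:
  "carrier (field_units :: 'f::field monoid) = - {0}"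
  "monoid.mult (field_units :: 'f monoid) = (*)" "monoid.one (field_units :: 'f monoid) = 1"
  by (simp_all add: field_units_def)

lemma field_units_group: "comm_group (field_units :: 'f::field monoid)"
proof (rule comm_groupI)
  fix x :: 'f assume "x \<in> carrier field_units"
  then show "\<exists>y\<in>carrier field_units. y \<otimes>\<^bsub>field_units\<^esub> x = \<one>\<^bsub>field_units\<^esub>"
    by (intro bexI[of _ "inverse x"]) auto
qed auto

lemma coset_eq:
  assumes "subgroup N (field_units :: 'f::field monoid)" "a \<noteq> 0"
  shows "N #>\<^bsub>field_units\<^esub> a = {k * a | k. k \<in> N}"
  by (auto simp: r_coset_def)

lemma coset_of_member:
  assumes N: "subgroup N (field_units :: 'f::field monoid)"
    and M: "M \<in> carrier (field_units Mod N)" and a: "a \<in> M"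
  shows "M = {k * a | k. k \<in> N}" "a \<noteq> 0"
proof -
  interpret comm_group "field_units :: 'f monoid" by (rule field_units_group)
  interpret N: subgroup N "field_units :: 'f monoid" by fact
  from M obtain z where z: "z \<noteq> 0" "M = N #>\<^bsub>field_units\<^esub> z"
    by (auto simp: FactGroup_def RCOSETS_def)
  with a have az: "a \<in> N #>\<^bsub>field_units\<^esub> z" by simp
  then show a0: "a \<noteq> 0" using r_coset_subset_G[of N z] N.subset z by auto
  have "N #>\<^bsub>field_units\<^esub> z = N #>\<^bsub>field_units\<^esub> a"
    using repr_independence[OF az _ N] z by simp
  then show "M = {k * a | k. k \<in> N}" using z coset_eq[OF N a0] by simp
qed

lemma hom_coset_closed:
  assumes "\<mu> \<in> hom (G\<lparr>carrier := T\<rparr>) (field_units Mod N)" "s \<in> T" "t \<in> T" "a \<in> \<mu> s" "c \<in> \<mu> t"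
  shows "a * c \<in> \<mu> (s \<otimes>\<^bsub>G\<^esub> t)"
  using assms by (auto simp: hom_def FactGroup_def set_mult_def)

lemma hom_coset_carrier:
  assumes "\<mu> \<in> hom (G\<lparr>carrier := T\<rparr>) (field_units Mod N)" "t \<in> T"
  shows "\<mu> t \<in> carrier (field_units Mod N)"
  using assms by (auto simp: hom_def)

context cayley_algebra
begin

lemma norm_group_subgroup:
  assumes A: "unital_subalgebra scale mul one A" and aniso: "\<And>x. x \<in> A \<Longrightarrow> x \<noteq> 0 \<Longrightarrow> n x \<noteq> 0"
  shows "subgroup (norm_group n A) field_units"
proof -
  interpret F: comm_group "field_units :: 'f monoid" by (rule field_units_group)
  have clo: "n x * n y \<in> norm_group n A" if "x \<in> A" "y \<in> A" "x \<noteq> 0" "y \<noteq> 0" for x y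
  proof -
    have "n (mul x y) \<noteq> 0" using that aniso by (simp add: norm_mult)
    then have "mul x y \<noteq> 0" by auto
    moreover have "mul x y \<in> A" using A that by (simp add: unital_subalgebra_def)
    ultimately show ?thesis unfolding norm_group_def norm_mult[symmetric] by blast
  qed
  show ?thesis
  proof (rule F.subgroupI)
    show "norm_group n A \<subseteq> carrier field_units"
    proof
      fix a assume "a \<in> norm_group n A"
      then obtain x where "x \<in> A" "x \<noteq> 0" "a = n x" by (auto simp: norm_group_def)
      then show "a \<in> carrier field_units" using aniso[of x] by simp
    qed
    show "norm_group n A \<noteq> {}"
      using A by (auto simp: norm_group_def unital_subalgebra_def)
    fix a assume "a \<in> norm_group n A"
    then obtain x where x: "x \<in> A" "x \<noteq> 0" "a = n x" by (auto simp: norm_group_def)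
    let ?y = "scale (1 / n x) (cnj x)"
    have nx: "n x \<noteq> 0" using aniso x by blast
    have "?y \<in> A" using A cnj_closed_subalgebra[OF A x(1)] by (simp add: unital_subalgebra_def subspace_scale)
    moreover have ny: "n ?y = 1 / n x" using nx by (simp add: norm_scale power2_eq_square)
    moreover have "?y \<noteq> 0" using ny nx by auto
    moreover have "inv\<^bsub>field_units\<^esub> a = 1 / n x"
      by (rule F.inv_equality) (use nx x in auto)
    ultimately show "inv\<^bsub>field_units\<^esub> a \<in> norm_group n A"
      unfolding norm_group_def by (metis DiffI image_eqI singletonD)
  next
    fix a c assume "a \<in> norm_group n A" "c \<in> norm_group n A"
    then obtain x y where "x \<in> A" "x \<noteq> 0" "a = n x" "y \<in> A" "y \<noteq> 0" "c = n y" by (auto simp: norm_group_def)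
    then show "a \<otimes>\<^bsub>field_units\<^esub> c \<in> norm_group n A" using clo by simp
  qed
qed

lemma scalar_subalgebra: "unital_subalgebra scale mul one (span {one})"
proof -
  have "mul x y \<in> span {one}" if "x \<in> span {one}" "y \<in> span {one}" for x y
    using that by (auto simp: span_singleton mul_simps)
  then show ?thesis by (simp add: unital_subalgebra_def span_base)
qed

text \<open>Squares are the norms of scalars, so the gradings of type \<open>F\<close> and those of type \<open>K\<close> can be compared
  by the same argument, with \<open>span {one}\<close> in the role of \<open>K\<close>.\<close>

lemma square_group_eq: "square_group = norm_group n (span {one})"
proof -
  have "span {one} - {0} = (\<lambda>a. scale a one) ` (- {0})" by (auto simp: span_singleton)
  then show ?thesis
    by (simp add: square_group_def norm_group_def image_image norm_scale)
qed

lemma iso_norm_group: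
  assumes "unital_subalgebra scale mul one A" "unital_subalgebra scale mul one A'"
    and f: "algebra_iso_on scale mul A scale mul A' f"
  shows "norm_group n A' = norm_group n A"
proof -
  have bij: "f ` A = A'" "inj_on f A" and sc: "\<And>a x. x \<in> A \<Longrightarrow> f (scale a x) = scale a (f x)"
    using f by (auto simp: algebra_iso_on_def linear_iso_on_def bij_betw_def)
  have A: "one \<in> A" "0 \<in> A" using assms(1) subspace_0 by (auto simp: unital_subalgebra_def)
  have "f 0 = 0" using sc[OF A(1), of 0] by simp
  then have "f ` (A - {0}) = A' - {0}"
    using bij A by (metis image_insert image_empty inj_on_image_set_diff Diff_subset empty_subsetI insert_subset)
  then have "norm_group n A' = n ` (f ` (A - {0}))" by (simp add: norm_group_def)
  also have "\<dots> = (\<lambda>x. n (f x)) ` (A - {0})" by (rule image_image)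
  also have "\<dots> = norm_group n A"
    unfolding norm_group_def using iso_norm(1)[OF assms] by (intro image_cong) auto
  finally show ?thesis .
qed

lemma algebra_iso_restrict:
  assumes "algebra_iso_on scale mul UNIV scale mul UNIV F"
  shows "algebra_iso_on scale mul A scale mul (F ` A) F"
  using assms by (auto simp: algebra_iso_on_def linear_iso_on_def bij_betw_def inj_on_def)

lemma UNIV_subalgebra: "unital_subalgebra scale mul one UNIV"
  by (simp add: unital_subalgebra_def subspace_UNIV)

end

section \<open>Norm types\<close>

context cayley_grading_group
begin

lemma trivial_division_grading:
  assumes A: "unital_subalgebra scale mul one (U \<one>)"
    and aniso: "\<And>x. x \<in> U \<one> \<Longrightarrow> x \<noteq> 0 \<Longrightarrow> n x \<noteq> 0"
    and nondeg: "\<And>x. x \<in> U \<one> \<Longrightarrow> (\<And>y. y \<in> U \<one> \<Longrightarrow> b x y = 0) \<Longrightarrow> x = 0"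
  shows "division_grading scale mul one n G {\<one>} U"
proof (intro division_grading.intro division_grading_axioms.intro cayley_grading_group_axioms)
  show "subgroup {\<one>} G" by (rule G.triv_subgroup)
  show "one \<in> U \<one>" using A by (simp add: unital_subalgebra_def)
  show "\<exists>x\<in>U h. x \<noteq> 0" if "h \<in> {\<one>}" for h
    using that A by (auto simp: unital_subalgebra_def intro!: bexI[of _ one])
qed (use A aniso nondeg in \<open>auto simp: unital_subalgebra_def\<close>)

definition supported :: "'g set \<Rightarrow> ('g \<Rightarrow> 'c set) \<Rightarrow> bool" where
  "supported T U \<longleftrightarrow> division_grading scale mul one n G T U \<and> (\<forall>g\<in>carrier G - T. U g = {0})"

text \<open>One norm in each class suffices: by \<open>typed_norms\<close> it puts all nonzero norms of that degree into
  the class.\<close>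

definition norm_typed :: "'g set \<Rightarrow> ('g \<Rightarrow> 'f set) \<Rightarrow> ('g \<Rightarrow> 'c set) \<Rightarrow> bool" where
  "norm_typed T \<mu> U \<longleftrightarrow> (\<forall>t\<in>T. \<exists>x\<in>U t. n x \<noteq> 0 \<and> n x \<in> \<mu> t)"

lemma supported_one_subalgebra:
  assumes "supported T U"
  shows "unital_subalgebra scale mul one (U \<one>)" "\<And>x. x \<in> U \<one> \<Longrightarrow> x \<noteq> 0 \<Longrightarrow> n x \<noteq> 0"
proof -
  interpret division_grading scale mul one n G T U using assms by (simp add: supported_def)
  show "unital_subalgebra scale mul one (U \<one>)"
    using one_in sub[of \<one>] mul_closed[of \<one> \<one>] by (simp add: unital_subalgebra_def)
  show "\<And>x. x \<in> U \<one> \<Longrightarrow> x \<noteq> 0 \<Longrightarrow> n x \<noteq> 0" using anisotropic[of \<one>] by simp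
qed

lemma isomorphic_supports:
  assumes U: "supported T U" and V: "supported T' V"
    and iso: "isomorphic_gradings G scale mul U scale mul V"
  shows "T = T'" "isomorphic_subalgebras scale mul (U \<one>) (V \<one>)"
proof -
  interpret U: division_grading scale mul one n G T U using U by (simp add: supported_def)
  interpret V: division_grading scale mul one n G T' V using V by (simp add: supported_def)
  obtain F where F: "algebra_iso_on scale mul UNIV scale mul UNIV F" "\<And>g. g \<in> carrier G \<Longrightarrow> F ` U g = V g"
    using iso by (auto simp: isomorphic_gradings_def)
  have inj: "inj F" and "\<And>a x. F (scale a x) = scale a (F x)"
    using F(1) by (auto simp: algebra_iso_on_def linear_iso_on_def bij_betw_def)
  from this(2)[of 0] have F0: "F 0 = 0" by simp
  have tU: "g \<in> T \<longleftrightarrow> U g \<noteq> {0}" if "g \<in> carrier G" for g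
    using that U U.nonzero by (auto simp: supported_def)
  have tV: "g \<in> T' \<longleftrightarrow> V g \<noteq> {0}" if "g \<in> carrier G" for g
    using that V V.nonzero by (auto simp: supported_def)
  have eq: "U g = {0} \<longleftrightarrow> V g = {0}" if "g \<in> carrier G" for g
  proof -
    have "V g = {0} \<longleftrightarrow> F ` U g = F ` {0}" using F(2)[OF that] F0 by simp
    also have "\<dots> \<longleftrightarrow> U g = {0}" by (rule inj_image_eq_iff[OF inj])
    finally show ?thesis by simp
  qed
  show "T = T'"
  proof (rule Set.set_eqI)
    fix g
    show "g \<in> T \<longleftrightarrow> g \<in> T'"
    proof (cases "g \<in> carrier G")
      case True
      then show ?thesis by (simp only: tU tV eq)
    next
      case False
      then show ?thesis using U.H.mem_carrier V.H.mem_carrier by metis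
    qed
  qed
  show "isomorphic_subalgebras scale mul (U \<one>) (V \<one>)"
    unfolding isomorphic_subalgebras_def
    using algebra_iso_restrict[OF F(1), of "U \<one>"] F(2)[of \<one>] by auto
qed

lemma typed_norms:
  assumes U: "supported T U" and typed: "norm_typed T \<mu> U" and t: "t \<in> T"
    and \<mu>: "\<mu> t \<in> carrier (field_units Mod norm_group n (U \<one>))" and y: "y \<in> U t" "y \<noteq> 0"
  shows "n y \<in> \<mu> t"
proof -
  interpret U: division_grading scale mul one n G T U using U by (simp add: supported_def)
  obtain x where x: "x \<in> U t" "n x \<noteq> 0" "n x \<in> \<mu> t" using typed t by (auto simp: norm_typed_def)
  have x0: "x \<noteq> 0" using x by auto
  obtain a where a: "a \<in> U \<one>" "y = mul a x" using U.component_eq_one[OF t x(1) x0] y by auto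
  have "a \<noteq> 0" using a y by auto
  then have "n a \<in> norm_group n (U \<one>)" using a by (auto simp: norm_group_def)
  then show ?thesis
    using coset_of_member(1)[OF norm_group_subgroup[OF supported_one_subalgebra[OF U]] \<mu> x(3)] a
    by (auto simp: norm_mult)
qed

lemma supported_isomorphic:
  assumes U: "supported T U" and V: "supported T V"
    and full: "card T * dim (U \<one>) = 8" "card T * dim (V \<one>) = 8"
    and f: "algebra_iso_on scale mul (U \<one>) scale mul (V \<one>) f"
    and norms: "\<And>t. t \<in> T \<Longrightarrow> \<exists>x\<in>U t. \<exists>x'\<in>V t. n x \<noteq> 0 \<and> n x' = n x"
  shows "isomorphic_gradings G scale mul U scale mul V"
proof -
  have D: "division_grading scale mul one n G T U" "division_grading scale mul one n G T V"
    using U V by (simp_all add: supported_def)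
  obtain F where F: "algebra_iso_on scale mul UNIV scale mul UNIV F" "\<forall>t\<in>T. F ` U t = V t"
    using division_gradings_isomorphic[OF D full f norms] by blast
  have "F (scale 0 0) = scale 0 (F 0)"
    using F(1) unfolding algebra_iso_on_def linear_iso_on_def by blast
  then have "F 0 = 0" by simp
  then have "F ` U g = V g" if "g \<in> carrier G" for g
    using that F(2) U V by (cases "g \<in> T") (auto simp: supported_def)
  then show ?thesis unfolding isomorphic_gradings_def using F(1) by blast
qed

text \<open>Norms of the same degree lie in one coset of the norm group of \<open>V \<one>\<close>; multiplying by an element of
  \<open>V \<one>\<close> makes them equal.\<close>

lemma typed_isomorphic:
  assumes U: "supported T U" "norm_typed T \<mu> U" and V: "supported T V" "norm_typed T \<mu> V"
    and full: "card T * dim (U \<one>) = 8" "card T * dim (V \<one>) = 8"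
    and f: "algebra_iso_on scale mul (U \<one>) scale mul (V \<one>) f"
    and \<mu>: "\<And>t. t \<in> T \<Longrightarrow> \<mu> t \<in> carrier (field_units Mod norm_group n (V \<one>))"
  shows "isomorphic_gradings G scale mul U scale mul V"
proof -
  interpret U: division_grading scale mul one n G T U using U by (simp add: supported_def)
  interpret V: division_grading scale mul one n G T V using V by (simp add: supported_def)
  have "\<exists>x\<in>U t. \<exists>x'\<in>V t. n x \<noteq> 0 \<and> n x' = n x" if t: "t \<in> T" for t
  proof -
    obtain x where x: "x \<in> U t" "n x \<noteq> 0" "n x \<in> \<mu> t" using U t by (auto simp: norm_typed_def)
    obtain y where y: "y \<in> V t" "n y \<noteq> 0" "n y \<in> \<mu> t" using V t by (auto simp: norm_typed_def)
    have "n x \<in> {k * n y | k. k \<in> norm_group n (V \<one>)}"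
      using coset_of_member(1)[OF norm_group_subgroup[OF supported_one_subalgebra[OF V(1)]] \<mu>[OF t] y(3)] x
      by simp
    then obtain a where a: "a \<in> V \<one>" "n x = n a * n y" by (auto simp: norm_group_def)
    have "mul a y \<in> V (\<one> \<otimes> t)" by (rule V.mul_closed) (use a y t in auto)
    then have "mul a y \<in> V t" using t by simp
    then show ?thesis
      using a x by (intro bexI[of _ x] bexI[of _ "mul a y"]) (auto simp: norm_mult)
  qed
  then show ?thesis by (rule supported_isomorphic[OF U(1) V(1) full f])
qed

text \<open>An isomorphism preserves norms, hence also the norm groups; two cosets of the same group that share
  an element coincide.\<close>

lemma isomorphic_types:
  assumes U: "supported T U" "norm_typed T \<mu> U" and V: "supported T' V" "norm_typed T' \<mu>' V"
    and \<mu>: "\<And>t. t \<in> T \<Longrightarrow> \<mu> t \<in> carrier (field_units Mod norm_group n (U \<one>))"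
    and \<mu>': "\<And>t. t \<in> T' \<Longrightarrow> \<mu>' t \<in> carrier (field_units Mod norm_group n (V \<one>))"
    and iso: "isomorphic_gradings G scale mul U scale mul V" and t: "t \<in> T"
  shows "\<mu> t = \<mu>' t"
proof -
  have T: "T = T'" using isomorphic_supports U V iso by blast
  interpret U: division_grading scale mul one n G T U using U by (simp add: supported_def)
  obtain F where F: "algebra_iso_on scale mul UNIV scale mul UNIV F" "\<And>g. g \<in> carrier G \<Longrightarrow> F ` U g = V g"
    using iso by (auto simp: isomorphic_gradings_def)
  have norm: "n (F x) = n x" for x
    using iso_norm(1)[OF UNIV_subalgebra UNIV_subalgebra F(1)] by simp
  have "algebra_iso_on scale mul (U \<one>) scale mul (V \<one>) F"
    using algebra_iso_restrict[OF F(1), of "U \<one>"] F(2)[of \<one>] by auto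
  then have N: "norm_group n (V \<one>) = norm_group n (U \<one>)"
    by (intro iso_norm_group supported_one_subalgebra(1)[OF U(1)] supported_one_subalgebra(1)[OF V(1)])
  obtain x where x: "x \<in> U t" "x \<noteq> 0" using U.nonzero t by blast
  have nx: "n x \<noteq> 0" using U.anisotropic t x by blast
  have 1: "n x \<in> \<mu> t" by (rule typed_norms[OF U t \<mu>[OF t] x])
  have "F x \<in> V t" using F(2)[of t] t x by auto
  moreover have "F x \<noteq> 0" using norm[of x] nx by auto
  ultimately have 2: "n x \<in> \<mu>' t"
    using typed_norms[OF V _ \<mu>', of t "F x"] t T norm by simp
  note sg = norm_group_subgroup[OF supported_one_subalgebra[OF U(1)]]
  show ?thesis
    using coset_of_member(1)[OF sg \<mu>[OF t] 1] coset_of_member(1)[OF sg _ 2] \<mu>'[of t] t T N by simp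
qed

end

section \<open>Admissibility of the norm types of gradings\<close>

lemma isometricI:
  assumes \<Psi>: "linear_iso_on s2 V2 s1 V1 \<Psi>"
    and add: "\<And>f g. f \<in> V2 \<Longrightarrow> g \<in> V2 \<Longrightarrow> f + g \<in> V2" and sc: "\<And>a f. f \<in> V2 \<Longrightarrow> s2 a f \<in> V2"
    and norm: "\<And>f. f \<in> V2 \<Longrightarrow> q1 (\<Psi> f) = q2 f"
  shows "isometric s1 V1 q1 s2 V2 q2"
proof -
  have bij: "bij_betw \<Psi> V2 V1" and padd: "\<And>x y. x \<in> V2 \<Longrightarrow> y \<in> V2 \<Longrightarrow> \<Psi> (x + y) = \<Psi> x + \<Psi> y"
    and psc: "\<And>a x. x \<in> V2 \<Longrightarrow> \<Psi> (s2 a x) = s1 a (\<Psi> x)"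
    using \<Psi> by (auto simp: linear_iso_on_def)
  let ?f = "the_inv_into V2 \<Psi>"
  have inj: "inj_on \<Psi> V2" using bij by (simp add: bij_betw_def)
  have f: "?f (\<Psi> x) = x" if "x \<in> V2" for x using the_inv_into_f_f[OF inj that] .
  have ex: "\<exists>x\<in>V2. y = \<Psi> x" if "y \<in> V1" for y using bij that by (auto simp: bij_betw_def)
  have "bij_betw ?f V1 V2" using bij by (rule bij_betw_the_inv_into)
  moreover have "?f (x + y) = ?f x + ?f y" if "x \<in> V1" "y \<in> V1" for x y
  proof -
    from that obtain x' y' where "x' \<in> V2" "y' \<in> V2" "x = \<Psi> x'" "y = \<Psi> y'" using ex by metis
    then show ?thesis using f add padd by (metis)
  qed
  moreover have "?f (s1 a x) = s2 a (?f x)" if "x \<in> V1" for a x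
  proof -
    from that obtain x' where "x' \<in> V2" "x = \<Psi> x'" using ex by metis
    then show ?thesis using f sc psc by metis
  qed
  moreover have "q2 (?f x) = q1 x" if "x \<in> V1" for x
  proof -
    from that obtain x' where "x' \<in> V2" "x = \<Psi> x'" using ex by metis
    then show ?thesis using f norm by simp
  qed
  ultimately show ?thesis unfolding isometric_def linear_iso_on_def by blast
qed

lemma isomorphic_gradings_cong:
  assumes "\<And>g. g \<in> carrier G \<Longrightarrow> U g = U' g"
  shows "isomorphic_gradings G s1 m1 U s2 m2 V \<longleftrightarrow> isomorphic_gradings G s1 m1 U' s2 m2 V"
  using assms by (simp add: isomorphic_gradings_def)

lemma isomorphic_gradings_refl:
  "(\<And>g. g \<in> carrier G \<Longrightarrow> U g = V g) \<Longrightarrow> isomorphic_gradings G s m U s m V"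
  unfolding isomorphic_gradings_def algebra_iso_on_def linear_iso_on_def
  by (rule exI[of _ id]) auto

text \<open>The class \<open>\<mu> \<one>\<close> is idempotent, so it is the subgroup itself.\<close>

lemma coset_one_subgroup:
  assumes N: "subgroup N (field_units :: 'f::field monoid)" and T: "subgroup T G" and G: "group G"
    and \<mu>: "\<mu> \<in> hom (G\<lparr>carrier := T\<rparr>) (field_units Mod N)"
  shows "1 \<in> \<mu> \<one>\<^bsub>G\<^esub>"
proof -
  interpret F: comm_group "field_units :: 'f monoid" by (rule field_units_group)
  interpret N: subgroup N "field_units :: 'f monoid" by fact
  interpret G: group G by fact
  have one: "\<one>\<^bsub>G\<^esub> \<in> T" using T by (rule subgroup.one_closed)
  have M: "\<mu> \<one>\<^bsub>G\<^esub> \<in> carrier (field_units Mod N)" by (rule hom_coset_carrier[OF \<mu> one])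
  then obtain z where "z \<noteq> 0" "\<mu> \<one>\<^bsub>G\<^esub> = N #>\<^bsub>field_units\<^esub> z"
    by (auto simp: FactGroup_def RCOSETS_def)
  then have z: "z \<in> \<mu> \<one>\<^bsub>G\<^esub>" using F.rcos_self[of z N] N by simp
  note eq = coset_of_member[OF N M z]
  have "z * z \<in> \<mu> \<one>\<^bsub>G\<^esub>" using hom_coset_closed[OF \<mu> one one z z] by simp
  then obtain k where "k \<in> N" "z * z = k * z" using eq(1) by auto
  then have "z \<in> N" using eq(2) by simp
  then have "inv\<^bsub>field_units\<^esub> z \<in> N" by (rule N.m_inv_closed)
  moreover have "inv\<^bsub>field_units\<^esub> z = 1 / z" by (rule F.inv_equality) (use eq(2) in auto)
  ultimately have "1 / z \<in> N" by simp
  then have "1 / z * z \<in> {k * z | k. k \<in> N}" by blast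
  then show ?thesis using eq by simp
qed

context division_grading
begin

lemma one_subalgebra: "unital_subalgebra scale mul one (U \<one>)"
  using one_in sub[of \<one>] mul_closed[of \<one> \<one>] by (simp add: unital_subalgebra_def)

abbreviation N :: "'f set" where
  "N \<equiv> norm_group n (U \<one>)"

lemma N_subgroup: "subgroup N field_units"
  using norm_group_subgroup[OF one_subalgebra] anisotropic[of \<one>] by simp

text \<open>The normalization \<open>x \<one> = one\<close> matches the representative 1 that admissibility prescribes at \<open>\<one>\<close>.\<close>

lemma transversal:
  obtains x where "\<And>t. t \<in> H \<Longrightarrow> x t \<in> U t" "\<And>t. t \<in> H \<Longrightarrow> x t \<noteq> 0" "x \<one> = one"
proof -
  define x where "x t = (if t = \<one> then one else SOME y. y \<in> U t \<and> y \<noteq> 0)" for t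
  have "x t \<in> U t \<and> x t \<noteq> 0" if t: "t \<in> H" for t
  proof (cases "t = \<one>")
    case True
    then show ?thesis using one_in by (simp add: x_def)
  next
    case False
    obtain y where "y \<in> U t \<and> y \<noteq> 0" using nonzero t by blast
    then have "(SOME y. y \<in> U t \<and> y \<noteq> 0) \<in> U t \<and> (SOME y. y \<in> U t \<and> y \<noteq> 0) \<noteq> 0" by (rule someI)
    then show ?thesis using False by (simp add: x_def)
  qed
  then show ?thesis using that[of x] by (simp add: x_def)
qed

lemma norm_orthogonal_sum:
  assumes "S \<subseteq> H" "\<And>t. t \<in> S \<Longrightarrow> y t \<in> U t"
  shows "n (\<Sum>t\<in>S. y t) = (\<Sum>t\<in>S. n (y t))"
proof -
  have "finite S" using assms(1) H_finite finite_subset by blast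
  then show ?thesis using assms
  proof (induction rule: finite_induct)
    case (insert k S)
    have "b (y k) (\<Sum>t\<in>S. y t) = (\<Sum>t\<in>S. b (y k) (y t))" by (rule b_sum_right)
    also have "\<dots> = 0"
    proof (rule sum.neutral, rule ballI)
      fix t assume "t \<in> S"
      then show "b (y k) (y t) = 0"
        by (intro orthogonal[of k t]) (use insert in auto)
    qed
    finally show ?case using insert by (simp add: norm_add)
  qed simp
qed

context
  fixes x
  assumes x: "\<And>t. t \<in> H \<Longrightarrow> x t \<in> U t" "\<And>t. t \<in> H \<Longrightarrow> x t \<noteq> 0"
begin

lemma norm_x: "t \<in> H \<Longrightarrow> n (x t) \<noteq> 0"
  using anisotropic x by blast

text \<open>Up to a factor from \<open>U \<one>\<close>, the product of the representatives in degrees \<open>s\<close> and \<open>t\<close> is the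
  representative in degree \<open>s t\<close>.\<close>

lemma norm_coset_hom:
  "(\<lambda>t. N #>\<^bsub>field_units\<^esub> n (x t)) \<in> hom (G\<lparr>carrier := H\<rparr>) (field_units Mod N)"
proof -
  interpret F: comm_group "field_units :: 'f monoid" by (rule field_units_group)
  interpret N: subgroup N "field_units :: 'f monoid" by (rule N_subgroup)
  interpret NN: normal N "field_units :: 'f monoid"
    using F.subgroup_imp_normal[OF N_subgroup] .
  show ?thesis
  proof (rule homI)
    fix t assume "t \<in> carrier (G\<lparr>carrier := H\<rparr>)"
    then show "N #>\<^bsub>field_units\<^esub> n (x t) \<in> carrier (field_units Mod N)"
      using norm_x by (auto simp: FactGroup_def RCOSETS_def)
  next
    fix s t assume "s \<in> carrier (G\<lparr>carrier := H\<rparr>)" "t \<in> carrier (G\<lparr>carrier := H\<rparr>)"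
    then have s: "s \<in> H" and t: "t \<in> H" by auto
    then have st: "s \<otimes> t \<in> H" by simp
    have mem: "mul (x s) (x t) \<in> U (s \<otimes> t)" using mul_closed x s t by simp
    then obtain a where a: "a \<in> U \<one>" "mul (x s) (x t) = mul a (x (s \<otimes> t))"
      using component_eq_one[OF st x(1)[OF st] x(2)[OF st]] by auto
    have eq: "n (x s) * n (x t) = n a * n (x (s \<otimes> t))" using a(2) by (simp flip: norm_mult)
    have "n (x s) * n (x t) \<noteq> 0" using norm_x[OF s] norm_x[OF t] by simp
    then have "n a \<noteq> 0" unfolding eq by simp
    then have "a \<noteq> 0" by auto
    then have "n a \<in> N" using a(1) by (auto simp: norm_group_def)
    then have "n (x s) * n (x t) \<in> N #>\<^bsub>field_units\<^esub> n (x (s \<otimes> t))"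
      unfolding eq coset_eq[OF N_subgroup norm_x[OF st]] by blast
    then have "N #>\<^bsub>field_units\<^esub> n (x (s \<otimes> t)) = N #>\<^bsub>field_units\<^esub> (n (x s) * n (x t))"
      by (intro F.repr_independence) (use norm_x[OF st] N_subgroup in auto)
    also have "\<dots> = (N #>\<^bsub>field_units\<^esub> n (x s)) <#>\<^bsub>field_units\<^esub> (N #>\<^bsub>field_units\<^esub> n (x t))"
      using NN.rcos_sum[of "n (x s)" "n (x t)"] norm_x s t by simp
    finally show "N #>\<^bsub>field_units\<^esub> n (x (s \<otimes>\<^bsub>G\<lparr>carrier := H\<rparr>\<^esub> t))
        = (N #>\<^bsub>field_units\<^esub> n (x s)) \<otimes>\<^bsub>field_units Mod N\<^esub> (N #>\<^bsub>field_units\<^esub> n (x t))"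
      by (simp add: FactGroup_def)
  qed
qed

lemma norm_in_coset: "t \<in> H \<Longrightarrow> n (x t) \<in> N #>\<^bsub>field_units\<^esub> n (x t)"
proof -
  interpret F: comm_group "field_units :: 'f monoid" by (rule field_units_group)
  assume "t \<in> H"
  then show ?thesis using F.rcos_self[of "n (x t)" N] N_subgroup norm_x by simp
qed

definition coords :: "('g \<Rightarrow> 'c) set" where
  "coords = {f. (\<forall>t\<in>H. f t \<in> U \<one>) \<and> (\<forall>t. t \<notin> H \<longrightarrow> f t = 0)}"

text \<open>Every component is \<open>U \<one>\<close> times its representative, and the components are orthogonal; so coordinates
  with respect to the representatives diagonalize the norm.\<close>

lemma coordinates_iso:
  assumes full: "total = UNIV"
  shows "linear_iso_on (\<lambda>a f t. scale a (f t)) coords scale UNIV (\<lambda>f. \<Sum>t\<in>H. mul (f t) (x t))"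
    and "\<And>f. f \<in> coords \<Longrightarrow> n (\<Sum>t\<in>H. mul (f t) (x t)) = (\<Sum>t\<in>H. n (x t) * n (f t))"
proof -
  let ?\<Psi> = "\<lambda>f. \<Sum>t\<in>H. mul (f t) (x t)"
  have mem: "mul c (x t) \<in> U t" if "c \<in> U \<one>" "t \<in> H" for c t
    using mul_closed[of \<one> t c "x t"] that x by simp
  show "n (?\<Psi> f) = (\<Sum>t\<in>H. n (x t) * n (f t))" if f: "f \<in> coords" for f
  proof -
    have "n (?\<Psi> f) = (\<Sum>t\<in>H. n (mul (f t) (x t)))"
      by (rule norm_orthogonal_sum) (use mem f in \<open>auto simp: coords_def\<close>)
    then show ?thesis by (simp add: norm_mult mult.commute)
  qed
  have add: "?\<Psi> (f + g) = ?\<Psi> f + ?\<Psi> g" for f g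
    by (simp add: mul_add_left sum.distrib)
  have "inj_on ?\<Psi> coords"
  proof (rule inj_onI)
    fix f g assume f: "f \<in> coords" and g: "g \<in> coords" and eq: "?\<Psi> f = ?\<Psi> g"
    have "f t - g t = 0" if t: "t \<in> H" for t
    proof (rule nondeg_one)
      show d: "f t - g t \<in> U \<one>" using f g t sub[of \<one>] by (auto simp: coords_def intro: subspace_diff)
      fix c assume c: "c \<in> U \<one>"
      have "b (?\<Psi> h) (mul c (x t)) = b (h t) c * n (x t)" if h: "h \<in> coords" for h
      proof -
        have "b (?\<Psi> h) (mul c (x t)) = (\<Sum>s\<in>H. b (mul (h s) (x s)) (mul c (x t)))"
          by (rule b_sum_left)
        also have "\<dots> = (\<Sum>s\<in>H. if s = t then b (h t) c * n (x t) else 0)"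
        proof (rule sum.cong[OF refl])
          fix s assume s: "s \<in> H"
          have "b (mul (h s) (x s)) (mul c (x t)) = 0" if "s \<noteq> t"
            by (rule orthogonal[OF s t that]) (use mem s t c h in \<open>auto simp: coords_def\<close>)
          then show "b (mul (h s) (x s)) (mul c (x t)) = (if s = t then b (h t) c * n (x t) else 0)"
            by (auto simp: b_mul_right)
        qed
        also have "\<dots> = b (h t) c * n (x t)" using t H_finite by simp
        finally show ?thesis .
      qed
      from this[OF f] this[OF g] eq show "b (f t - g t) c = 0"
        using norm_x[OF t] by (simp add: b_diff_left)
    qed
    then have "f t = g t" for t using f g by (cases "t \<in> H") (auto simp: coords_def)
    then show "f = g" by (rule ext)
  qed
  moreover have "?\<Psi> ` coords = UNIV"
  proof -
    have "y \<in> ?\<Psi> ` coords" for y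
    proof -
      obtain f where f: "\<forall>h\<in>H. f h \<in> U h" "y = (\<Sum>h\<in>H. f h)" using decompose full by blast
      have "\<exists>c\<in>U \<one>. f h = mul c (x h)" if "h \<in> H" for h
        using component_eq_one[OF that x(1)[OF that] x(2)[OF that]] f that by auto
      then obtain g where g: "\<And>h. h \<in> H \<Longrightarrow> g h \<in> U \<one> \<and> f h = mul (g h) (x h)" by metis
      let ?g = "\<lambda>h. if h \<in> H then g h else 0"
      have g1: "?g \<in> coords" using g by (auto simp: coords_def)
      have g2: "y = ?\<Psi> ?g" unfolding f(2) using g by (intro sum.cong) auto
      from g2 g1 show ?thesis by (rule image_eqI)
    qed
    then show ?thesis by blast
  qed
  ultimately show "linear_iso_on (\<lambda>a f t. scale a (f t)) coords scale UNIV ?\<Psi>"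
    unfolding linear_iso_on_def bij_betw_def using add by (simp add: mul_scale_left scale_sum_right)
qed

lemma admissible_K:
  assumes full: "total = UNIV" and x1: "x \<one> = one"
  shows "admissible_K scale n G (U \<one>) H (\<lambda>t. N #>\<^bsub>field_units\<^esub> n (x t))"
  unfolding admissible_K_def
proof (intro conjI norm_coset_hom exI[of _ "\<lambda>t. n (x t)"] ballI)
  show "n (x \<one>) = 1" using x1 by simp
  show "n (x t) \<in> N #>\<^bsub>field_units\<^esub> n (x t)" if "t \<in> H" for t using norm_in_coset[OF that] .
  have "isometric scale UNIV n (\<lambda>a f t. scale a (f t)) coords (\<lambda>f. \<Sum>t\<in>H. n (x t) * n (f t))"
  proof (rule isometricI[OF coordinates_iso(1)[OF full]])
    show "n (\<Sum>t\<in>H. mul (f t) (x t)) = (\<Sum>t\<in>H. n (x t) * n (f t))" if "f \<in> coords" for f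
      by (rule coordinates_iso(2)[OF full that])
    show "f + g \<in> coords" if "f \<in> coords" "g \<in> coords" for f g
      using that sub[of \<one>] by (auto simp: coords_def subspace_add)
    show "(\<lambda>t. scale a (f t)) \<in> coords" if "f \<in> coords" for a f
      using that sub[of \<one>] by (auto simp: coords_def subspace_scale)
  qed
  then show "isometric scale UNIV n (\<lambda>a f t. scale a (f t))
      {f. (\<forall>t\<in>H. f t \<in> U \<one>) \<and> (\<forall>t. t \<notin> H \<longrightarrow> f t = 0)} (\<lambda>f. \<Sum>t\<in>H. n (x t) * n (f t))"
    unfolding coords_def .
qed

lemma admissible_F:
  assumes full: "total = UNIV" and x1: "x \<one> = one" and U1: "U \<one> = span {one}"
  shows "admissible_F scale n G H (\<lambda>t. N #>\<^bsub>field_units\<^esub> n (x t))"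
  unfolding admissible_F_def square_group_eq U1[symmetric]
proof (intro conjI norm_coset_hom exI[of _ "\<lambda>t. n (x t)"] ballI)
  show "n (x \<one>) = 1" using x1 by simp
  show "n (x t) \<in> N #>\<^bsub>field_units\<^esub> n (x t)" if "t \<in> H" for t using norm_in_coset[OF that] .
  let ?V = "{f :: 'g \<Rightarrow> 'f. \<forall>t. t \<notin> H \<longrightarrow> f t = 0}"
  let ?e = "\<lambda>f t. scale (f t) one"
  let ?\<Psi> = "\<lambda>f. \<Sum>t\<in>H. mul (f t) (x t)"
  have e: "?e f \<in> coords" if "f \<in> ?V" for f
    using that by (auto simp: coords_def U1 span_singleton)
  have bij: "bij_betw ?e ?V coords"
  proof (rule bij_betwI')
    show "(?e f = ?e g) = (f = g)" if "f \<in> ?V" "g \<in> ?V" for f g by (auto simp: fun_eq_iff)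
    show "?e f \<in> coords" if "f \<in> ?V" for f using e[OF that] .
    show "\<exists>f\<in>?V. g = ?e f" if g: "g \<in> coords" for g
    proof -
      have "\<exists>a. g t = scale a one \<and> (t \<notin> H \<longrightarrow> a = 0)" for t
        using g by (cases "t \<in> H") (auto simp: coords_def U1 span_singleton)
      then obtain f where "\<And>t. g t = scale (f t) one \<and> (t \<notin> H \<longrightarrow> f t = 0)" by metis
      then show ?thesis by (intro bexI[of _ f]) auto
    qed
  qed
  have lin: "linear_iso_on (\<lambda>a f t. a * f t) ?V scale UNIV (?\<Psi> \<circ> ?e)"
    unfolding linear_iso_on_def
  proof (intro conjI)
    show "bij_betw (?\<Psi> \<circ> ?e) ?V UNIV"
      using bij_betw_trans[OF bij] coordinates_iso(1)[OF full] unfolding linear_iso_on_def by blast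
  qed (auto simp: mul_simps scale_left_distrib sum.distrib scale_sum_right)
  show "isometric scale UNIV n (\<lambda>a f t. a * f t) ?V (\<lambda>f. \<Sum>t\<in>H. n (x t) * (f t)\<^sup>2)"
  proof (rule isometricI[OF lin])
    show "n ((?\<Psi> \<circ> ?e) f) = (\<Sum>t\<in>H. n (x t) * (f t)\<^sup>2)" if "f \<in> ?V" for f
      using coordinates_iso(2)[OF full e[OF that]] by (simp add: norm_scale)
  qed auto
qed

end

end

section \<open>The doubling gradings\<close>

context cayley_grading_group
begin

lemma order2_subgroup:
  assumes T: "subgroup T G" "card T = 2"
  obtains t where "T = {\<one>, t}" "t \<noteq> \<one>" "t \<in> carrier G" "t \<otimes> t = \<one>"
proof -
  interpret T: subgroup T G by fact
  obtain a c where "T = {a, c}" "a \<noteq> c" using T(2) by (auto simp: card_2_iff)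
  moreover have "\<one> \<in> T" by (rule T.one_closed)
  ultimately obtain t where t: "T = {\<one>, t}" "t \<noteq> \<one>" by auto
  then have "t \<in> T" by simp
  then have "t \<in> carrier G" "t \<otimes> t \<in> T" by auto
  moreover then have "t \<otimes> t = \<one>" using t by auto
  ultimately show ?thesis using that t by blast
qed

lemma Gamma_Q_supported:
  assumes Q: "quaternion_division_subalgebra scale mul one n Q" and T: "subgroup T G" "card T = 2"
  shows "supported T (Gamma_Q G n Q T)"
proof -
  obtain t where t: "T = {\<one>, t}" "t \<noteq> \<one>" "t \<in> carrier G" "t \<otimes> t = \<one>"
    using order2_subgroup[OF T] by blast
  let ?U = "Gamma_Q G n Q T"
  have U: "?U \<one> = Q" "?U t = perp n Q" using t by (auto simp: Gamma_Q_def)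
  have A: "unital_subalgebra scale mul one Q" and dim: "dim Q = 4"
    and nondeg: "\<And>x. x \<in> Q \<Longrightarrow> (\<And>y. y \<in> Q \<Longrightarrow> b x y = 0) \<Longrightarrow> x = 0"
    and inv: "all_nonzero_invertible mul one Q"
    using Q by (auto simp: quaternion_division_subalgebra_def)
  have sub: "subspace Q" using A by (simp add: unital_subalgebra_def)
  obtain u where u: "u \<in> perp n Q" "n u \<noteq> 0" using perp_nonisotropic[OF sub nondeg] dim by auto
  have D: "division_grading scale mul one n G {\<one>} ?U"
    by (rule trivial_division_grading) (unfold U, fact A, fact norm_invertible[OF inv], fact nondeg)
  have "division_grading scale mul one n G ({\<one>} \<union> (\<lambda>h. h \<otimes> t) ` {\<one>}) ?U"
  proof (rule division_grading.adjoin[OF D t(3) _ t(4)])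
    show "u \<in> perp n (\<Union>h\<in>{\<one>}. ?U h)" using u U by simp
    show "?U (h \<otimes> t) = (\<lambda>x. mul x u) ` ?U h" if "h \<in> {\<one>}" for h
      using that t U double_perp[OF A nondeg dim u] by simp
  qed (use t u in auto)
  moreover have "{\<one>} \<union> (\<lambda>h. h \<otimes> t) ` {\<one>} = T" using t by auto
  ultimately show ?thesis by (auto simp: supported_def Gamma_Q_def t(1))
qed

lemma Gamma_Q_one: "Gamma_Q G n Q T \<one> = Q"
  by (simp add: Gamma_Q_def)

lemma elementary_abelianD:
  assumes "elementary_abelian_2_subgroup G k T"
  shows "subgroup T G" "card T = k" "\<And>t. t \<in> T \<Longrightarrow> t \<otimes> t = \<one>"
  using assms by (auto simp: elementary_abelian_2_subgroup_def)

text \<open>The grading arises from \<open>K\<close>, in degree \<open>\<one>\<close>, by adjoining \<open>u\<close> and then \<open>v\<close>. The last component is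
  described as \<open>K(uv)\<close> but arises as \<open>(Ku)v\<close>; the two agree because \<open>k(uv) = (cnj k \<cdot> u)v\<close>.\<close>

lemma doubling_grading_K_supported:
  assumes K: "quadratic_separable_subfield scale mul one K"
    and T: "elementary_abelian_2_subgroup G 4 T"
    and \<mu>: "\<mu> \<in> hom (G\<lparr>carrier := T\<rparr>) (field_units Mod norm_group n K)"
    and dbl: "doubling_grading_K mul n G K T \<mu> U"
  shows "supported T U" "U \<one> = K" "norm_typed T \<mu> U"
proof -
  have A: "unital_subalgebra scale mul one K" and inv: "all_nonzero_invertible mul one K"
    using K by (auto simp: quadratic_separable_subfield_def)
  note nondeg = quadratic_subfield_nondeg[OF K]
  note aniso = norm_invertible[OF inv]
  have oneK: "one \<in> K" using A by (simp add: unital_subalgebra_def)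
  obtain t1 t2 u v where Teq: "T = {\<one>, t1, t2, t1 \<otimes> t2}"
    and u: "u \<in> perp n K" "n u \<noteq> 0" and v: "v \<in> perp n (K \<union> (\<lambda>x. mul x u) ` K)" "n v \<noteq> 0"
    and nu: "n u \<in> \<mu> t1" and nv: "n v \<in> \<mu> t2"
    and Ueq: "U = (\<lambda>g. if g = \<one> then K else if g = t1 then (\<lambda>x. mul x u) ` K
                 else if g = t2 then (\<lambda>x. mul x v) ` K
                 else if g = t1 \<otimes> t2 then (\<lambda>x. mul x (mul u v)) ` K else {0})"
    using dbl unfolding doubling_grading_K_def by (elim exE conjE) (rule that; assumption)
  note Tab = elementary_abelianD[OF T]
  interpret T: subgroup T G by (rule Tab(1))
  have mem: "t1 \<in> T" "t2 \<in> T" "t1 \<otimes> t2 \<in> T" unfolding Teq by simp_all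
  have car: "t1 \<in> carrier G" "t2 \<in> carrier G"
    using T.mem_carrier[OF mem(1)] T.mem_carrier[OF mem(2)] .
  have "card (set [\<one>, t1, t2, t1 \<otimes> t2]) = length [\<one>, t1, t2, t1 \<otimes> t2]"
    using Tab(2) unfolding Teq by simp
  then have "distinct [\<one>, t1, t2, t1 \<otimes> t2]" by (rule card_distinct)
  then have dist: "t1 \<noteq> \<one>" "t2 \<noteq> \<one>" "t2 \<noteq> t1" "t1 \<otimes> t2 \<noteq> \<one>" "t1 \<otimes> t2 \<noteq> t1" "t1 \<otimes> t2 \<noteq> t2"
    by (auto simp del: G.l_cancel_one G.r_cancel_one G.l_cancel_one' G.r_cancel_one')
  have U: "U \<one> = K" "U t1 = (\<lambda>x. mul x u) ` K" "U t2 = (\<lambda>x. mul x v) ` K"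
    "U (t1 \<otimes> t2) = (\<lambda>x. mul x (mul u v)) ` K"
    unfolding Ueq by (simp_all only: dist if_False if_True refl simp_thms)
  have U0: "U g = {0}" if "g \<notin> T" for g
  proof -
    have "g \<noteq> \<one>" "g \<noteq> t1" "g \<noteq> t2" "g \<noteq> t1 \<otimes> t2" using that unfolding Teq by blast+
    then show ?thesis unfolding Ueq by (simp only: if_False)
  qed
  show "U \<one> = K" by (rule U)
  have vK: "\<And>k. k \<in> K \<Longrightarrow> b v k = 0" and vKu: "\<And>k. k \<in> K \<Longrightarrow> b v (mul k u) = 0"
    using v(1) by (auto simp: perp_def)
  have uK: "\<And>k. k \<in> K \<Longrightarrow> b u k = 0" using u(1) by (auto simp: perp_def)
  note cnjK = cnj_closed_subalgebra[OF A]
  have swap: "mul k (mul u v) = mul (mul (cnj k) u) v" if k: "k \<in> K" for k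
  proof -
    have cu: "cnj u = - u" using uK[OF oneK] by (rule cnj_trace_zero)
    have uk: "mul u k = mul (cnj k) u"
      using mul_perp_commute[of u "cnj k"] uK oneK k by simp
    have "mul k (mul u v) = mul (mul u k) v"
    proof (rule doubling_left)
      show "b v (cnj u) = 0" using vKu[OF oneK] cu by (simp add: one_mul b_minus_right)
      have "cnj (mul u k) = - mul (cnj k) u" by (simp add: cnj_mul_distrib cu mul_minus_right)
      then show "b v (cnj (mul u k)) = 0" using vKu[OF cnjK[OF k]] by (simp add: b_minus_right)
    qed (use vK oneK cnjK k in auto)
    then show ?thesis by (simp add: uk)
  qed
  have cnj_image: "cnj ` K = K"
  proof
    show "cnj ` K \<subseteq> K" using cnjK by auto
    show "K \<subseteq> cnj ` K"
    proof
      fix x assume "x \<in> K"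
      then show "x \<in> cnj ` K" using cnjK by (intro image_eqI[of _ _ "cnj x"]) auto
    qed
  qed
  have "(\<lambda>x. mul x (mul u v)) ` K = (\<lambda>x. mul (mul (cnj x) u) v) ` K"
    using swap by (intro image_cong) auto
  also have "\<dots> = (\<lambda>x. mul (mul x u) v) ` (cnj ` K)" by (simp only: image_image)
  also have "\<dots> = (\<lambda>x. mul x v) ` ((\<lambda>x. mul x u) ` K)" by (simp only: cnj_image image_image)
  finally have U12: "U (t1 \<otimes> t2) = (\<lambda>x. mul x v) ` U t1" by (simp add: U)
  have D0: "division_grading scale mul one n G {\<one>} U"
    by (rule trivial_division_grading) (unfold U, fact A, fact aniso, fact nondeg)
  have H1: "{\<one>} \<union> (\<lambda>h. h \<otimes> t1) ` {\<one>} = {\<one>, t1}" using car by auto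
  have D1: "division_grading scale mul one n G {\<one>, t1} U"
    unfolding H1[symmetric]
  proof (rule division_grading.adjoin[OF D0 car(1) _ Tab(3)[OF mem(1)]])
    show "u \<in> perp n (\<Union>h\<in>{\<one>}. U h)" using u U by simp
    show "U (h \<otimes> t1) = (\<lambda>x. mul x u) ` U h" if "h \<in> {\<one>}" for h using that car U by simp
  qed (use dist u in auto)
  have H2: "{\<one>, t1} \<union> (\<lambda>h. h \<otimes> t2) ` {\<one>, t1} = T" using car unfolding Teq by auto
  have D2: "division_grading scale mul one n G T U"
    unfolding H2[symmetric]
  proof (rule division_grading.adjoin[OF D1 car(2) _ Tab(3)[OF mem(2)]])
    show "v \<in> perp n (\<Union>h\<in>{\<one>, t1}. U h)" using v U by simp
    show "U (h \<otimes> t2) = (\<lambda>x. mul x v) ` U h" if "h \<in> {\<one>, t1}" for h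
    proof (cases "h = \<one>")
      case True
      then show ?thesis using car U by simp
    next
      case False
      then show ?thesis using that U12 by simp
    qed
  qed (use dist v in auto)
  show sup: "supported T U" using D2 U0 by (simp add: supported_def)
  have 1: "1 \<in> \<mu> \<one>"
    by (rule coset_one_subgroup[OF norm_group_subgroup[OF A aniso] Tab(1) G.group_axioms \<mu>]) auto
  have 12: "n u * n v \<in> \<mu> (t1 \<otimes> t2)" by (rule hom_coset_closed[OF \<mu> mem(1,2) nu nv])
  have "\<exists>x\<in>U t. n x \<noteq> 0 \<and> n x \<in> \<mu> t" if t: "t \<in> T" for t
  proof -
    from t consider "t = \<one>" | "t = t1" | "t = t2" | "t = t1 \<otimes> t2" unfolding Teq by blast
    then show ?thesis
    proof cases
      case 1
      then show ?thesis using U oneK \<open>1 \<in> \<mu> \<one>\<close> by (intro bexI[of _ one]) auto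
    next
      case 2
      then show ?thesis using U oneK u nu by (intro bexI[of _ u]) (auto simp: image_iff one_mul intro!: bexI[of _ one])
    next
      case 3
      then show ?thesis using U oneK v nv by (intro bexI[of _ v]) (auto simp: image_iff one_mul intro!: bexI[of _ one])
    next
      case 4
      then show ?thesis using U oneK u v 12
        by (intro bexI[of _ "mul u v"]) (auto simp: norm_mult image_iff one_mul intro!: bexI[of _ one])
    qed
  qed
  then show "norm_typed T \<mu> U" by (simp add: norm_typed_def)
qed

lemma two_neq_zero: "CHAR('f) \<noteq> 2 \<Longrightarrow> (2::'f) \<noteq> 0"
proof
  assume "CHAR('f) \<noteq> 2" "(2::'f) = 0"
  then have "CHAR('f) dvd 2" using of_nat_eq_0_iff_char_dvd[of 2, where 'a = 'f] by simp
  then have "CHAR('f) = 1 \<or> CHAR('f) = 2" using prime_nat_iff[of 2] two_is_prime_nat by blast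
  then show False using \<open>CHAR('f) \<noteq> 2\<close> CHAR_not_1[where 'a = 'f] by simp
qed

lemma scalar_nondeg: "(2::'f) \<noteq> 0 \<Longrightarrow> x \<in> span {one} \<Longrightarrow> (\<And>y. y \<in> span {one} \<Longrightarrow> b x y = 0) \<Longrightarrow> x = 0"
proof -
  assume two: "(2::'f) \<noteq> 0" and x: "x \<in> span {one}" and perp: "\<And>y. y \<in> span {one} \<Longrightarrow> b x y = 0"
  obtain a where a: "x = scale a one" using x by (auto simp: span_singleton)
  have "b x one = 0" using perp by (simp add: span_base)
  then show "x = 0" using a two by (simp add: b_simps b_one_one)
qed

lemma scalar_aniso: "x \<in> span {one} \<Longrightarrow> x \<noteq> 0 \<Longrightarrow> n x \<noteq> 0"
  by (auto simp: span_singleton norm_scale)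

lemma span_mul_image: "(\<lambda>x. mul x u) ` span {y} = span {mul y u}"
proof -
  interpret lin: Vector_Spaces.linear scale scale "\<lambda>x. mul x u" by (rule mul_linear_left)
  show ?thesis using lin.span_image[of "{y}"] by simp
qed

lemma order8_subgroup:
  assumes T: "elementary_abelian_2_subgroup G 8 T" and s: "s1 \<in> T" "s2 \<in> T" "s3 \<in> T"
    and gen: "generate G {s1, s2, s3} = T"
  shows "T = {\<one>, s1, s2, s1 \<otimes> s2, s3, s1 \<otimes> s3, s2 \<otimes> s3, s1 \<otimes> s2 \<otimes> s3}"
    "distinct [\<one>, s1, s2, s1 \<otimes> s2, s3, s1 \<otimes> s3, s2 \<otimes> s3, s1 \<otimes> s2 \<otimes> s3]"
    "{\<one>, s1, s2, s1 \<otimes> s2} \<union> (\<lambda>h. h \<otimes> s3) ` {\<one>, s1, s2, s1 \<otimes> s2} = T"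
proof -
  note Tab = elementary_abelianD[OF T]
  interpret T: subgroup T G by (rule Tab(1))
  have car: "s1 \<in> carrier G" "s2 \<in> carrier G" "s3 \<in> carrier G" using s by auto
  note three = G.three_involutions[OF car(1) Tab(3)[OF s(1)] car(2) Tab(3)[OF s(2)] car(3) Tab(3)[OF s(3)]]
  show Teq: "T = {\<one>, s1, s2, s1 \<otimes> s2, s3, s1 \<otimes> s3, s2 \<otimes> s3, s1 \<otimes> s2 \<otimes> s3}"
    using three(2) gen by metis
  show "{\<one>, s1, s2, s1 \<otimes> s2} \<union> (\<lambda>h. h \<otimes> s3) ` {\<one>, s1, s2, s1 \<otimes> s2} = T"
    unfolding three(1) Teq[symmetric] ..
  have "card (set [\<one>, s1, s2, s1 \<otimes> s2, s3, s1 \<otimes> s3, s2 \<otimes> s3, s1 \<otimes> s2 \<otimes> s3])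
      = length [\<one>, s1, s2, s1 \<otimes> s2, s3, s1 \<otimes> s3, s2 \<otimes> s3, s1 \<otimes> s2 \<otimes> s3]"
    using Tab(2) arg_cong[OF Teq, of card] by simp
  then show "distinct [\<one>, s1, s2, s1 \<otimes> s2, s3, s1 \<otimes> s3, s2 \<otimes> s3, s1 \<otimes> s2 \<otimes> s3]"
    by (rule card_distinct)
qed

definition doubling_pairs :: "'g \<Rightarrow> 'g \<Rightarrow> 'g \<Rightarrow> 'c \<Rightarrow> 'c \<Rightarrow> 'c \<Rightarrow> ('c \<times> 'g) set" where
  "doubling_pairs s1 s2 s3 u v w =
    {(one, \<one>), (u, s1), (v, s2), (mul u v, s1 \<otimes> s2), (w, s3), (mul u w, s1 \<otimes> s3),
     (mul v w, s2 \<otimes> s3), (mul (mul u v) w, s1 \<otimes> s2 \<otimes> s3)}"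

text \<open>The abbreviations for the products in the proof keep simplification from applying group laws to
  the degrees.\<close>

lemma doubling_pairs_components:
  assumes "distinct [\<one>, s1, s2, s1 \<otimes> s2, s3, s1 \<otimes> s3, s2 \<otimes> s3, s1 \<otimes> s2 \<otimes> s3]"
  shows "{x. (x, \<one>) \<in> doubling_pairs s1 s2 s3 u v w} = {one}"
    "{x. (x, s1) \<in> doubling_pairs s1 s2 s3 u v w} = {u}"
    "{x. (x, s2) \<in> doubling_pairs s1 s2 s3 u v w} = {v}"
    "{x. (x, s1 \<otimes> s2) \<in> doubling_pairs s1 s2 s3 u v w} = {mul u v}"
    "{x. (x, s3) \<in> doubling_pairs s1 s2 s3 u v w} = {w}"
    "{x. (x, s1 \<otimes> s3) \<in> doubling_pairs s1 s2 s3 u v w} = {mul u w}"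
    "{x. (x, s2 \<otimes> s3) \<in> doubling_pairs s1 s2 s3 u v w} = {mul v w}"
    "{x. (x, s1 \<otimes> s2 \<otimes> s3) \<in> doubling_pairs s1 s2 s3 u v w} = {mul (mul u v) w}"
proof -
  define p q r k where "p = s1 \<otimes> s2" "q = s1 \<otimes> s3" "r = s2 \<otimes> s3" "k = s1 \<otimes> s2 \<otimes> s3"
  define e where "e = \<one>"
  have d: "distinct [e, s1, s2, p, s3, q, r, k]" using assms by (simp only: p_q_r_k_def e_def)
  note pairs = doubling_pairs_def[of s1 s2 s3 u v w, folded e_def p_q_r_k_def(4) p_q_r_k_def(1-3)]
  show "{x. (x, \<one>) \<in> doubling_pairs s1 s2 s3 u v w} = {one}"
    unfolding pairs e_def[symmetric] using d by auto
  show "{x. (x, s1) \<in> doubling_pairs s1 s2 s3 u v w} = {u}"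
    unfolding pairs using d by auto
  show "{x. (x, s2) \<in> doubling_pairs s1 s2 s3 u v w} = {v}"
    unfolding pairs using d by auto
  show "{x. (x, s1 \<otimes> s2) \<in> doubling_pairs s1 s2 s3 u v w} = {mul u v}"
    unfolding pairs p_q_r_k_def(1)[symmetric] using d by auto
  show "{x. (x, s3) \<in> doubling_pairs s1 s2 s3 u v w} = {w}"
    unfolding pairs using d by auto
  show "{x. (x, s1 \<otimes> s3) \<in> doubling_pairs s1 s2 s3 u v w} = {mul u w}"
    unfolding pairs p_q_r_k_def(2)[symmetric] using d by auto
  show "{x. (x, s2 \<otimes> s3) \<in> doubling_pairs s1 s2 s3 u v w} = {mul v w}"
    unfolding pairs p_q_r_k_def(3)[symmetric] using d by auto
  show "{x. (x, s1 \<otimes> s2 \<otimes> s3) \<in> doubling_pairs s1 s2 s3 u v w} = {mul (mul u v) w}"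
    unfolding pairs p_q_r_k_def(4)[symmetric] using d by auto
qed

text \<open>Three doubling steps starting from the scalars, which form a nondegenerate subalgebra because the
  characteristic is not 2.\<close>

lemma doubling_grading_F_supported:
  assumes char: "CHAR('f) \<noteq> 2"
    and T: "elementary_abelian_2_subgroup G 8 T"
    and \<mu>: "\<mu> \<in> hom (G\<lparr>carrier := T\<rparr>) (field_units Mod square_group)"
    and dbl: "doubling_grading_F scale mul one n G T \<mu> U"
  shows "supported T U" "U \<one> = span {one}" "norm_typed T \<mu> U"
proof -
  obtain s1 s2 s3 u v w where Ueq: "U = (\<lambda>g. span {x. (x, g) \<in> doubling_pairs s1 s2 s3 u v w})"
    and s: "s1 \<in> T" "s2 \<in> T" "s3 \<in> T" and gen: "generate G {s1, s2, s3} = T"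
    and u: "u \<in> perp n {one}" "n u \<noteq> 0" and v: "v \<in> perp n {one, u}" "n v \<noteq> 0"
    and w: "w \<in> perp n {one, u, v, mul u v}" "n w \<noteq> 0"
    and nm: "n u \<in> \<mu> s1" "n v \<in> \<mu> s2" "n w \<in> \<mu> s3"
    using dbl unfolding doubling_grading_F_def doubling_pairs_def[symmetric]
    by (elim exE conjE) (rule that; assumption)
  note Tab = elementary_abelianD[OF T]
  interpret T: subgroup T G by (rule Tab(1))
  have car: "s1 \<in> carrier G" "s2 \<in> carrier G" "s3 \<in> carrier G" using s by auto
  note facts = order8_subgroup[OF T s gen]
  have U: "U \<one> = span {one}" "U s1 = span {u}" "U s2 = span {v}" "U (s1 \<otimes> s2) = span {mul u v}"
    "U s3 = span {w}" "U (s1 \<otimes> s3) = span {mul u w}" "U (s2 \<otimes> s3) = span {mul v w}"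
    "U (s1 \<otimes> s2 \<otimes> s3) = span {mul (mul u v) w}"
    unfolding Ueq doubling_pairs_components[OF facts(2)] by (rule refl)+
  show "U \<one> = span {one}" by (rule U)
  have U0: "U g = {0}" if "g \<notin> T" for g
  proof -
    have "{x. (x, g) \<in> doubling_pairs s1 s2 s3 u v w} = {}"
      using that unfolding facts(1) doubling_pairs_def by auto
    then show ?thesis by (simp add: Ueq)
  qed
  have D0: "division_grading scale mul one n G {\<one>} U"
    by (rule trivial_division_grading)
      (unfold U, rule scalar_subalgebra, erule (1) scalar_aniso, rule scalar_nondeg[OF two_neq_zero[OF char]])
  have H1: "{\<one>} \<union> (\<lambda>h. h \<otimes> s1) ` {\<one>} = {\<one>, s1}" using car by auto
  have D1: "division_grading scale mul one n G {\<one>, s1} U"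
    unfolding H1[symmetric]
  proof (rule division_grading.adjoin[OF D0 car(1) _ Tab(3)[OF s(1)]])
    show "u \<in> perp n (\<Union>h\<in>{\<one>}. U h)" using u U by (simp add: perp_span)
    show "U (h \<otimes> s1) = (\<lambda>x. mul x u) ` U h" if "h \<in> {\<one>}" for h
      using that car U by (simp add: span_mul_image one_mul)
    show "s1 \<notin> {\<one>}" using facts(2) by auto
  qed (use u in auto)
  have H2: "{\<one>, s1} \<union> (\<lambda>h. h \<otimes> s2) ` {\<one>, s1} = {\<one>, s1, s2, s1 \<otimes> s2}" using car by auto
  have perp_Un: "x \<in> perp n (A \<union> B) \<longleftrightarrow> x \<in> perp n A \<and> x \<in> perp n B" for x A B
    by (auto simp: perp_def)
  have D2: "division_grading scale mul one n G {\<one>, s1, s2, s1 \<otimes> s2} U"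
    unfolding H2[symmetric]
  proof (rule division_grading.adjoin[OF D1 car(2) _ Tab(3)[OF s(2)]])
    show "v \<in> perp n (\<Union>h\<in>{\<one>, s1}. U h)"
      using v U by (simp add: perp_Un perp_span) (simp add: perp_def)
    show "U (h \<otimes> s2) = (\<lambda>x. mul x v) ` U h" if "h \<in> {\<one>, s1}" for h
      using that car U by (elim insertE emptyE) (simp_all add: span_mul_image one_mul)
    show "s2 \<notin> {\<one>, s1}" using facts(2) by auto
  qed (use v in auto)
  have D3: "division_grading scale mul one n G T U"
    unfolding facts(3)[symmetric]
  proof (rule division_grading.adjoin[OF D2 car(3) _ Tab(3)[OF s(3)]])
    show "w \<in> perp n (\<Union>h\<in>{\<one>, s1, s2, s1 \<otimes> s2}. U h)"
      using w U by (simp add: perp_Un perp_span) (simp add: perp_def)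
    show "U (h \<otimes> s3) = (\<lambda>x. mul x w) ` U h" if "h \<in> {\<one>, s1, s2, s1 \<otimes> s2}" for h
      using that car U by (elim insertE emptyE) (simp_all add: span_mul_image one_mul)
    show "s3 \<notin> {\<one>, s1, s2, s1 \<otimes> s2}" using facts(2) by (simp only: distinct.simps) auto
  qed (use w in auto)
  show "supported T U" using D3 U0 by (simp add: supported_def)
  have 1: "1 \<in> \<mu> \<one>"
    by (rule coset_one_subgroup[OF _ Tab(1) G.group_axioms \<mu>])
      (unfold square_group_eq, rule norm_group_subgroup[OF scalar_subalgebra], erule (1) scalar_aniso)
  note clo = hom_coset_closed[OF \<mu>]
  have m12: "n u * n v \<in> \<mu> (s1 \<otimes> s2)" by (rule clo[OF s(1,2) nm(1,2)])
  have m13: "n u * n w \<in> \<mu> (s1 \<otimes> s3)" by (rule clo[OF s(1,3) nm(1,3)])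
  have m23: "n v * n w \<in> \<mu> (s2 \<otimes> s3)" by (rule clo[OF s(2,3) nm(2,3)])
  have m123: "n u * n v * n w \<in> \<mu> (s1 \<otimes> s2 \<otimes> s3)"
    by (rule clo[OF T.m_closed[OF s(1,2)] s(3) m12 nm(3)])
  have wit: "\<exists>x\<in>U t. n x \<noteq> 0 \<and> n x \<in> \<mu> t" if "U t = span {x}" "n x \<noteq> 0" "n x \<in> \<mu> t" for t x
    using that by (intro bexI[of _ x]) (auto intro: span_base)
  have "\<exists>x\<in>U t. n x \<noteq> 0 \<and> n x \<in> \<mu> t" if t: "t \<in> T" for t
    using t[unfolded facts(1)] u(2) v(2) w(2) 1 nm m12 m13 m23 m123
    by (elim insertE emptyE)
      (simp_all only:, auto intro!: wit[OF U(1)] wit[OF U(2)] wit[OF U(3)] wit[OF U(4)]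
        wit[OF U(5)] wit[OF U(6)] wit[OF U(7)] wit[OF U(8)] simp: norm_mult)
  then show "norm_typed T \<mu> U" by (simp add: norm_typed_def)
qed

end

section \<open>Witt extension and existence of the doubling gradings\<close>

context cayley_algebra
begin

definition isometry :: "('c \<Rightarrow> 'c) \<Rightarrow> bool" where
  "isometry h \<longleftrightarrow> Vector_Spaces.linear scale scale h \<and> (\<forall>x. n (h x) = n x)"

lemma isometryD:
  assumes "isometry h"
  shows "h (x + y) = h x + h y" "h (scale a x) = scale a (h x)" "n (h x) = n x" "b (h x) (h y) = b x y"
proof -
  interpret h: Vector_Spaces.linear scale scale h using assms by (simp add: isometry_def)
  show 1: "h (x + y) = h x + h y" for x y by (rule h.add)
  show "h (scale a x) = scale a (h x)" by (rule h.scale)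
  show 2: "n (h x) = n x" for x using assms by (simp add: isometry_def)
  show "b (h x) (h y) = b x y" unfolding polar_def by (simp add: 2 flip: 1)
qed

lemma isometry_comp:
  assumes "isometry h" "isometry k"
  shows "isometry (\<lambda>x. h (k x))"
  using assms unfolding isometry_def
  by (auto intro: Vector_Spaces.linear_compose[unfolded comp_def])

lemma isometryI:
  assumes "\<And>x y. h (x + y) = h x + h y" "\<And>a x. h (scale a x) = scale a (h x)" "\<And>x. n (h x) = n x"
  shows "isometry h"
  unfolding isometry_def using assms vector_space_axioms
  by (simp add: Vector_Spaces.linear_iff vector_space_def)

definition reflection :: "'c \<Rightarrow> 'c \<Rightarrow> 'c" where
  "reflection z x = x - scale (b x z / n z) z"

lemma isometry_reflection:
  assumes "n z \<noteq> 0"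
  shows "isometry (reflection z)"
proof (rule isometryI)
  show "reflection z (x + y) = reflection z x + reflection z y" for x y
    by (simp add: reflection_def b_simps add_divide_distrib scale_left_distrib)
  show "reflection z (scale a x) = scale a (reflection z x)" for a x
    by (simp add: reflection_def b_simps scale_right_diff_distrib)
  show "n (reflection z x) = n x" for x
    using assms by (simp add: reflection_def norm_diff norm_scale b_simps power2_eq_square)
qed

lemma reflection_swap:
  assumes "n x = n y" "n (x - y) \<noteq> 0"
  shows "reflection (x - y) x = y"
proof -
  have "b x (x - y) = n (x - y)" using assms(1) by (simp add: b_simps b_self norm_diff)
  then show ?thesis using assms(2) by (simp add: reflection_def)
qed

lemma reflection_fixes: "b z x = 0 \<Longrightarrow> reflection x z = z"
  by (simp add: reflection_def)

lemma scale_two: "scale 2 x = x + x"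
  using scale_left_distrib[of 1 1 x] by simp

lemma reflection_self: "n x \<noteq> 0 \<Longrightarrow> reflection x x = - x"
  by (simp add: reflection_def b_self scale_two)

text \<open>The sum of the norms of \<open>x - y\<close> and \<open>x + y\<close> is \<open>4 * n y\<close>, so one of the two is nonisotropic and
  provides a reflection.\<close>

lemma witt_vector:
  assumes two: "(2::'f) \<noteq> 0" and n: "n x = n y" "n y \<noteq> 0"
  shows "\<exists>h. isometry h \<and> h x = y \<and> (\<forall>z. b z x = 0 \<longrightarrow> b z y = 0 \<longrightarrow> h z = z)"
proof (cases "n (x - y) = 0")
  case False
  have "reflection (x - y) z = z" if "b z x = 0" "b z y = 0" for z
    using that by (intro reflection_fixes) (simp add: b_simps)
  then show ?thesis
    using isometry_reflection[OF False] reflection_swap[OF n(1) False] by blast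
next
  case True
  have "n (x - - y) + n (x - y) = (2 * 2) * n y" using n(1) by (simp add: norm_diff norm_add)
  moreover have "(2 * 2) * n y \<noteq> 0" using two n(2) by (simp only: mult_eq_0_iff) simp
  ultimately have ne: "n (x - - y) \<noteq> 0" using True by (simp only: add_0_right) simp
  let ?h = "\<lambda>z. reflection y (reflection (x - - y) z)"
  have "reflection (x - - y) x = - y" using n(1) ne by (intro reflection_swap) simp_all
  moreover have "reflection y (- y) = y"
    using n(2) by (simp add: reflection_def b_simps b_self scale_two)
  ultimately have "?h x = y" by simp
  moreover have "isometry ?h" by (rule isometry_comp[OF isometry_reflection[OF n(2)] isometry_reflection[OF ne]])
  moreover have "?h z = z" if "b z x = 0" "b z y = 0" for z
  proof -
    have "reflection (x - - y) z = z" using that by (intro reflection_fixes) (simp add: b_simps)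
    then show ?thesis using that by (simp add: reflection_fixes)
  qed
  ultimately show ?thesis by blast
qed

text \<open>If \<open>y - y'\<close> is nonisotropic, the reflection in it serves, with \<open>\<sigma> = 1\<close>. Otherwise \<open>y\<close> is first reflected in
  \<open>x\<close>: then the norm of the sum of the image and \<open>y'\<close> is the discriminant divided by \<open>n x\<close>, hence
  nonzero, and the reflection in that sum sends the image to \<open>- y'\<close> and fixes \<open>- x\<close>.\<close>

lemma witt_plane:
  assumes n: "n y = n y'" "b x y = b x y'" and x: "n x \<noteq> 0"
    and disc: "4 * n x * n y \<noteq> (b x y)\<^sup>2"
  shows "\<exists>h \<sigma>. isometry h \<and> \<sigma> * \<sigma> = (1::'f) \<and> h x = scale \<sigma> x \<and> h y = scale \<sigma> y' \<and>
    (\<forall>z. b z x = 0 \<longrightarrow> b z y = 0 \<longrightarrow> b z y' = 0 \<longrightarrow> h z = z)"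
proof (cases "n (y - y') = 0")
  case False
  have "reflection (y - y') z = z" if "b z y = 0" "b z y' = 0" for z
    using that by (intro reflection_fixes) (simp add: b_simps)
  moreover have "reflection (y - y') x = x"
    using n(2) by (intro reflection_fixes) (simp add: b_simps)
  ultimately show ?thesis
    using isometry_reflection[OF False] reflection_swap[OF n(1) False]
    by (intro exI[of _ "reflection (y - y')"] exI[of _ 1]) simp
next
  case True
  define s where "s = reflection x y"
  have s: "s = y - scale (b x y / n x) x" by (simp add: s_def reflection_def b_commute)
  have byy': "b y y' = 2 * n y" using True n(1) by (simp add: norm_diff)
  have ns: "n s = n y" unfolding s_def using isometry_reflection[OF x] by (simp add: isometry_def)
  have "n (s - - y') = n y + n y + b s y'" using n(1) ns by (simp add: norm_add)
  also have "b s y' = 2 * n y - (b x y)\<^sup>2 / n x"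
    using n(2) by (simp add: s b_simps byy' power2_eq_square)
  finally have "n x * n (s - - y') = 4 * n x * n y - (b x y)\<^sup>2"
    using x by (simp add: field_simps)
  then have ne: "n (s - - y') \<noteq> 0" using disc by auto
  let ?h = "\<lambda>z. reflection (s - - y') (reflection x z)"
  have iso: "isometry ?h" by (rule isometry_comp[OF isometry_reflection[OF ne] isometry_reflection[OF x]])
  have rx: "reflection x x = - x"
    using x by (rule reflection_self)
  have "b x s = - b x y" using x by (simp add: s b_simps b_self)
  then have "b (- x) (s - - y') = 0" using n(2) by (simp add: b_simps)
  then have hx: "?h x = - x" unfolding rx by (rule reflection_fixes)
  have hy: "?h y = - y'"
    unfolding s_def[symmetric] by (rule reflection_swap[OF _ ne]) (simp add: ns n)
  have "?h z = z" if "b z x = 0" "b z y = 0" "b z y' = 0" for z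
  proof -
    have "reflection x z = z" using that by (simp add: reflection_fixes)
    moreover have "b z (s - - y') = 0" using that by (simp add: s b_simps)
    ultimately show ?thesis by (simp add: reflection_fixes)
  qed
  then show ?thesis
    using iso hx hy by (intro exI[of _ ?h] exI[of _ "-1"]) simp
qed

lemma isometry_mul: "n c = 1 \<Longrightarrow> isometry (mul c)"
  by (rule isometryI) (simp_all add: mul_simps norm_mult)

lemma isometry_scale: "isometry h \<Longrightarrow> \<sigma> * \<sigma> = 1 \<Longrightarrow> isometry (\<lambda>x. scale \<sigma> (h x))"
  by (rule isometryI)
    (simp_all add: isometryD norm_scale scale_right_distrib mult.commute power2_eq_square)

text \<open>If the discriminant vanished, \<open>2a - tr a\<close> would be orthogonal to \<open>K\<close> and hence zero; this forces
  characteristic 2 and \<open>tr a = 0\<close>, so that \<open>one\<close> would be orthogonal to \<open>K\<close>.\<close>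

lemma quadratic_subfield_discriminant:
  assumes K: "quadratic_separable_subfield scale mul one K"
    and a: "a \<in> K" "\<And>c. a \<noteq> scale c one"
  shows "4 * n one * n a \<noteq> (b one a)\<^sup>2"
proof
  assume disc: "4 * n one * n a = (b one a)\<^sup>2"
  have A: "unital_subalgebra scale mul one K" and dimK: "dim K = 2"
    using K by (auto simp: quadratic_separable_subfield_def)
  have sub: "subspace K" and oneK: "one \<in> K" using A by (auto simp: unital_subalgebra_def)
  let ?c = "scale 2 a - scale (b one a) one"
  have perp: "b ?c y = 0" if y: "y \<in> K" for y
  proof -
    obtain p q where "y = scale p one + scale q a" using dim2_span[OF sub oneK dimK a y] by blast
    then show ?thesis
      using disc b_commute[of a one] by (simp add: b_simps b_self b_one_one power2_eq_square algebra_simps)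
  qed
  have "?c \<in> K" using sub a oneK by (simp add: subspace_diff subspace_scale)
  then have c0: "?c = 0" using quadratic_subfield_nondeg[OF K _ perp] by blast
  have two: "(2::'f) = 0"
  proof (rule ccontr)
    assume "(2::'f) \<noteq> 0"
    then have "a = scale (inverse 2 * b one a) one" using arg_cong[OF c0, of "scale (inverse 2)"]
      by (simp add: scale_right_diff_distrib)
    then show False using a(2) by blast
  qed
  then have tr: "b one a = 0" using c0 by simp
  have "b one y = 0" if y: "y \<in> K" for y
  proof -
    obtain p q where "y = scale p one + scale q a" using dim2_span[OF sub oneK dimK a y] by blast
    then show ?thesis using tr two by (simp add: b_simps b_one_one)
  qed
  then have "one = 0" using quadratic_subfield_nondeg[OF K oneK] by blast
  then show False by simp
qed

text \<open>The vectors \<open>e t k\<close> are the preimages of the functions on \<open>T\<close> that take the value \<open>k\<close> at \<open>t\<close> and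
  vanish elsewhere.\<close>

lemma orthogonal_frame_K:
  assumes iso: "isometric scale UNIV n (\<lambda>a f t. scale a (f t))
      {f. (\<forall>t\<in>T. f t \<in> K) \<and> (\<forall>t. t \<notin> T \<longrightarrow> f t = 0)} (\<lambda>f. \<Sum>t\<in>T. r t * n (f t))"
    and T: "finite T" and K: "subspace K"
  obtains e where "\<And>t k. t \<in> T \<Longrightarrow> k \<in> K \<Longrightarrow> n (e t k) = r t * n k"
    "\<And>t k l. t \<in> T \<Longrightarrow> k \<in> K \<Longrightarrow> l \<in> K \<Longrightarrow> b (e t k) (e t l) = r t * b k l"
    "\<And>s t k l. s \<in> T \<Longrightarrow> t \<in> T \<Longrightarrow> s \<noteq> t \<Longrightarrow> k \<in> K \<Longrightarrow> l \<in> K \<Longrightarrow> b (e s k) (e t l) = 0"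
proof -
  let ?V = "{f. (\<forall>t\<in>T. f t \<in> K) \<and> (\<forall>t. t \<notin> T \<longrightarrow> f t = 0)}"
  let ?q = "\<lambda>f. \<Sum>t\<in>T. r t * n (f t)"
  let ?d = "\<lambda>t k x. if x = t then k else 0"
  obtain f where bij: "bij_betw f UNIV ?V" and add: "\<And>x y. f (x + y) = f x + f y"
    and q: "\<And>x. ?q (f x) = n x"
    using iso unfolding isometric_def linear_iso_on_def by auto
  define e where "e t k = inv_into UNIV f (?d t k)" for t k
  have fe: "f (e t k) = ?d t k" if "t \<in> T" "k \<in> K" for t k
  proof -
    have "?d t k \<in> ?V" using that subspace_0[OF K] by auto
    then have "?d t k \<in> range f" using bij by (simp add: bij_betw_def)
    then show ?thesis unfolding e_def by (rule f_inv_into_f)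
  qed
  have qd: "?q (?d t k) = r t * n k" if "t \<in> T" for t k
  proof -
    have "?q (?d t k) = (\<Sum>x\<in>T. if x = t then r t * n k else 0)" by (intro sum.cong) auto
    then show ?thesis using that T by simp
  qed
  have ne: "n (e t k) = r t * n k" if "t \<in> T" "k \<in> K" for t k
    using q[of "e t k"] fe[OF that] qd[OF that(1)] by simp
  have same: "b (e t k) (e t l) = r t * b k l" if "t \<in> T" "k \<in> K" "l \<in> K" for t k l
  proof -
    have "f (e t k + e t l) = ?d t (k + l)" unfolding add fe[OF that(1,2)] fe[OF that(1,3)] by auto
    then have "n (e t k + e t l) = r t * n (k + l)" using q[of "e t k + e t l"] qd[OF that(1)] by simp
    then show ?thesis unfolding polar_def using ne that by (simp add: algebra_simps)
  qed
  have other: "b (e s k) (e t l) = 0" if "s \<in> T" "t \<in> T" "s \<noteq> t" "k \<in> K" "l \<in> K" for s t k l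
  proof -
    have "f (e s k + e t l) = (\<lambda>x. ?d s k x + ?d t l x)"
      unfolding add fe[OF that(1,4)] fe[OF that(2,5)] by auto
    then have "n (e s k + e t l) = (\<Sum>x\<in>T. r x * n (?d s k x + ?d t l x))" using q[of "e s k + e t l"] by simp
    also have "\<dots> = (\<Sum>x\<in>T. r x * n (?d s k x) + r x * n (?d t l x))"
      using that(3) by (intro sum.cong) auto
    also have "\<dots> = r s * n k + r t * n l"
      unfolding sum.distrib using qd[OF that(1), of k] qd[OF that(2), of l] by simp
    finally show ?thesis unfolding polar_def using ne that by simp
  qed
  show ?thesis using that[of e] ne same other by blast
qed

lemma orthogonal_frame_F:
  assumes iso: "isometric scale UNIV n (\<lambda>a f t. a * f t) {f. \<forall>t. t \<notin> T \<longrightarrow> f t = 0}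
      (\<lambda>f. \<Sum>t\<in>T. r t * (f t)\<^sup>2)"
    and T: "finite T"
  obtains e where "\<And>t. t \<in> T \<Longrightarrow> n (e t) = r t"
    "\<And>s t. s \<in> T \<Longrightarrow> t \<in> T \<Longrightarrow> s \<noteq> t \<Longrightarrow> b (e s) (e t) = 0"
proof -
  let ?V = "{f :: _ \<Rightarrow> 'f. \<forall>t. t \<notin> T \<longrightarrow> f t = 0}"
  let ?q = "\<lambda>f. \<Sum>t\<in>T. r t * (f t)\<^sup>2"
  let ?d = "\<lambda>t x. if x = t then 1 else 0 :: 'f"
  obtain f where bij: "bij_betw f UNIV ?V" and add: "\<And>x y. f (x + y) = f x + f y"
    and q: "\<And>x. ?q (f x) = n x"
    using iso unfolding isometric_def linear_iso_on_def by auto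
  define e where "e t = inv_into UNIV f (?d t)" for t
  have fe: "f (e t) = ?d t" if "t \<in> T" for t
  proof -
    have "?d t \<in> ?V" using that by auto
    then have "?d t \<in> range f" using bij by (simp add: bij_betw_def)
    then show ?thesis unfolding e_def by (rule f_inv_into_f)
  qed
  have qd: "?q (?d t) = r t" if "t \<in> T" for t
  proof -
    have "?q (?d t) = (\<Sum>x\<in>T. if x = t then r t else 0)" by (intro sum.cong) auto
    then show ?thesis using that T by simp
  qed
  have ne: "n (e t) = r t" if "t \<in> T" for t
    using q[of "e t"] fe[OF that] qd[OF that(1)] by simp
  have other: "b (e s) (e t) = 0" if "s \<in> T" "t \<in> T" "s \<noteq> t" for s t
  proof -
    have "f (e s + e t) = (\<lambda>x. ?d s x + ?d t x)"
      unfolding add fe[OF that(1)] fe[OF that(2)] by auto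
    then have "n (e s + e t) = (\<Sum>x\<in>T. r x * (?d s x + ?d t x)\<^sup>2)" using q[of "e s + e t"] by simp
    also have "\<dots> = (\<Sum>x\<in>T. r x * (?d s x)\<^sup>2 + r x * (?d t x)\<^sup>2)"
      using that(3) by (intro sum.cong) auto
    also have "\<dots> = r s + r t"
      unfolding sum.distrib using qd[OF that(1)] qd[OF that(2)] by simp
    finally show ?thesis unfolding polar_def using ne that by simp
  qed
  show ?thesis using that[of e] ne other by blast
qed

end

context cayley_grading_group
begin

text \<open>The isometry provided by admissibility carries an orthogonal sum of scaled copies of \<open>K\<close> onto the
  algebra. It is corrected until the copy of degree \<open>\<one>\<close> is \<open>K\<close> itself and the copy of degree \<open>t1\<close> is
  \<open>Ku\<close>; then a vector of the copy of degree \<open>t2\<close> serves as \<open>v\<close>.\<close>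

lemma doubling_grading_K_exists:
  assumes K: "quadratic_separable_subfield scale mul one K"
    and T: "elementary_abelian_2_subgroup G 4 T" and adm: "admissible_K scale n G K T \<mu>"
  shows "\<exists>U. doubling_grading_K mul n G K T \<mu> U"
proof -
  have A: "unital_subalgebra scale mul one K" and dimK: "dim K = 2" and inv: "all_nonzero_invertible mul one K"
    using K by (auto simp: quadratic_separable_subfield_def)
  have sub: "subspace K" and oneK: "one \<in> K" using A by (auto simp: unital_subalgebra_def)
  note Tab = elementary_abelianD[OF T]
  interpret T: subgroup T G by (rule Tab(1))
  have fin: "finite T" using Tab(2) by (metis card.infinite zero_neq_numeral)
  obtain r where \<mu>: "\<mu> \<in> hom (G\<lparr>carrier := T\<rparr>) (field_units Mod norm_group n K)"
    and r1: "r \<one> = 1" and r: "\<And>t. t \<in> T \<Longrightarrow> r t \<in> \<mu> t"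
    and iso: "isometric scale UNIV n (\<lambda>a f t. scale a (f t))
      {f. (\<forall>t\<in>T. f t \<in> K) \<and> (\<forall>t. t \<notin> T \<longrightarrow> f t = 0)} (\<lambda>f. \<Sum>t\<in>T. r t * n (f t))"
    using adm unfolding admissible_K_def by auto
  note sgN = norm_group_subgroup[OF A norm_invertible[OF inv]]
  have r0: "r t \<noteq> 0" if "t \<in> T" for t
    by (rule coset_of_member(2)[OF sgN hom_coset_carrier[OF \<mu> that] r[OF that]])
  obtain e where ne: "\<And>t k. t \<in> T \<Longrightarrow> k \<in> K \<Longrightarrow> n (e t k) = r t * n k"
    and same: "\<And>t k l. t \<in> T \<Longrightarrow> k \<in> K \<Longrightarrow> l \<in> K \<Longrightarrow> b (e t k) (e t l) = r t * b k l"
    and other: "\<And>s t k l. s \<in> T \<Longrightarrow> t \<in> T \<Longrightarrow> s \<noteq> t \<Longrightarrow> k \<in> K \<Longrightarrow> l \<in> K \<Longrightarrow> b (e s k) (e t l) = 0"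
    using orthogonal_frame_K[OF iso fin sub] by blast
  obtain t1 t2 where t: "t1 \<in> T" "t2 \<in> T" and Teq: "T = {\<one>, t1, t2, t1 \<otimes> t2}"
    using G.klein_generators[OF Tab] by metis
  have "card (set [\<one>, t1, t2, t1 \<otimes> t2]) = length [\<one>, t1, t2, t1 \<otimes> t2]"
    using Tab(2) unfolding Teq by simp
  then have "distinct [\<one>, t1, t2, t1 \<otimes> t2]" by (rule card_distinct)
  then have dist: "t1 \<noteq> \<one>" "t2 \<noteq> \<one>" "t1 \<noteq> t2" by auto
  obtain a where a: "a \<in> K" "\<And>c. a \<noteq> scale c one"
    using subfield_dim2_not_scalar[OF sub oneK dimK] by blast
  note disc = quadratic_subfield_discriminant[OF K a]
  note T1 = T.one_closed
  have perpK: "w \<in> perp n K" if "b w one = 0" "b w a = 0" for w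
    unfolding perp_def
  proof (clarify)
    fix y assume "y \<in> K"
    then obtain p q where "y = scale p one + scale q a" using dim2_span[OF sub oneK dimK a] by blast
    then show "b w y = 0" using that by (simp add: b_simps)
  qed
  \<comment> \<open>first move the image of \<open>K\<close> onto \<open>K\<close>: left multiplication moves the unit vector to \<open>one\<close>\<close>
  let ?h0 = "mul (cnj (e \<one> one))"
  have n1: "n (e \<one> one) = 1" using ne[OF T1 oneK] r1 by simp
  have iso0: "isometry ?h0" by (rule isometry_mul) (simp add: n1)
  have h0: "?h0 (e \<one> one) = one" using cnj_mul[of "e \<one> one"] n1 by simp
  have "n (?h0 (e \<one> a)) = n a" using isometryD(3)[OF iso0] ne[OF T1 a(1)] r1 by simp
  moreover have "b one (?h0 (e \<one> a)) = b one a"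
    using isometryD(4)[OF iso0, of "e \<one> one" "e \<one> a"] h0 same[OF T1 oneK a(1)] r1 by simp
  ultimately obtain h1 \<sigma> where h1: "isometry h1" "\<sigma> * \<sigma> = 1" "h1 one = scale \<sigma> one"
    "h1 (?h0 (e \<one> a)) = scale \<sigma> a"
    using witt_plane[of "?h0 (e \<one> a)" a one] disc by auto
  define h2 where "h2 x = scale \<sigma> (h1 (?h0 x))" for x
  have iso2: "isometry h2"
    unfolding h2_def by (rule isometry_scale[OF isometry_comp[OF h1(1) iso0] h1(2)])
  have h2: "h2 (e \<one> one) = one" "h2 (e \<one> a) = a" using h1 h0 by (simp_all add: h2_def)
  note I2 = isometryD[OF iso2]
  define u y where "u = h2 (e t1 one)" and "y = h2 (e t1 a)"
  have nu: "n u = r t1" using ne[OF t(1) oneK] by (simp add: u_def I2)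
  have ny: "n y = r t1 * n a" using ne[OF t(1) a(1)] by (simp add: y_def I2)
  have buy: "b u y = r t1 * b one a" using same[OF t(1) oneK a(1)] by (simp add: u_def y_def I2)
  have perp1: "b (h2 (e t k)) one = 0" "b (h2 (e t k)) a = 0" if "t \<in> T" "t \<noteq> \<one>" "k \<in> K" for t k
    using I2(4)[of "e t k" "e \<one> one"] I2(4)[of "e t k" "e \<one> a"] h2
      other[OF that(1) T1 that(2,3) oneK] other[OF that(1) T1 that(2,3) a(1)] by simp_all
  have uK: "u \<in> perp n K" unfolding u_def using perp1[OF t(1) dist(1) oneK] by (rule perpK)
  have yK: "y \<in> perp n K" unfolding y_def using perp1[OF t(1) dist(1) a(1)] by (rule perpK)
  \<comment> \<open>then move the second plane onto \<open>Ku\<close>\<close>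
  have "n y = n (mul a u)" using ny nu by (simp add: norm_mult)
  moreover have "b u y = b u (mul a u)"
    using b_mul_right[of one u a] buy nu by (simp add: one_mul)
  moreover have "4 * n u * n y \<noteq> (b u y)\<^sup>2"
  proof
    assume "4 * n u * n y = (b u y)\<^sup>2"
    then have "(r t1)\<^sup>2 * (4 * n a) = (r t1)\<^sup>2 * (b one a)\<^sup>2"
      by (simp add: nu ny buy power2_eq_square algebra_simps)
    then show False using disc r0[OF t(1)] by simp
  qed
  ultimately obtain h3 \<tau> where h3: "isometry h3" "\<tau> * \<tau> = 1" "h3 u = scale \<tau> u" "h3 y = scale \<tau> (mul a u)"
    and fix3: "\<And>z. b z u = 0 \<Longrightarrow> b z y = 0 \<Longrightarrow> b z (mul a u) = 0 \<Longrightarrow> h3 z = z"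
    using witt_plane[of y "mul a u" u] nu r0[OF t(1)] by auto
  have \<tau>: "\<tau> \<noteq> 0" using h3(2) by auto
  have fixK: "h3 k = k" if k: "k \<in> K" for k
  proof (rule fix3)
    show "b k u = 0" "b k y = 0" using uK yK k by (auto simp: perp_def b_commute)
    show "b k (mul a u) = 0" by (rule perp_mul(1)[OF A uK k a(1)])
  qed
  define v where "v = h3 (h2 (e t2 one))"
  have nv: "n v = r t2" using ne[OF t(2) oneK] by (simp add: v_def I2 isometryD(3)[OF h3(1)])
  have "b v one = 0" "b v a = 0"
    using perp1[OF t(2) dist(2) oneK] isometryD(4)[OF h3(1), of "h2 (e t2 one)"] fixK[OF oneK] fixK[OF a(1)]
    unfolding v_def by metis+
  then have vK: "v \<in> perp n K" by (rule perpK)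
  have "b v (h3 u) = 0"
    unfolding v_def u_def
    using other[OF t(2,1) dist(3)[symmetric] oneK oneK] by (simp add: isometryD(4)[OF h3(1)] I2(4))
  then have vu: "b v u = 0" using \<tau> h3(3) by (simp add: b_simps)
  have "b v (h3 y) = 0"
    unfolding v_def y_def
    using other[OF t(2,1) dist(3)[symmetric] oneK a(1)] by (simp add: isometryD(4)[OF h3(1)] I2(4))
  then have vau: "b v (mul a u) = 0" using \<tau> h3(4) by (simp add: b_simps)
  have vKu: "v \<in> perp n (K \<union> (\<lambda>x. mul x u) ` K)"
    unfolding perp_def
  proof (clarify, elim UnE imageE)
    fix y assume "y \<in> K" then show "b v y = 0" using vK by (simp add: perp_def)
  next
    fix y k assume "y = mul k u" "k \<in> K"
    then obtain p q where "k = scale p one + scale q a" using dim2_span[OF sub oneK dimK a] by blast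
    then show "b v y = 0" using vu vau \<open>y = mul k u\<close> by (simp add: b_simps mul_simps)
  qed
  show ?thesis
    unfolding doubling_grading_K_def
    using Teq uK vKu nu nv r0[OF t(1)] r0[OF t(2)] r[OF t(1)] r[OF t(2)] by metis
qed

text \<open>The frame vectors of degrees \<open>\<one>\<close>, \<open>s1 s2\<close> are moved to \<open>one\<close> and to a multiple of \<open>uv\<close>, where \<open>u\<close>
  and \<open>v\<close> are the images of those of degrees \<open>s1\<close> and \<open>s2\<close>; the vector of degree \<open>s3\<close> is then
  orthogonal to the quaternion algebra of \<open>u\<close> and \<open>v\<close>.\<close>

lemma doubling_grading_F_exists:
  assumes char: "CHAR('f) \<noteq> 2"
    and T: "elementary_abelian_2_subgroup G 8 T" and adm: "admissible_F scale n G T \<mu>"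
  shows "\<exists>U. doubling_grading_F scale mul one n G T \<mu> U"
proof -
  note two = two_neq_zero[OF char]
  note Tab = elementary_abelianD[OF T]
  interpret T: subgroup T G by (rule Tab(1))
  have fin: "finite T" using Tab(2) by (metis card.infinite zero_neq_numeral)
  obtain r where \<mu>: "\<mu> \<in> hom (G\<lparr>carrier := T\<rparr>) (field_units Mod square_group)"
    and r1: "r \<one> = 1" and r: "\<And>t. t \<in> T \<Longrightarrow> r t \<in> \<mu> t"
    and iso: "isometric scale UNIV n (\<lambda>a f t. a * f t) {f. \<forall>t. t \<notin> T \<longrightarrow> f t = 0}
      (\<lambda>f. \<Sum>t\<in>T. r t * (f t)\<^sup>2)"
    using adm unfolding admissible_F_def by auto
  have sgN: "subgroup (square_group :: 'f set) field_units"
    unfolding square_group_eq using norm_group_subgroup[OF scalar_subalgebra] scalar_aniso by blast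
  have r0: "r t \<noteq> 0" if "t \<in> T" for t
    by (rule coset_of_member(2)[OF sgN hom_coset_carrier[OF \<mu> that] r[OF that]])
  obtain e where ne: "\<And>t. t \<in> T \<Longrightarrow> n (e t) = r t"
    and other: "\<And>s t. s \<in> T \<Longrightarrow> t \<in> T \<Longrightarrow> s \<noteq> t \<Longrightarrow> b (e s) (e t) = 0"
    using orthogonal_frame_F[OF iso fin] by blast
  obtain s1 s2 s3 where s: "s1 \<in> T" "s2 \<in> T" "s3 \<in> T" and gen: "generate G {s1, s2, s3} = T"
    using G.order8_generators[OF Tab] by metis
  have "distinct [\<one>, s1, s2, s1 \<otimes> s2, s3, s1 \<otimes> s3, s2 \<otimes> s3, s1 \<otimes> s2 \<otimes> s3]"
    by (rule order8_subgroup(2)[OF T s gen])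
  then have dist: "s1 \<noteq> \<one>" "s2 \<noteq> \<one>" "s3 \<noteq> \<one>" "s1 \<noteq> s2" "s1 \<noteq> s3" "s2 \<noteq> s3" "s1 \<otimes> s2 \<noteq> \<one>"
    "s1 \<otimes> s2 \<noteq> s1" "s1 \<otimes> s2 \<noteq> s2" "s1 \<otimes> s2 \<noteq> s3"
    by (simp_all only: distinct.simps list.set insert_iff empty_iff de_Morgan_disj not_False_eq_True simp_thms)
      metis+
  note T1 = T.one_closed
  have s12: "s1 \<otimes> s2 \<in> T" using s by simp
  obtain h0 where h0: "isometry h0" "h0 (e \<one>) = one"
    using witt_vector[OF two, of "e \<one>" one] ne[OF T1] r1 by auto
  note I0 = isometryD[OF h0(1)]
  define E where "E t = h0 (e t)" for t
  have nE: "n (E t) = r t" if "t \<in> T" for t using ne[OF that] by (simp add: E_def I0)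
  have bE: "b (E p) (E q) = 0" if "p \<in> T" "q \<in> T" "p \<noteq> q" for p q
    using other[OF that] by (simp add: E_def I0)
  have E1: "E \<one> = one" using h0 by (simp add: E_def)
  define u v where "u = E s1" and "v = E s2"
  have nu: "n u = r s1" and nv: "n v = r s2" using nE s by (simp_all add: u_def v_def)
  have u1: "b u one = 0" and v1: "b v one = 0" and vu: "b v u = 0"
    using bE[OF s(1) T1 dist(1)] bE[OF s(2) T1 dist(2)] bE[OF s(2,1) dist(4)[symmetric]] E1
    by (simp_all add: u_def v_def)
  have uv: "b (mul u v) one = 0" "b (mul u v) u = 0" "b (mul u v) v = 0"
  proof -
    show "b (mul u v) one = 0"
      using adjoint_left[of u v one] u1 vu by (simp add: mul_one cnj_trace_zero b_minus_right)
    show "b (mul u v) u = 0"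
      using adjoint_left[of u v u] v1 by (simp add: cnj_mul b_scale_right)
    show "b (mul u v) v = 0"
      using adjoint_right[of u v v] u1 by (simp add: mul_cnj b_scale_right)
  qed
  \<comment> \<open>as \<open>\<mu>\<close> is a homomorphism, \<open>r (s1 s2)\<close> and \<open>n (uv)\<close> differ by a square\<close>
  obtain k where k: "k \<in> square_group" "r (s1 \<otimes> s2) = k * (r s1 * r s2)"
    using coset_of_member(1)[OF sgN hom_coset_carrier[OF \<mu> s12] hom_coset_closed[OF \<mu> s(1,2) r[OF s(1)] r[OF s(2)]]]
      r[OF s12] by auto
  then obtain c where c: "c \<noteq> 0" "k = c\<^sup>2" by (auto simp: square_group_def)
  let ?y = "scale c (mul u v)"
  have "n (E (s1 \<otimes> s2)) = n ?y" using nE[OF s12] k c nu nv by (simp add: norm_scale norm_mult)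
  moreover have "n ?y \<noteq> 0" using c nu nv r0 s by (simp add: norm_scale norm_mult)
  ultimately obtain h where h: "isometry h" "h (E (s1 \<otimes> s2)) = ?y"
    and fix_h: "\<And>z. b z (E (s1 \<otimes> s2)) = 0 \<Longrightarrow> b z ?y = 0 \<Longrightarrow> h z = z"
    using witt_vector[OF two] by blast
  note I = isometryD[OF h(1)]
  have h1: "h one = one" "h u = u" "h v = v"
  proof -
    show "h one = one"
      by (rule fix_h) (use uv bE[OF T1 s12 dist(7)[symmetric]] E1 in \<open>simp_all add: b_simps b_commute[of one "mul u v"]\<close>)
    show "h u = u"
      by (rule fix_h) (use uv bE[OF s(1) s12 dist(8)[symmetric]] in \<open>simp_all add: u_def[symmetric] b_simps b_commute[of u "mul u v"]\<close>)
    show "h v = v"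
      by (rule fix_h) (use uv bE[OF s(2) s12 dist(9)[symmetric]] in \<open>simp_all add: v_def[symmetric] b_simps b_commute[of v "mul u v"]\<close>)
  qed
  define w where "w = h (E s3)"
  have nw: "n w = r s3" using nE s by (simp add: w_def I)
  have "b w one = 0" "b w u = 0" "b w v = 0"
    using I(4)[of "E s3" one] I(4)[of "E s3" u] I(4)[of "E s3" v] h1 E1
      bE[OF s(3) T1 dist(3)] bE[OF s(3,1) dist(5)[symmetric]] bE[OF s(3,2) dist(6)[symmetric]]
    by (simp_all add: w_def u_def[symmetric] v_def[symmetric])
  moreover have "b w ?y = 0"
    using I(4)[of "E s3" "E (s1 \<otimes> s2)"] h(2) bE[OF s(3) s12 dist(10)[symmetric]] by (simp add: w_def)
  then have "b w (mul u v) = 0" using c by (simp add: b_simps)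
  ultimately have w: "w \<in> perp n {one, u, v, mul u v}" by (simp add: perp_def)
  have uv_perp: "u \<in> perp n {one}" "v \<in> perp n {one, u}" using u1 v1 vu by (simp_all add: perp_def)
  have nz: "n u \<noteq> 0" "n v \<noteq> 0" "n w \<noteq> 0" using nu nv nw r0 s by simp_all
  have m: "n u \<in> \<mu> s1" "n v \<in> \<mu> s2" "n w \<in> \<mu> s3" using nu nv nw r s by simp_all
  show ?thesis
    unfolding doubling_grading_F_def
    by (intro exI conjI) (rule s gen uv_perp w nz m refl)+
qed

end

section \<open>Good bases\<close>

lemma three_arith [simp]: "(3::3) = 0" "(1::3) + 1 = 2" "(1::3) + 2 = 0" "(2::3) + 1 = 0" "(2::3) + 2 = 1"
  "(0::3) \<noteq> 1" "(0::3) \<noteq> 2" "(1::3) \<noteq> 2" "(1::3) \<noteq> 0" "(2::3) \<noteq> 0" "(2::3) \<noteq> 1"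
  by simp_all

lemma exhaust3: "(i::3) = 1 \<or> i = 2 \<or> i = 0"
  using exhaust_3[of i] by simp

lemma sum3: "(\<Sum>i\<in>UNIV. f (i::3)) = f 1 + f 2 + (f 0 :: 'a::comm_monoid_add)"
  using sum_3[of f] by simp

lemma UNIV_good_index: "(UNIV :: good_index set) = {Ix_e1, Ix_e2} \<union> range Ix_u \<union> range Ix_v"
  by (auto intro: good_index.exhaust)

lemma sum_good_index:
  "(\<Sum>i\<in>UNIV. f i) = f Ix_e1 + f Ix_e2 + (\<Sum>j\<in>UNIV. f (Ix_u j)) + (\<Sum>j\<in>UNIV. f (Ix_v j))"
  for f :: "good_index \<Rightarrow> 'a::comm_monoid_add"
proof -
  have inj: "inj Ix_u" "inj Ix_v" by (auto intro: injI)
  have "(\<Sum>i\<in>UNIV. f i) = (\<Sum>i\<in>{Ix_e1, Ix_e2} \<union> range Ix_u. f i) + (\<Sum>i\<in>range Ix_v. f i)"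
    unfolding UNIV_good_index by (rule sum.union_disjoint) auto
  also have "(\<Sum>i\<in>{Ix_e1, Ix_e2} \<union> range Ix_u. f i) = (\<Sum>i\<in>{Ix_e1, Ix_e2}. f i) + (\<Sum>i\<in>range Ix_u. f i)"
    by (rule sum.union_disjoint) auto
  finally show ?thesis by (simp add: sum.reindex[OF inj(1)] sum.reindex[OF inj(2)])
qed

lemma card_good_index: "CARD(good_index) = 8"
proof -
  have "CARD(good_index) = (\<Sum>i\<in>(UNIV::good_index set). 1)" by simp
  also have "\<dots> = 8" unfolding sum_good_index by simp
  finally show ?thesis .
qed

fun good_vector :: "'d \<Rightarrow> 'd \<Rightarrow> (3 \<Rightarrow> 'd) \<Rightarrow> (3 \<Rightarrow> 'd) \<Rightarrow> good_index \<Rightarrow> 'd" where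
  "good_vector e1 e2 u v Ix_e1 = e1"
| "good_vector e1 e2 u v Ix_e2 = e2"
| "good_vector e1 e2 u v (Ix_u j) = u j"
| "good_vector e1 e2 u v (Ix_v j) = v j"

definition good_combination ::
  "('f::field \<Rightarrow> 'd::ab_group_add \<Rightarrow> 'd) \<Rightarrow> (good_index \<Rightarrow> 'd) \<Rightarrow> 'f ^ good_index \<Rightarrow> 'd" where
  "good_combination s bs x = (\<Sum>i\<in>UNIV. s (x $ i) (bs i))"

text \<open>A system of vectors with the multiplication table of a good basis; its linear independence is
  stated as injectivity of \<open>good_combination\<close>.\<close>

locale good_system = vector_space s
  for s :: "'f::field \<Rightarrow> 'd::ab_group_add \<Rightarrow> 'd" +
  fixes m :: "'d \<Rightarrow> 'd \<Rightarrow> 'd" and e1 e2 :: 'd and u v :: "3 \<Rightarrow> 'd"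
  assumes m_right: "\<And>x. Vector_Spaces.linear s s (\<lambda>y. m x y)"
    and m_left: "\<And>y. Vector_Spaces.linear s s (\<lambda>x. m x y)"
    and ee: "m e1 e1 = e1" "m e2 e2 = e2" "m e1 e2 = 0" "m e2 e1 = 0"
    and eu: "\<And>j. m e1 (u j) = u j" "\<And>j. m e2 (u j) = 0" "\<And>j. m (u j) e1 = 0" "\<And>j. m (u j) e2 = u j"
    and ev: "\<And>j. m e1 (v j) = 0" "\<And>j. m e2 (v j) = v j" "\<And>j. m (v j) e1 = v j" "\<And>j. m (v j) e2 = 0"
    and uu: "\<And>j k. m (u j) (u k) = (\<Sum>l\<in>UNIV. s (levi_civita j k l) (v l))"
    and vv: "\<And>j k. m (v j) (v k) = (\<Sum>l\<in>UNIV. s (levi_civita j k l) (u l))"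
    and uv: "\<And>j k. m (u j) (v k) = (if j = k then - e1 else 0)"
    and vu: "\<And>j k. m (v j) (u k) = (if j = k then - e2 else 0)"
    and dim_8: "dim UNIV = 8"
    and ker: "\<And>x :: 'f ^ good_index. good_combination s (good_vector e1 e2 u v) x = 0 \<Longrightarrow> x = 0"
begin

abbreviation "bs \<equiv> good_vector e1 e2 u v"
abbreviation "F \<equiv> good_combination s bs"

lemma linear_F: "Vector_Spaces.linear (*s) s F"
proof -
  interpret vec: vector_space "(*s) :: 'f \<Rightarrow> 'f ^ good_index \<Rightarrow> _" by (rule vec.vector_space_axioms)
  show ?thesis
    unfolding Vector_Spaces.linear_iff
    by (simp add: vec.vector_space_axioms vector_space_axioms good_combination_def scale_left_distrib
        sum.distrib scale_sum_right)
qed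

lemma F_axis: "F (axis i 1) = bs i"
proof -
  have "F (axis i 1) = (\<Sum>j\<in>UNIV. if j = i then bs i else 0)"
    unfolding good_combination_def by (intro sum.cong) (auto simp: axis_def)
  then show ?thesis by simp
qed

lemma F_table: "F (good_table i j) = m (bs i) (bs j)"
proof -
  interpret F: Vector_Spaces.linear "(*s)" s F by (rule linear_F)
  note F.add [simp] F.neg [simp] F.zero [simp]
  show ?thesis
    by (cases "(i, j)" rule: good_table.cases)
      (simp_all add: F_axis ee eu ev uv vu uu vv F.sum F.scale)
qed

lemma F_mul: "F (split_mul x y) = m (F x) (F y)"
proof -
  interpret F: Vector_Spaces.linear "(*s)" s F by (rule linear_F)
  have "F (split_mul x y) = (\<Sum>i\<in>UNIV. \<Sum>j\<in>UNIV. s (x $ i * y $ j) (m (bs i) (bs j)))"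
    by (simp add: split_mul_def F.sum F.scale F_table)
  also have "\<dots> = (\<Sum>i\<in>UNIV. s (x $ i) (m (bs i) (F y)))"
  proof (rule sum.cong[OF refl])
    fix i
    interpret R: Vector_Spaces.linear s s "\<lambda>y. m (bs i) y" by (rule m_right)
    show "(\<Sum>j\<in>UNIV. s (x $ i * y $ j) (m (bs i) (bs j))) = s (x $ i) (m (bs i) (F y))"
      by (simp add: good_combination_def R.sum R.scale scale_sum_right)
  qed
  also have "\<dots> = m (F x) (F y)"
  proof -
    interpret L: Vector_Spaces.linear s s "\<lambda>x. m x (F y)" by (rule m_left)
    show ?thesis by (simp add: good_combination_def[of _ _ x] L.sum L.scale)
  qed
  finally show ?thesis .
qed

lemma bij_F: "bij F"
proof -
  interpret F: Vector_Spaces.linear "(*s)" s F by (rule linear_F)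
  obtain B where B: "independent B" "UNIV \<subseteq> span B" "card B = dim (UNIV :: 'd set)"
    using basis_exists[of UNIV] by metis
  then have "finite B" using dim_8 by (metis card.infinite zero_neq_numeral)
  then interpret fd: finite_dimensional_vector_space s B
    by unfold_locales (use B in auto)
  interpret P: finite_dimensional_vector_space_pair "(*s) :: 'f \<Rightarrow> 'f ^ good_index \<Rightarrow> _" cart_basis s B
    by unfold_locales
  have inj: "inj F" using ker by (simp add: F.inj_iff_eq_0)
  moreover have "card (cart_basis :: ('f ^ good_index) set) = 8" "card B = 8"
    using B(3) dim_8 by (simp_all add: card_cart_basis card_good_index)
  then have "surj F"
    using P.linear_injective_imp_surjective[OF linear_F inj]
    by (simp add: fd.dimension_def vec.dimension_def)
  ultimately show ?thesis by (simp add: bij_def)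
qed

lemma iso_F: "algebra_iso_on (*s) split_mul UNIV s m UNIV F"
proof -
  interpret F: Vector_Spaces.linear "(*s)" s F by (rule linear_F)
  show ?thesis
    unfolding algebra_iso_on_def linear_iso_on_def using bij_F F.add F.scale F_mul by blast
qed

text \<open>For any assignment of degrees to the good basis, the isomorphism carries the corresponding grading
  of the split Cayley algebra to the one that gives the vectors of the system these degrees.\<close>

lemma image_Gamma_split: "F ` Gamma_split G \<gamma> g = span {bs i | i. good_degree G \<gamma> i = g}"
proof -
  interpret F: Vector_Spaces.linear "(*s)" s F by (rule linear_F)
  have "F ` {axis i 1 |i. good_degree G \<gamma> i = g} = {bs i | i. good_degree G \<gamma> i = g}"
    by (auto simp: F_axis image_iff) (metis F_axis)
  then show ?thesis by (simp add: Gamma_split_def flip: F.span_image)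
qed

end

lemma algebra_iso_inv:
  assumes "algebra_iso_on s1 m1 UNIV s2 m2 UNIV f"
  shows "algebra_iso_on s2 m2 UNIV s1 m1 UNIV (inv_into UNIV f)"
proof -
  have bij: "bij f" and add: "\<And>x y. f (x + y) = f x + f y" and sc: "\<And>a x. f (s1 a x) = s2 a (f x)"
    and mul: "\<And>x y. f (m1 x y) = m2 (f x) (f y)"
    using assms by (auto simp: algebra_iso_on_def linear_iso_on_def)
  let ?g = "inv_into UNIV f"
  have inj: "inj f" and fg: "\<And>y. f (?g y) = y"
    using bij by (auto simp: bij_def surj_f_inv_f)
  have eq: "?g y = x" if "y = f x" for x y using that inj by simp
  show ?thesis
    unfolding algebra_iso_on_def linear_iso_on_def
  proof (intro conjI ballI allI)
    show "bij_betw ?g UNIV UNIV" using bij by (rule bij_imp_bij_inv)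
  qed (rule eq, simp add: add sc mul fg)+
qed

lemma isomorphic_gradings_sym:
  assumes "isomorphic_gradings G s1 m1 U s2 m2 V"
  shows "isomorphic_gradings G s2 m2 V s1 m1 U"
proof -
  obtain f where f: "algebra_iso_on s1 m1 UNIV s2 m2 UNIV f" "\<And>g. g \<in> carrier G \<Longrightarrow> f ` U g = V g"
    using assms by (auto simp: isomorphic_gradings_def)
  have inj: "inj f" using f(1) by (auto simp: algebra_iso_on_def linear_iso_on_def bij_def)
  have "inv_into UNIV f ` V g = U g" if "g \<in> carrier G" for g
    using f(2)[OF that] inj by (metis image_inv_f_f)
  then show ?thesis using algebra_iso_inv[OF f(1)] unfolding isomorphic_gradings_def by blast
qed

lemma split_mul_axis: "split_mul (axis i 1) (axis j 1) = (good_table i j :: 'f::field ^ good_index)"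
proof -
  have "split_mul (axis i 1) (axis j 1)
      = (\<Sum>k\<in>UNIV. \<Sum>l\<in>UNIV. if l = j then (if k = i then good_table k l else 0) else 0 :: 'f ^ good_index)"
    unfolding split_mul_def by (intro sum.cong) (auto simp: axis_def)
  then show ?thesis by simp
qed

lemma split_mul_linear:
  "Vector_Spaces.linear (*s) (*s) (\<lambda>y :: 'f::field ^ good_index. split_mul x y)"
  "Vector_Spaces.linear (*s) (*s) (\<lambda>x :: 'f::field ^ good_index. split_mul x y)"
  unfolding Vector_Spaces.linear_iff
  by (simp_all add: vec.vector_space_axioms split_mul_def vec.scale_left_distrib vec.scale_right_distrib
      sum.distrib vec.scale_sum_right algebra_simps)

lemma permutation3_cases:
  assumes "bij (\<pi> :: 3 \<Rightarrow> 3)"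
  shows "\<pi> 1 = 1 \<and> \<pi> 2 = 2 \<and> \<pi> 0 = 0 \<or> \<pi> 1 = 1 \<and> \<pi> 2 = 0 \<and> \<pi> 0 = 2 \<or>
    \<pi> 1 = 2 \<and> \<pi> 2 = 1 \<and> \<pi> 0 = 0 \<or> \<pi> 1 = 2 \<and> \<pi> 2 = 0 \<and> \<pi> 0 = 1 \<or>
    \<pi> 1 = 0 \<and> \<pi> 2 = 1 \<and> \<pi> 0 = 2 \<or> \<pi> 1 = 0 \<and> \<pi> 2 = 2 \<and> \<pi> 0 = 1"
proof -
  have "\<pi> 1 \<noteq> \<pi> 2" "\<pi> 1 \<noteq> \<pi> 0" "\<pi> 2 \<noteq> \<pi> 0"
    using assms by (auto simp: bij_def inj_eq)
  then show ?thesis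
    using exhaust3[of "\<pi> 1"] exhaust3[of "\<pi> 2"] exhaust3[of "\<pi> 0"] by metis
qed

text \<open>The scalar \<open>\<epsilon>\<close> is the sign of the permutation.\<close>

lemma levi_civita_permute:
  assumes "bij (\<pi> :: 3 \<Rightarrow> 3)"
  obtains \<epsilon> where "\<epsilon> * \<epsilon> = (1::'f::field)"
    "\<And>j k l. levi_civita (\<pi> j) (\<pi> k) (\<pi> l) = \<epsilon> * (levi_civita j k l :: 'f)"
proof -
  let ?\<epsilon> = "levi_civita (\<pi> 1) (\<pi> 2) (\<pi> 0) :: 'f"
  note cases = permutation3_cases[OF assms]
  have "?\<epsilon> * ?\<epsilon> = 1" using cases by (elim disjE) (simp_all add: levi_civita_def)
  moreover have "levi_civita (\<pi> j) (\<pi> k) (\<pi> l) = ?\<epsilon> * (levi_civita j k l :: 'f)" for j k l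
    using cases exhaust3[of j] exhaust3[of k] exhaust3[of l]
    by (elim disjE) (simp_all add: levi_civita_def)
  ultimately show ?thesis using that by blast
qed

lemma good_combination_axes:
  fixes x :: "'f::field ^ good_index"
  assumes \<sigma>: "inj \<sigma>" and \<epsilon>: "\<And>i. \<epsilon> i \<noteq> 0"
    and zero: "good_combination (*s) (\<lambda>i. \<epsilon> i *s axis (\<sigma> i) 1) x = 0"
  shows "x = 0"
proof -
  have "x $ i = 0" for i
  proof -
    have "0 = good_combination (*s) (\<lambda>i. \<epsilon> i *s axis (\<sigma> i) 1) x $ \<sigma> i" using zero by simp
    also have "\<dots> = (\<Sum>j\<in>UNIV. if j = i then x $ i * \<epsilon> i else 0)"
      unfolding good_combination_def sum_component
      by (intro sum.cong) (auto simp: axis_def inj_eq[OF \<sigma>])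
    finally show ?thesis using \<epsilon>[of i] by simp
  qed
  then show ?thesis by (simp add: vec_eq_iff)
qed

lemma split_dim_8: "vec.dim (UNIV :: ('f::field ^ good_index) set) = 8"
  by (simp add: card_cart_basis card_good_index)

fun permute_index :: "(3 \<Rightarrow> 3) \<Rightarrow> good_index \<Rightarrow> good_index" where
  "permute_index \<pi> (Ix_u j) = Ix_u (\<pi> j)"
| "permute_index \<pi> (Ix_v j) = Ix_v (\<pi> j)"
| "permute_index \<pi> i = i"

fun swap_index :: "good_index \<Rightarrow> good_index" where
  "swap_index Ix_e1 = Ix_e2" | "swap_index Ix_e2 = Ix_e1"
| "swap_index (Ix_u j) = Ix_v j" | "swap_index (Ix_v j) = Ix_u j"

fun index_sign :: "'f::field \<Rightarrow> good_index \<Rightarrow> 'f" where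
  "index_sign \<epsilon> (Ix_u j) = \<epsilon>" | "index_sign \<epsilon> (Ix_v j) = \<epsilon>" | "index_sign \<epsilon> i = 1"

text \<open>Permuting the indices of a good basis multiplies its structure constants \<open>levi_civita\<close> by \<open>\<epsilon>\<close>, which
  is undone by multiplying all \<open>u\<^sub>j\<close> and \<open>v\<^sub>j\<close> by \<open>\<epsilon>\<close>. The table is also invariant under exchanging
  \<open>e\<^sub>1, u\<^sub>j\<close> with \<open>e\<^sub>2, v\<^sub>j\<close>.\<close>

lemma permuted_good_system:
  fixes \<epsilon> :: "'f::field"
  assumes \<pi>: "bij \<pi>" and \<epsilon>: "\<epsilon> * \<epsilon> = 1"
    and levi: "\<And>j k l. levi_civita (\<pi> j) (\<pi> k) (\<pi> l) = \<epsilon> * (levi_civita j k l :: 'f)"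
  shows "good_system ((*s) :: 'f \<Rightarrow> _) split_mul (axis Ix_e1 1) (axis Ix_e2 1)
      (\<lambda>j. \<epsilon> *s axis (Ix_u (\<pi> j)) 1) (\<lambda>j. \<epsilon> *s axis (Ix_v (\<pi> j)) 1)" (is ?direct)
    and "good_system ((*s) :: 'f \<Rightarrow> _) split_mul (axis Ix_e2 1) (axis Ix_e1 1)
      (\<lambda>j. \<epsilon> *s axis (Ix_v (\<pi> j)) 1) (\<lambda>j. \<epsilon> *s axis (Ix_u (\<pi> j)) 1)" (is ?swapped)
proof -
  have inj: "inj \<pi>" using \<pi> by (simp add: bij_def)
  have \<epsilon>0: "\<epsilon> \<noteq> 0" using \<epsilon> by auto
  have sc: "split_mul (a *s x) y = a *s split_mul x y" "split_mul x (a *s y) = a *s split_mul x y"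
    for a and x y :: "'f ^ good_index"
    using split_mul_linear[of x] split_mul_linear(2)[of y] unfolding Vector_Spaces.linear_iff by blast+
  have reindex: "(\<Sum>l\<in>UNIV. levi_civita (\<pi> j) (\<pi> k) l *s axis (I l) 1)
      = (\<Sum>l\<in>UNIV. (levi_civita j k l * \<epsilon>) *s axis (I (\<pi> l)) (1::'f))" for j k and I :: "3 \<Rightarrow> good_index"
  proof -
    have "(\<Sum>l\<in>UNIV. levi_civita (\<pi> j) (\<pi> k) l *s axis (I l) (1::'f))
        = (\<Sum>l\<in>UNIV. levi_civita (\<pi> j) (\<pi> k) (\<pi> l) *s axis (I (\<pi> l)) 1)"
      using sum.reindex_bij_betw[OF \<pi>, of "\<lambda>l. levi_civita (\<pi> j) (\<pi> k) l *s axis (I l) (1::'f)"] by simp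
    then show ?thesis
      by (simp add: levi mult.commute)
  qed
  have inj_p: "inj (permute_index \<pi>)"
  proof (rule injI)
    fix i j show "permute_index \<pi> i = permute_index \<pi> j \<Longrightarrow> i = j"
      by (cases i; cases j) (auto simp: inj_eq[OF inj])
  qed
  have inj_s: "inj (\<lambda>i. swap_index (permute_index \<pi> i))"
  proof (rule injI)
    fix i j show "swap_index (permute_index \<pi> i) = swap_index (permute_index \<pi> j) \<Longrightarrow> i = j"
      by (cases i; cases j) (auto simp: inj_eq[OF inj])
  qed
  have sgn: "index_sign \<epsilon> i \<noteq> 0" for i by (cases i) (auto simp: \<epsilon>0)
  note simps = sc split_mul_axis
  show ?direct
  proof (intro good_system.intro good_system_axioms.intro vec.vector_space_axioms split_mul_linear split_dim_8)
    have eq: "good_vector (axis Ix_e1 1) (axis Ix_e2 1) (\<lambda>j. \<epsilon> *s axis (Ix_u (\<pi> j)) 1)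
        (\<lambda>j. \<epsilon> *s axis (Ix_v (\<pi> j)) 1) = (\<lambda>i. index_sign \<epsilon> i *s axis (permute_index \<pi> i) 1)"
      (is "?b = _")
    proof
      fix i show "?b i = index_sign \<epsilon> i *s axis (permute_index \<pi> i) 1" by (cases i) auto
    qed
    show "x = 0" if "good_combination (*s) ?b x = 0" for x
      using good_combination_axes[OF inj_p, of "index_sign \<epsilon>" x, OF sgn] that unfolding eq by blast
  qed (simp_all add: simps reindex \<epsilon> inj_eq[OF inj])
  show ?swapped
  proof (intro good_system.intro good_system_axioms.intro vec.vector_space_axioms split_mul_linear split_dim_8)
    have eq: "good_vector (axis Ix_e2 1) (axis Ix_e1 1) (\<lambda>j. \<epsilon> *s axis (Ix_v (\<pi> j)) 1)
        (\<lambda>j. \<epsilon> *s axis (Ix_u (\<pi> j)) 1) = (\<lambda>i. index_sign \<epsilon> i *s axis (swap_index (permute_index \<pi> i)) 1)"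
      (is "?b = _")
    proof
      fix i show "?b i = index_sign \<epsilon> i *s axis (swap_index (permute_index \<pi> i)) 1" by (cases i) auto
    qed
    show "x = 0" if "good_combination (*s) ?b x = 0" for x
      using good_combination_axes[OF inj_s, of "index_sign \<epsilon>" x, OF sgn] that unfolding eq by blast
  qed (simp_all add: simps reindex \<epsilon> inj_eq[OF inj])
qed

lemma span_scaled_axes:
  fixes bs :: "good_index \<Rightarrow> 'f::field ^ good_index"
  assumes bs: "\<And>i. \<exists>a. a \<noteq> 0 \<and> bs i = a *s axis (\<sigma> i) 1" and \<sigma>: "surj \<sigma>"
    and deg: "\<And>i. d' i = d (\<sigma> i)"
  shows "vec.span {bs i | i. d' i = g} = vec.span {axis k 1 | k. d k = (g::'g)}"
proof (rule vec.span_eq[THEN iffD2], intro conjI subsetI)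
  fix x assume "x \<in> {bs i | i. d' i = g}"
  then obtain i where i: "x = bs i" "d (\<sigma> i) = g" using deg by auto
  obtain a where "bs i = a *s axis (\<sigma> i) 1" using bs by blast
  moreover have "axis (\<sigma> i) 1 \<in> vec.span {axis k (1::'f) | k. d k = g}" using i by (auto intro: vec.span_base)
  ultimately show "x \<in> vec.span {axis k 1 | k. d k = g}" using i by (simp add: vec.span_scale)
next
  fix x assume "x \<in> {axis k (1::'f) | k. d k = g}"
  then obtain k where k: "x = axis k 1" "d k = g" by auto
  obtain i where i: "k = \<sigma> i" using \<sigma> by (metis surjD)
  obtain a where a: "a \<noteq> 0" "bs i = a *s axis (\<sigma> i) 1" using bs by blast
  have "bs i \<in> vec.span {bs i | i. d' i = g}" using i k deg by (auto intro: vec.span_base)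
  then have "inverse a *s bs i \<in> vec.span {bs i | i. d' i = g}" by (rule vec.span_scale)
  moreover have "inverse a *s bs i = x" using a k i by simp
  ultimately show "x \<in> vec.span {bs i | i. d' i = g}" by simp
qed

lemma Gamma_split_equiv_isomorphic:
  assumes G: "group G" and \<gamma>: "\<And>i. \<gamma> i \<in> carrier G" and equiv: "triple_equiv G \<gamma> \<gamma>'"
  shows "isomorphic_gradings G ((*s) :: 'f::field \<Rightarrow> _) split_mul (Gamma_split G \<gamma>) (*s) split_mul (Gamma_split G \<gamma>')"
proof -
  interpret G: group G by fact
  obtain \<pi> where \<pi>: "bij \<pi>"
    and cases: "(\<forall>i. \<gamma>' i = \<gamma> (\<pi> i)) \<or> (\<forall>i. \<gamma>' i = inv\<^bsub>G\<^esub> (\<gamma> (\<pi> i)))"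
    using equiv unfolding triple_equiv_def by blast
  obtain \<epsilon> :: 'f where \<epsilon>: "\<epsilon> * \<epsilon> = 1" and
    levi: "\<And>j k l. levi_civita (\<pi> j) (\<pi> k) (\<pi> l) = \<epsilon> * (levi_civita j k l :: 'f)"
    using levi_civita_permute[OF \<pi>] by blast
  have \<epsilon>0: "\<epsilon> \<noteq> 0" using \<epsilon> by auto
  have surj_p: "surj (permute_index \<pi>)"
  proof -
    have "\<exists>i. k = permute_index \<pi> i" for k
    proof (cases k)
      case (Ix_u j)
      then show ?thesis using \<pi> by (metis bij_pointE permute_index.simps(1))
    next
      case (Ix_v j)
      then show ?thesis using \<pi> by (metis bij_pointE permute_index.simps(2))
    qed (metis permute_index.simps)+
    then show ?thesis by (simp add: surj_def)
  qed
  have swap: "swap_index (swap_index i) = i" for i by (cases i) auto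
  have surj_s: "surj (\<lambda>i. swap_index (permute_index \<pi> i))"
    using surj_p swap unfolding surj_def by metis
  from cases have "isomorphic_gradings G ((*s) :: 'f \<Rightarrow> _) split_mul (Gamma_split G \<gamma>') (*s) split_mul (Gamma_split G \<gamma>)"
  proof
    assume eq: "\<forall>i. \<gamma>' i = \<gamma> (\<pi> i)"
    interpret good_system "(*s) :: 'f \<Rightarrow> _" split_mul "axis Ix_e1 1" "axis Ix_e2 1"
      "\<lambda>j. \<epsilon> *s axis (Ix_u (\<pi> j)) 1" "\<lambda>j. \<epsilon> *s axis (Ix_v (\<pi> j)) 1"
      by (rule permuted_good_system(1)[OF \<pi> \<epsilon> levi])
    have "F ` Gamma_split G \<gamma>' g = Gamma_split G \<gamma> g" for g
      unfolding image_Gamma_split unfolding Gamma_split_def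
    proof (rule span_scaled_axes[OF _ surj_p])
      show "\<exists>a. a \<noteq> 0 \<and> bs i = a *s axis (permute_index \<pi> i) 1" for i
        by (cases i) (auto intro: exI[of _ 1] exI[of _ \<epsilon>] simp: \<epsilon>0)
      show "good_degree G \<gamma>' i = good_degree G \<gamma> (permute_index \<pi> i)" for i
        by (cases i) (auto simp: eq)
    qed
    then show ?thesis unfolding isomorphic_gradings_def using iso_F by blast
  next
    assume eq: "\<forall>i. \<gamma>' i = inv\<^bsub>G\<^esub> (\<gamma> (\<pi> i))"
    interpret good_system "(*s) :: 'f \<Rightarrow> _" split_mul "axis Ix_e2 1" "axis Ix_e1 1"
      "\<lambda>j. \<epsilon> *s axis (Ix_v (\<pi> j)) 1" "\<lambda>j. \<epsilon> *s axis (Ix_u (\<pi> j)) 1"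
      by (rule permuted_good_system(2)[OF \<pi> \<epsilon> levi])
    have "F ` Gamma_split G \<gamma>' g = Gamma_split G \<gamma> g" for g
      unfolding image_Gamma_split unfolding Gamma_split_def
    proof (rule span_scaled_axes[OF _ surj_s])
      show "\<exists>a. a \<noteq> 0 \<and> bs i = a *s axis (swap_index (permute_index \<pi> i)) 1" for i
        by (cases i) (auto intro: exI[of _ 1] exI[of _ \<epsilon>] simp: \<epsilon>0)
      show "good_degree G \<gamma>' i = good_degree G \<gamma> (swap_index (permute_index \<pi> i))" for i
        by (cases i) (auto simp: eq \<gamma>)
    qed
    then show ?thesis unfolding isomorphic_gradings_def using iso_F by blast
  qed
  then show ?thesis by (rule isomorphic_gradings_sym)
qed

section \<open>Recovering the triple of degrees\<close>

lemma dim_Gamma_split: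
  "vec.dim (Gamma_split G \<gamma> g :: ('f::field ^ good_index) set) = card {i. good_degree G \<gamma> i = g}"
proof -
  let ?A = "{axis i (1::'f) | i. good_degree G \<gamma> i = g}"
  have "?A \<subseteq> cart_basis" by (auto simp: cart_basis_def)
  then have "vec.independent ?A" using vec.independent_Basis vec.independent_mono by blast
  then have "vec.dim (vec.span ?A) = card ?A" by (rule vec.dim_span_eq_card_independent)
  moreover have "?A = (\<lambda>i. axis i 1) ` {i. good_degree G \<gamma> i = g}" by auto
  moreover have "card ((\<lambda>i. axis i (1::'f)) ` {i. good_degree G \<gamma> i = g}) = card {i. good_degree G \<gamma> i = g}"
    by (rule card_image, rule inj_onI) (simp add: axis_eq_axis)
  ultimately show ?thesis unfolding Gamma_split_def by (simp only:)
qed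

text \<open>An element of one multiset occurs in a pair of the other one; an involution makes the two pairs
  containing it equal, so both can be removed.\<close>

lemma match_involution_pairs:
  assumes "finite S'" "finite S"
    and inv: "\<And>x. x \<in> \<gamma> ` S \<union> \<gamma>' ` S' \<Longrightarrow> f (f x) = x"
    and eq: "(\<Sum>i\<in>S. {#\<gamma> i, f (\<gamma> i)#}) = (\<Sum>j\<in>S'. {#\<gamma>' j, f (\<gamma>' j)#})"
  shows "\<exists>\<pi>. bij_betw \<pi> S' S \<and> (\<forall>j\<in>S'. \<gamma>' j = \<gamma> (\<pi> j) \<or> \<gamma>' j = f (\<gamma> (\<pi> j)))"
  using assms
proof (induction S' arbitrary: S rule: finite_induct)
  case empty
  then have "S = {}" using sum_eq_empty_iff[of S "\<lambda>i. {#\<gamma> i, f (\<gamma> i)#}"] by auto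
  then show ?case by (auto simp: bij_betw_def)
next
  case (insert j S')
  have "\<gamma>' j \<in># (\<Sum>i\<in>S. {#\<gamma> i, f (\<gamma> i)#})"
    using insert.prems insert.hyps by simp
  then obtain i where i: "i \<in> S" "\<gamma>' j = \<gamma> i \<or> \<gamma>' j = f (\<gamma> i)"
    using insert.prems(1) by (auto simp: set_mset_sum)
  then have pair: "{#\<gamma>' j, f (\<gamma>' j)#} = {#\<gamma> i, f (\<gamma> i)#}"
    using insert.prems(2)[of "\<gamma> i"] by auto
  have "(\<Sum>i\<in>S. {#\<gamma> i, f (\<gamma> i)#}) = {#\<gamma> i, f (\<gamma> i)#} + (\<Sum>i\<in>S - {i}. {#\<gamma> i, f (\<gamma> i)#})"
    using i insert.prems(1) by (simp add: sum.remove)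
  moreover have "(\<Sum>j\<in>insert j S'. {#\<gamma>' j, f (\<gamma>' j)#}) = {#\<gamma>' j, f (\<gamma>' j)#} + (\<Sum>j\<in>S'. {#\<gamma>' j, f (\<gamma>' j)#})"
    using insert.hyps by (rule sum.insert)
  ultimately have "{#\<gamma> i, f (\<gamma> i)#} + (\<Sum>i\<in>S - {i}. {#\<gamma> i, f (\<gamma> i)#})
      = {#\<gamma> i, f (\<gamma> i)#} + (\<Sum>j\<in>S'. {#\<gamma>' j, f (\<gamma>' j)#})"
    using insert.prems(3) pair by (simp only:)
  then have "(\<Sum>i\<in>S - {i}. {#\<gamma> i, f (\<gamma> i)#}) = (\<Sum>j\<in>S'. {#\<gamma>' j, f (\<gamma>' j)#})"
    by (simp only: add_left_cancel)
  then obtain \<pi> where \<pi>: "bij_betw \<pi> S' (S - {i})" "\<forall>j\<in>S'. \<gamma>' j = \<gamma> (\<pi> j) \<or> \<gamma>' j = f (\<gamma> (\<pi> j))"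
    using insert.IH[of "S - {i}"] insert.prems by auto
  let ?\<pi> = "\<pi>(j := i)"
  have "bij_betw ?\<pi> S' (S - {i})"
    using \<pi>(1) insert.hyps(2) by (subst bij_betw_cong[of S' _ \<pi>]) auto
  then have "bij_betw ?\<pi> (S' \<union> {j}) ((S - {i}) \<union> {i})"
    by (intro bij_betw_combine) (auto simp: bij_betw_def)
  moreover have "(S - {i}) \<union> {i} = S" "S' \<union> {j} = insert j S'" using i by auto
  ultimately have "bij_betw ?\<pi> (insert j S') S" by metis
  moreover have "\<forall>k\<in>insert j S'. \<gamma>' k = \<gamma> (?\<pi> k) \<or> \<gamma>' k = f (\<gamma> (?\<pi> k))"
    using \<pi>(2) i insert.hyps(2) by auto
  ultimately show ?case by blast
qed

text \<open>If exactly one entry \<open>x\<close> is inverted, or exactly one is not, the two product relations give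
  \<open>x = inv x\<close>, so the exception disappears.\<close>

lemma (in comm_group) sign_pattern:
  assumes car: "a \<in> carrier G" "d \<in> carrier G" "c \<in> carrier G" and prod: "a \<otimes> d \<otimes> c = \<one>"
    and a': "a' = a \<or> a' = inv a" and d': "d' = d \<or> d' = inv d" and c': "c' = c \<or> c' = inv c"
    and prod': "a' \<otimes> d' \<otimes> c' = \<one>"
  shows "(a' = a \<and> d' = d \<and> c' = c) \<or> (a' = inv a \<and> d' = inv d \<and> c' = inv c)"
proof -
  have involution: "x = inv x" if "p \<otimes> x = \<one>" "p \<otimes> inv x = \<one>" "p \<in> carrier G" "x \<in> carrier G" for p x
  proof -
    have "inv x = p" by (rule inv_equality[OF that(1,4,3)])
    moreover have "inv (inv x) = p" by (rule inv_equality[OF that(2) inv_closed[OF that(4)] that(3)])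
    ultimately show ?thesis using inv_inv[OF that(4)] by simp
  qed
  have iprod: "inv a \<otimes> inv d \<otimes> inv c = \<one>"
    using arg_cong[OF prod, of "m_inv G"] car by (simp add: inv_mult)
  note ic = inv_closed[OF car(1)] inv_closed[OF car(2)] inv_closed[OF car(3)]
  from a' d' c' consider "a' = a" "d' = d" "c' = c" | "a' = inv a" "d' = inv d" "c' = inv c"
    | "a' = inv a" "d' = d" "c' = c" | "a' = a" "d' = inv d" "c' = c" | "a' = a" "d' = d" "c' = inv c"
    | "a' = a" "d' = inv d" "c' = inv c" | "a' = inv a" "d' = d" "c' = inv c" | "a' = inv a" "d' = inv d" "c' = c"
    by blast
  then show ?thesis
  proof cases
    case 3
    have "a = inv a"
      by (rule involution[of "d \<otimes> c"]) (use car ic prod prod' 3 in \<open>simp_all add: m_ac\<close>)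
    then show ?thesis using 3 by simp
  next
    case 4
    have "d = inv d"
      by (rule involution[of "a \<otimes> c"]) (use car ic prod prod' 4 in \<open>simp_all add: m_ac\<close>)
    then show ?thesis using 4 by simp
  next
    case 5
    have "c = inv c"
      by (rule involution[of "a \<otimes> d"]) (use car ic prod prod' 5 in \<open>simp_all add: m_ac\<close>)
    then show ?thesis using 5 by simp
  next
    case 6
    have "a = inv a"
      by (rule involution[of "inv d \<otimes> inv c"]) (use car ic iprod prod' 6 in \<open>simp_all add: m_ac\<close>)
    then show ?thesis using 6 by simp
  next
    case 7
    have "d = inv d"
      by (rule involution[of "inv a \<otimes> inv c"]) (use car ic iprod prod' 7 in \<open>simp_all add: m_ac\<close>)
    then show ?thesis using 7 by simp
  next
    case 8
    have "c = inv c"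
      by (rule involution[of "inv a \<otimes> inv d"]) (use car ic iprod prod' 8 in \<open>simp_all add: m_ac\<close>)
    then show ?thesis using 8 by simp
  qed auto
qed

lemma Gamma_split_isomorphic_equiv:
  assumes G: "comm_group G" and \<gamma>: "triple_of_product_one G \<gamma>" and \<gamma>': "triple_of_product_one G \<gamma>'"
    and iso: "isomorphic_gradings G ((*s) :: 'f::field \<Rightarrow> _) split_mul (Gamma_split G \<gamma>) (*s) split_mul (Gamma_split G \<gamma>')"
  shows "triple_equiv G \<gamma> \<gamma>'"
proof -
  interpret G: comm_group G by fact
  let ?inv = "m_inv G"
  have car: "\<gamma> i \<in> carrier G" "\<gamma>' i \<in> carrier G" for i using \<gamma> \<gamma>' by (auto simp: triple_of_product_one_def)
  have deg_car: "good_degree G \<gamma> i \<in> carrier G" "good_degree G \<gamma>' i \<in> carrier G" for i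
    by (cases i; simp add: car)+
  obtain f where f: "algebra_iso_on ((*s) :: 'f \<Rightarrow> _) split_mul UNIV (*s) split_mul UNIV f"
    "\<And>g. g \<in> carrier G \<Longrightarrow> f ` Gamma_split G \<gamma> g = Gamma_split G \<gamma>' g"
    using iso by (auto simp: isomorphic_gradings_def)
  have inj: "inj f" and lin: "Vector_Spaces.linear (*s) (*s) f"
    using f(1) by (auto simp: algebra_iso_on_def linear_iso_on_def bij_def Vector_Spaces.linear_iff vec.vector_space_axioms)
  have card: "card {i. good_degree G \<gamma> i = g} = card {i. good_degree G \<gamma>' i = g}" for g
  proof (cases "g \<in> carrier G")
    case True
    have "vec.dim (f ` Gamma_split G \<gamma> g) = vec.dim (Gamma_split G \<gamma> g :: ('f ^ good_index) set)"
      by (rule vec.dim_image_eq[OF lin]) (use inj in \<open>auto intro: inj_on_subset\<close>)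
    then show ?thesis using f(2)[OF True] dim_Gamma_split[where 'f = 'f] by metis
  next
    case False
    then have "{i. good_degree G \<gamma> i = g} = {}" "{i. good_degree G \<gamma>' i = g} = {}" using deg_car by auto
    then show ?thesis by simp
  qed
  have "image_mset (good_degree G \<gamma>) (mset_set UNIV) = image_mset (good_degree G \<gamma>') (mset_set UNIV)"
  proof (rule multiset_eqI)
    fix g
    have "count (image_mset (good_degree G \<delta>) (mset_set UNIV)) g = card {i. good_degree G \<delta> i = g}" for \<delta>
      by (simp add: count_image_mset vimage_def Int_def eq_commute)
    then show "count (image_mset (good_degree G \<gamma>) (mset_set UNIV)) g
        = count (image_mset (good_degree G \<gamma>') (mset_set UNIV)) g" using card by simp
  qed
  moreover have "image_mset (good_degree G \<delta>) (mset_set UNIV)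
      = {#\<one>\<^bsub>G\<^esub>, \<one>\<^bsub>G\<^esub>#} + (\<Sum>i\<in>UNIV. {#\<delta> i, ?inv (\<delta> i)#})" for \<delta>
  proof -
    have "image_mset h (mset_set A) = (\<Sum>i\<in>A. {#h i#})" if "finite A" for h :: "good_index \<Rightarrow> 'a" and A
      using that by (induction A rule: finite_induct) auto
    then have "image_mset (good_degree G \<delta>) (mset_set UNIV) = (\<Sum>i\<in>UNIV. {#good_degree G \<delta> i#})" by simp
    also have "\<dots> = {#\<one>\<^bsub>G\<^esub>, \<one>\<^bsub>G\<^esub>#} + (\<Sum>i\<in>UNIV. {#\<delta> i, ?inv (\<delta> i)#})"
      unfolding sum_good_index by (simp add: sum3)
    finally show ?thesis .
  qed
  ultimately have "(\<Sum>i\<in>UNIV. {#\<gamma> i, ?inv (\<gamma> i)#}) = (\<Sum>i\<in>UNIV. {#\<gamma>' i, ?inv (\<gamma>' i)#})"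
    by (simp only: add_left_cancel)
  moreover have "?inv (?inv x) = x" if "x \<in> range \<gamma> \<union> range \<gamma>'" for x
    using that car by auto
  ultimately have "\<exists>\<pi>. bij \<pi> \<and> (\<forall>j\<in>UNIV. \<gamma>' j = \<gamma> (\<pi> j) \<or> \<gamma>' j = ?inv (\<gamma> (\<pi> j)))"
    by (intro match_involution_pairs) simp_all
  then obtain \<pi> where \<pi>: "bij \<pi>" and match: "\<And>j. \<gamma>' j = \<gamma> (\<pi> j) \<or> \<gamma>' j = ?inv (\<gamma> (\<pi> j))"
    by auto
  let ?\<delta> = "\<lambda>j. \<gamma> (\<pi> j)"
  have prod': "\<gamma>' 1 \<otimes>\<^bsub>G\<^esub> \<gamma>' 2 \<otimes>\<^bsub>G\<^esub> \<gamma>' 0 = \<one>\<^bsub>G\<^esub>" using \<gamma>' by (simp add: triple_of_product_one_def)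
  have prod: "?\<delta> 1 \<otimes>\<^bsub>G\<^esub> ?\<delta> 2 \<otimes>\<^bsub>G\<^esub> ?\<delta> 0 = \<one>\<^bsub>G\<^esub>"
  proof -
    have "\<gamma> 1 \<otimes>\<^bsub>G\<^esub> \<gamma> 2 \<otimes>\<^bsub>G\<^esub> \<gamma> 0 = \<one>\<^bsub>G\<^esub>" using \<gamma> by (simp add: triple_of_product_one_def)
    then show ?thesis using permutation3_cases[OF \<pi>] car(1)
      by (elim disjE) (simp_all add: G.m_ac)
  qed
  have "(\<gamma>' 1 = ?\<delta> 1 \<and> \<gamma>' 2 = ?\<delta> 2 \<and> \<gamma>' 0 = ?\<delta> 0) \<or>
      (\<gamma>' 1 = ?inv (?\<delta> 1) \<and> \<gamma>' 2 = ?inv (?\<delta> 2) \<and> \<gamma>' 0 = ?inv (?\<delta> 0))"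
    by (rule G.sign_pattern[OF car(1) car(1) car(1) prod match match match prod'])
  then have "(\<forall>i. \<gamma>' i = ?\<delta> i) \<or> (\<forall>i. \<gamma>' i = ?inv (?\<delta> i))"
    unfolding forall_3 three_arith(1) .
  then show ?thesis unfolding triple_equiv_def using \<pi> by blast
qed

section \<open>Peirce decomposition\<close>

locale split_idempotents = cayley_algebra scale mul one n
  for scale :: "'f::field \<Rightarrow> 'c::ab_group_add \<Rightarrow> 'c" and mul one n +
  fixes e1 e2 :: 'c
  assumes sum_one: "e1 + e2 = one" and n_e1: "n e1 = 0" and n_e2: "n e2 = 0"
begin

lemma swapped: "split_idempotents scale mul one n e2 e1"
  by unfold_locales (simp_all add: n_e1 n_e2 sum_one add.commute)

lemma b_e: "b e1 e1 = 0" "b e2 e2 = 0" "b e1 e2 = 1" "b e2 e1 = 1"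
proof -
  show "b e1 e1 = 0" "b e2 e2 = 0" by (simp_all add: b_self n_e1 n_e2)
  show 1: "b e1 e2 = 1" by (simp add: polar_def sum_one n_e1 n_e2)
  then show "b e2 e1 = 1" by (simp add: b_commute)
qed

lemma cnj_e: "cnj e1 = e2" "cnj e2 = e1"
proof -
  have "b e1 one = 1" "b e2 one = 1" unfolding sum_one[symmetric] by (simp_all add: b_add_right b_e)
  moreover have "one - e1 = e2" "one - e2 = e1" by (simp_all flip: sum_one)
  ultimately show "cnj e1 = e2" "cnj e2 = e1" by (simp_all add: cnj_def)
qed

lemma mul_e: "mul e1 e1 = e1" "mul e2 e2 = e2" "mul e1 e2 = 0" "mul e2 e1 = 0"
proof -
  show 1: "mul e1 e2 = 0" using mul_cnj[of e1] by (simp add: cnj_e n_e1)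
  show 2: "mul e2 e1 = 0" using mul_cnj[of e2] by (simp add: cnj_e n_e2)
  have "mul e1 (e1 + e2) = e1" "mul e2 (e1 + e2) = e2" by (simp_all add: sum_one mul_one)
  then show "mul e1 e1 = e1" "mul e2 e2 = e2" using 1 2 by (simp_all add: mul_add_right)
qed

text \<open>The first Peirce space; the second one is \<open>opp.peirce\<close> below, obtained by exchanging the
  idempotents. The formula for \<open>proj\<close> is multiplication by \<open>e1\<close> corrected by the component along \<open>e1\<close>.\<close>

definition peirce :: "'c set" where
  "peirce = {x. b x e1 = 0 \<and> b x e2 = 0 \<and> mul e1 x = x}"

definition proj :: "'c \<Rightarrow> 'c" where
  "proj x = mul e1 x - scale (b x e2) e1"

lemma mul_e1_e1: "mul e1 (mul e1 x) = mul e1 x"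
proof -
  have "mul e2 (mul e1 x) = 0" using cnj_mul_cancel[of e1 x] by (simp add: cnj_e n_e1)
  moreover have "mul (e1 + e2) (mul e1 x) = mul e1 x" by (simp add: sum_one one_mul)
  ultimately show ?thesis by (simp add: mul_add_left)
qed

lemma proj_in: "proj x \<in> peirce"
  unfolding peirce_def proj_def
  by (simp add: b_simps b_e adjoint_left[of e1 x] cnj_e mul_e mul_simps mul_e1_e1)

lemma proj_id: "x \<in> peirce \<Longrightarrow> proj x = x"
  by (simp add: proj_def peirce_def)

lemma proj_add: "proj (x + y) = proj x + proj y"
  by (simp add: proj_def mul_simps b_simps scale_left_distrib)

lemma proj_scale: "proj (scale a x) = scale a (proj x)"
  by (simp add: proj_def mul_simps b_simps scale_right_diff_distrib)

lemma peirce_D: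
  assumes "x \<in> peirce"
  shows "mul e1 x = x" "mul x e2 = x" "mul e2 x = 0" "mul x e1 = 0"
    "b x e1 = 0" "b x e2 = 0" "b e1 x = 0" "b e2 x = 0" "b x one = 0" "n x = 0" "cnj x = - x" "mul x x = 0"
proof -
  show 1: "mul e1 x = x" and b: "b x e1 = 0" "b x e2 = 0" using assms by (simp_all add: peirce_def)
  then show "b e1 x = 0" "b e2 x = 0" by (simp_all add: b_commute)
  show tr: "b x one = 0" unfolding sum_one[symmetric] using b by (simp add: b_add_right)
  show 2: "mul x e2 = x" using mul_perp_commute[of x e1] tr b 1 by (simp add: cnj_e)
  have "mul (e1 + e2) x = x" "mul x (e1 + e2) = x" by (simp_all add: sum_one one_mul mul_one)
  then show "mul e2 x = 0" "mul x e1 = 0" using 1 2 by (simp_all add: mul_add_left mul_add_right)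
  have "n (mul e1 x) = 0" by (simp add: norm_mult n_e1)
  then show nx: "n x = 0" using 1 by simp
  show "cnj x = - x" using tr by (rule cnj_trace_zero)
  show "mul x x = 0" by (simp add: quadratic tr nx)
qed

lemma peirce_isotropic: "x \<in> peirce \<Longrightarrow> y \<in> peirce \<Longrightarrow> b x y = 0"
  using b_mul_left[of e1 x y] by (simp add: peirce_D n_e1)

lemma peirce_anticommute:
  assumes "x \<in> peirce" "y \<in> peirce"
  shows "mul x y = - mul y x"
proof -
  have "- mul x y = mul y x"
    using left_linearized[of x y one] assms
    by (simp add: peirce_D peirce_isotropic mul_one mul_minus_left add_eq_0_iff)
  then show ?thesis by (metis minus_minus)
qed

lemma peirce_subspace: "subspace peirce"
  by (rule subspaceI) (auto simp: peirce_def b_simps mul_simps)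

interpretation opp: split_idempotents scale mul one n e2 e1
  by (rule swapped)

lemma peirce_decomposition: "x = scale (b x e2) e1 + scale (b x e1) e2 + proj x + opp.proj x"
proof -
  have "mul e1 x + mul e2 x = x" by (simp add: sum_one one_mul flip: mul_add_left)
  then show ?thesis by (simp add: proj_def opp.proj_def algebra_simps)
qed

lemma peirce_mul:
  assumes x: "x \<in> peirce" and y: "y \<in> peirce"
  shows "mul x y \<in> opp.peirce"
proof -
  have "b (mul x y) e1 = 0" "b (mul x y) e2 = 0"
    using x y by (simp_all add: adjoint_left[of x y] peirce_D mul_minus_left b_minus_right peirce_isotropic)
  moreover have "mul e2 (mul x y) = mul x y"
    using left_linearized[of x e1 y] x y by (simp add: peirce_D cnj_e mul_minus_left)
  ultimately show ?thesis by (simp add: opp.peirce_def)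
qed

lemma peirce_mixed:
  assumes x: "x \<in> peirce" and v: "v \<in> opp.peirce"
  shows "mul x v = - scale (b x v) e1" "mul v x = - scale (b x v) e2"
  using left_linearized[of x v e1] left_linearized[of x v e2] peirce_D[OF x] opp.peirce_D[OF v]
  by (simp_all add: mul_minus_left minus_equation_iff[of _ "scale _ _"])

text \<open>Moving \<open>x\<close> to the other side of the polar form and anticommuting shows that the trilinear form is
  invariant under cyclic shifts; it is therefore alternating.\<close>

lemma peirce_cyclic:
  assumes "x \<in> peirce" "y \<in> peirce" "z \<in> peirce"
  shows "b (mul x y) z = b (mul z x) y" "b (mul x y) y = 0" "b (mul x y) x = 0"
proof -
  have "b (mul x y) z = b y (- mul x z)"
    using adjoint_left[of x y z] assms by (simp add: peirce_D mul_minus_left)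
  then show "b (mul x y) z = b (mul z x) y"
    using peirce_anticommute[of z x] assms by (simp add: b_commute)
  show "b (mul x y) y = 0"
    using adjoint_right[of x y y] assms by (simp add: mul_minus_right peirce_D)
  show "b (mul x y) x = 0"
    using adjoint_left[of x y x] assms by (simp add: mul_minus_left peirce_D)
qed

text \<open>The left linearized identity replaces the product of \<open>yz\<close> and \<open>zx\<close> by that of \<open>z\<close> and \<open>(yz)x\<close>, and the
  latter factor is \<open>- e2\<close> as \<open>yz\<close> is dual to \<open>x\<close>.\<close>

lemma peirce_dual_product:
  assumes xyz: "x \<in> peirce" "y \<in> peirce" "z \<in> peirce" and one: "b (mul x y) z = 1"
  shows "mul (mul y z) (mul z x) = z"
proof -
  note v = peirce_mul[OF xyz(2,3)]
  have "b x (mul y z) = 1"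
    using peirce_cyclic(1)[OF xyz(2,3,1)] one by (simp add: b_commute)
  then have "mul (mul y z) x = - e2" using peirce_mixed(2)[OF xyz(1) v] by simp
  then show ?thesis
    using left_linearized[of "mul y z" z x] peirce_cyclic(2)[OF xyz(2,3)] xyz(2,3,1)
      opp.peirce_D(11)[OF v] peirce_D(2,11)[OF xyz(3)]
    by (simp add: mul_minus_left mul_minus_right)
qed

text \<open>The index 3 is 0 in the type \<open>3\<close>; \<open>peirce_v\<close> multiplies the two vectors with the cyclically following
  indices.\<close>

definition peirce_u :: "'c \<Rightarrow> 'c \<Rightarrow> 'c \<Rightarrow> 3 \<Rightarrow> 'c" where
  "peirce_u x y z j = (if j = 1 then x else if j = 2 then y else z)"

definition peirce_v :: "'c \<Rightarrow> 'c \<Rightarrow> 'c \<Rightarrow> 3 \<Rightarrow> 'c" where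
  "peirce_v x y z j = mul (peirce_u x y z (j + 1)) (peirce_u x y z (j + 2))"

text \<open>By cyclicity the products \<open>v\<^sub>j\<close> form the dual basis to the \<open>u\<^sub>j\<close>, which gives the mixed products and
  linear independence; \<open>peirce_dual_product\<close> gives the products of the \<open>v\<^sub>j\<close>.\<close>

lemma peirce_good_system:
  assumes xyz: "x \<in> peirce" "y \<in> peirce" "z \<in> peirce" and one: "b (mul x y) z = 1"
  shows "good_system scale mul e1 e2 (peirce_u x y z) (peirce_v x y z)"
proof -
  let ?u = "peirce_u x y z" and ?v = "peirce_v x y z"
  have u: "?u j \<in> peirce" for j using xyz by (simp add: peirce_u_def)
  have v: "?v j \<in> opp.peirce" for j unfolding peirce_v_def by (intro peirce_mul u)
  have one': "b (mul z x) y = 1" "b (mul y z) x = 1"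
    using one peirce_cyclic(1)[OF xyz] peirce_cyclic(1)[OF xyz(2,3,1)] by simp_all
  have val: "?u 1 = x" "?u 2 = y" "?u 0 = z" "?v 1 = mul y z" "?v 2 = mul z x" "?v 0 = mul x y"
    by (simp_all add: peirce_u_def peirce_v_def)
  note anti = peirce_anticommute[OF xyz(2,1)] peirce_anticommute[OF xyz(3,2)] peirce_anticommute[OF xyz(1,3)]
  note sq = peirce_D(12)[OF xyz(1)] peirce_D(12)[OF xyz(2)] peirce_D(12)[OF xyz(3)]
  note dual = peirce_dual_product[OF xyz one] peirce_dual_product[OF xyz(3,1,2) one'(1)]
    peirce_dual_product[OF xyz(2,3,1) one'(2)]
  note pv = peirce_mul[OF xyz(2,3)] peirce_mul[OF xyz(3,1)] peirce_mul[OF xyz(1,2)]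
  note vanti = opp.peirce_anticommute[OF pv(2,1)] opp.peirce_anticommute[OF pv(3,2)] opp.peirce_anticommute[OF pv(1,3)]
  note vsq = opp.peirce_D(12)[OF pv(1)] opp.peirce_D(12)[OF pv(2)] opp.peirce_D(12)[OF pv(3)]
  note zero = peirce_cyclic(2,3)[OF xyz(1,2,3)] peirce_cyclic(2,3)[OF xyz(2,3,1)] peirce_cyclic(2,3)[OF xyz(3,1,2)]
  have dualb: "b (?v k) (?u j) = (if j = k then 1 else 0)" for j k
    using exhaust3[of j] exhaust3[of k]
    by (elim disjE) (simp_all add: val one one' zero)
  then have dualb': "b (?u j) (?v k) = (if j = k then 1 else 0)" for j k
    by (simp add: b_commute)
  show ?thesis
  proof (intro good_system.intro good_system_axioms.intro vector_space_axioms mul_linear_left mul_linear_right)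
    show "mul e1 e1 = e1" "mul e2 e2 = e2" "mul e1 e2 = 0" "mul e2 e1 = 0" by (fact mul_e)+
    show "mul e1 (?u j) = ?u j" "mul e2 (?u j) = 0" "mul (?u j) e1 = 0" "mul (?u j) e2 = ?u j" for j
      using peirce_D[OF u] by simp_all
    show "mul e1 (?v j) = 0" "mul e2 (?v j) = ?v j" "mul (?v j) e1 = ?v j" "mul (?v j) e2 = 0" for j
      using opp.peirce_D[OF v] by simp_all
    show "mul (?u j) (?u k) = (\<Sum>l\<in>UNIV. scale (levi_civita j k l) (?v l))" for j k
      unfolding sum3 using exhaust3[of j] exhaust3[of k]
      by (elim disjE) (simp_all add: levi_civita_def val sq anti)
    show "mul (?v j) (?v k) = (\<Sum>l\<in>UNIV. scale (levi_civita j k l) (?u l))" for j k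
      unfolding sum3 using exhaust3[of j] exhaust3[of k]
      by (elim disjE) (simp_all add: levi_civita_def val vsq vanti dual)
    show "mul (?u j) (?v k) = (if j = k then - e1 else 0)" for j k
      by (simp add: peirce_mixed(1)[OF u v] dualb')
    show "mul (?v j) (?u k) = (if j = k then - e2 else 0)" for j k
      by (simp add: peirce_mixed(2)[OF u v] dualb')
    show "dim UNIV = 8" by (rule dim_8)
    fix c :: "'f ^ good_index"
    assume c0: "good_combination scale (good_vector e1 e2 ?u ?v) c = 0"
    let ?s = "scale (c $ Ix_e1) e1 + scale (c $ Ix_e2) e2 + (\<Sum>j\<in>UNIV. scale (c $ Ix_u j) (?u j))
      + (\<Sum>j\<in>UNIV. scale (c $ Ix_v j) (?v j))"
    have s0: "?s = 0" using c0 by (simp add: good_combination_def sum_good_index)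
    have iso: "b (?u j) (?u k) = 0" "b (?v j) (?v k) = 0" for j k
      by (rule peirce_isotropic[OF u u], rule opp.peirce_isotropic[OF v v])
    note simps = b_add_left b_scale_left b_sum_left b_e iso dualb dualb' peirce_D(5-8)[OF u] opp.peirce_D(5-8)[OF v]
    have "b ?s e2 = c $ Ix_e1" "b ?s e1 = c $ Ix_e2" by (simp_all add: simps)
    moreover have "b ?s (?v j) = c $ Ix_u j" "b ?s (?u j) = c $ Ix_v j" for j
      by (simp_all add: simps if_distrib[of "\<lambda>x. _ * x"] cong: if_cong)
    ultimately have "c $ i = 0" for i using s0 by (cases i) (metis b_zero_left)+
    then show "c = 0" by (simp add: vec_eq_iff)
  qed
qed

text \<open>If the form vanished, so would all products in the first Peirce space. For \<open>x\<close> in it and a dual \<open>v\<close> in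
  the second one, linearizing \<open>(yx)(cnj x) = n x \<cdot> y\<close> would make every \<open>y\<close> a multiple of \<open>x\<close>; both Peirce
  spaces would be at most one-dimensional, and the whole algebra at most 4-dimensional.\<close>

lemma peirce_trilinear_nonzero: "\<exists>x y z. b (mul (proj x) (proj y)) (proj z) \<noteq> 0"
proof (rule ccontr)
  assume "\<nexists>x y z. b (mul (proj x) (proj y)) (proj z) \<noteq> 0"
  then have zero: "b (mul x y) z = 0" if "x \<in> peirce" "y \<in> peirce" "z \<in> peirce" for x y z
    using proj_id that by metis
  have perp: "x = 0" if x: "x \<in> peirce" "\<And>v. v \<in> opp.peirce \<Longrightarrow> b x v = 0" for x
  proof (rule polar_nondegenerate)
    fix y
    have "b x y = b x (scale (b y e2) e1 + scale (b y e1) e2 + proj y + opp.proj y)"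
      using peirce_decomposition[of y] by simp
    also have "\<dots> = 0"
      using x(2)[OF opp.proj_in] peirce_isotropic[OF x(1) proj_in] peirce_D[OF x(1)] by (simp add: b_simps)
    finally show "b x y = 0" .
  qed
  have perp': "v = 0" if v: "v \<in> opp.peirce" "\<And>x. x \<in> peirce \<Longrightarrow> b v x = 0" for v
  proof (rule polar_nondegenerate)
    fix y
    have "b v y = b v (scale (b y e2) e1 + scale (b y e1) e2 + proj y + opp.proj y)"
      using peirce_decomposition[of y] by simp
    also have "\<dots> = 0"
      using v(2)[OF proj_in] opp.peirce_isotropic[OF v(1) opp.proj_in] opp.peirce_D[OF v(1)] by (simp add: b_simps)
    finally show "b v y = 0" .
  qed
  have mul0: "mul x y = 0" if "x \<in> peirce" "y \<in> peirce" for x y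
    by (rule perp'[OF peirce_mul[OF that]]) (rule zero[OF that])
  have "\<exists>x v. peirce \<subseteq> span {x} \<and> opp.peirce \<subseteq> span {v}"
  proof (cases "\<exists>x\<in>peirce. x \<noteq> 0")
    case False
    then have "peirce \<subseteq> {0}" by blast
    moreover from False have "opp.peirce \<subseteq> {0}" using perp' by force
    ultimately show ?thesis using span_zero by blast
  next
    case True
    then obtain x v0 where x: "x \<in> peirce" and v0: "v0 \<in> opp.peirce" "b x v0 \<noteq> 0" using perp by blast
    define v where "v = scale (1 / b x v0) v0"
    have v: "v \<in> opp.peirce" "b x v = 1"
      using v0 opp.peirce_subspace by (simp_all add: v_def subspace_scale b_scale_right)
    have "y \<in> span {x}" if y: "y \<in> peirce" for y
    proof -
      have "mul (mul y x) (cnj v) + mul (mul y v) (cnj x) = y"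
        using right_linearized[of y x v] v(2) by simp
      then have "y = scale (b y v) x"
        using mul0[OF y x] peirce_mixed(1)[OF y v(1)] peirce_D(1,11)[OF x]
        by (simp add: mul_simps)
      then show ?thesis by (metis span_base span_scale singletonI)
    qed
    moreover have "w \<in> span {v}" if w: "w \<in> opp.peirce" for w
    proof -
      let ?w = "w - scale (b x w) v"
      have "?w = 0"
      proof (rule perp')
        show "?w \<in> opp.peirce" using w v opp.peirce_subspace by (simp add: subspace_diff subspace_scale)
        fix y assume "y \<in> peirce"
        then obtain a where "y = scale a x" using \<open>\<And>y. y \<in> peirce \<Longrightarrow> y \<in> span {x}\<close> by (auto simp: span_singleton)
        then show "b ?w y = 0" using v(2) b_commute[of w x] b_commute[of v x] by (simp add: b_simps)
      qed
      then have "w = scale (b x w) v" by simp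
      then show ?thesis by (metis span_base span_scale singletonI)
    qed
    ultimately show ?thesis by blast
  qed
  then obtain x v where span: "peirce \<subseteq> span {x}" "opp.peirce \<subseteq> span {v}" by blast
  have "y \<in> span {e1, e2, x, v}" for y
  proof -
    have "proj y \<in> span {e1, e2, x, v}" "opp.proj y \<in> span {e1, e2, x, v}"
      using span proj_in opp.proj_in span_mono[of "{x}" "{e1, e2, x, v}"] span_mono[of "{v}" "{e1, e2, x, v}"]
      by blast+
    then have "scale (b y e2) e1 + scale (b y e1) e2 + proj y + opp.proj y \<in> span {e1, e2, x, v}"
      by (intro span_add span_scale) (auto intro: span_base)
    then show ?thesis using peirce_decomposition[of y] by metis
  qed
  then have "dim (UNIV :: 'c set) \<le> card {e1, e2, x, v}" by (intro dim_le_card) auto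
  also have "\<dots> \<le> 4" by (simp add: card_insert_if)
  finally show False using dim_8 by simp
qed

end

section \<open>Gradings with isotropic identity component\<close>

context cayley_graded
begin

text \<open>For \<open>y\<close> in the identity component paired nontrivially with the isotropic \<open>x\<close>, a multiple of
  \<open>x \<cdot> cnj y\<close> has norm 0 and trace 1 and hence is idempotent. The trilinear form of the resulting Peirce
  decomposition, being additive in each variable, is nonzero on some homogeneous vectors; their degrees have product \<open>\<one>\<close>.\<close>

lemma split_grading:
  assumes nontriv: "\<not> trivial_grading G W" and x: "x \<in> W \<one>" "x \<noteq> 0" "n x = 0"
  shows "\<exists>\<gamma>. triple_of_product_one G \<gamma> \<and> \<gamma> \<noteq> (\<lambda>_. \<one>) \<and>
    isomorphic_gradings G scale mul W (*s) split_mul (Gamma_split G \<gamma>)"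
proof -
  have sub1: "subspace (W \<one>)" by (rule sub) simp
  have mul1: "mul y z \<in> W \<one>" if "y \<in> W \<one>" "z \<in> W \<one>" for y z
    using mul_closed[of \<one> \<one> y z] that by simp
  obtain y where y: "y \<in> W \<one>" "b x y \<noteq> 0" using nondeg_pairing[of \<one> x] x by auto
  define e1 where "e1 = scale (1 / b x y) (mul x (cnj y))"
  define e2 where "e2 = one - e1"
  have e1W: "e1 \<in> W \<one>"
    unfolding e1_def using x y cnj_in[of \<one> y] mul1 sub1 by (simp add: subspace_scale)
  have e2W: "e2 \<in> W \<one>" unfolding e2_def using e1W one_in sub1 by (simp add: subspace_diff)
  have ne1: "n e1 = 0" by (simp add: e1_def norm_scale norm_mult x)
  have "b e1 one = 1" using y(2) b_eq_trace[of x y] by (simp add: e1_def b_scale_left)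
  then have ne2: "n e2 = 0" by (simp add: e2_def norm_diff ne1 b_commute[of one e1])
  interpret E: split_idempotents scale mul one n e1 e2
    by unfold_locales (simp_all add: e2_def[symmetric] ne1 ne2, simp add: e2_def)
  have proj_W: "E.proj z \<in> W g" if "g \<in> carrier G" "z \<in> W g" for g z
  proof -
    have "mul e1 z \<in> W (\<one> \<otimes> g)" by (rule mul_closed) (use that e1W in auto)
    moreover have "scale (b z e2) e1 \<in> W g"
    proof (cases "g = \<one>")
      case True
      then show ?thesis using e1W sub1 by (simp add: subspace_scale)
    next
      case False
      then have "b z e2 = 0" using b_orthogonal[of g \<one> z e2] that e2W by simp
      then show ?thesis using subspace_0[OF sub[OF that(1)]] by simp
    qed
    ultimately show ?thesis unfolding E.proj_def using that sub by (simp add: subspace_diff)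
  qed
  define t where "t x y z = b (mul (E.proj x) (E.proj y)) (E.proj z)" for x y z
  have t_add: "t (x + x') y z = t x y z + t x' y z" "t x (y + y') z = t x y z + t x y' z"
    "t x y (z + z') = t x y z + t x y z'" for x x' y y' z z'
    by (simp_all add: t_def E.proj_add mul_simps b_simps)
  have p0: "E.proj 0 = 0" using E.proj_scale[of 0 0] by simp
  have t_zero: "t 0 y z = 0" "t x 0 z = 0" "t x y 0 = 0" for x y z
    by (simp_all add: t_def p0)
  have "\<exists>g1 g2 g3 x y z. g1 \<in> carrier G \<and> g2 \<in> carrier G \<and> g3 \<in> carrier G \<and>
      x \<in> W g1 \<and> y \<in> W g2 \<and> z \<in> W g3 \<and> t x y z \<noteq> 0"
  proof (rule ccontr)
    assume neg: "\<not> ?thesis"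
    have hom: "t x y z = 0" if "g1 \<in> carrier G" "g2 \<in> carrier G" "g3 \<in> carrier G" "x \<in> W g1" "y \<in> W g2" "z \<in> W g3"
      for g1 g2 g3 x y z
      using neg that by blast
    have 1: "t x y z = 0" if "g1 \<in> carrier G" "g2 \<in> carrier G" "x \<in> W g1" "y \<in> W g2" for g1 g2 x y z
      by (induction z rule: homogeneous_induct) (use hom that t_add t_zero in auto)
    have 2: "t x y z = 0" if "g1 \<in> carrier G" "x \<in> W g1" for g1 x y z
      by (induction y rule: homogeneous_induct) (use 1 that t_add t_zero in auto)
    have "t x y z = 0" for x y z
      by (induction x rule: homogeneous_induct) (use 2 t_add t_zero in auto)
    then show False using E.peirce_trilinear_nonzero unfolding t_def by blast
  qed
  then obtain g1 g2 g3 x1 x2 x3 where g: "g1 \<in> carrier G" "g2 \<in> carrier G" "g3 \<in> carrier G"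
    and xW: "x1 \<in> W g1" "x2 \<in> W g2" "x3 \<in> W g3" and t: "t x1 x2 x3 \<noteq> 0" by blast
  define u1 u2 u3 where "u1 = E.proj x1" and "u2 = E.proj x2" and "u3 = scale (1 / t x1 x2 x3) (E.proj x3)"
  have uW: "u1 \<in> W g1" "u2 \<in> W g2" "u3 \<in> W g3"
    using proj_W g xW sub by (simp_all add: u1_def u2_def u3_def subspace_scale)
  have uP: "u1 \<in> E.peirce" "u2 \<in> E.peirce" "u3 \<in> E.peirce"
    using E.proj_in E.peirce_subspace by (simp_all add: u1_def u2_def u3_def subspace_scale)
  have one: "b (mul u1 u2) u3 = 1" using t by (simp add: u1_def u2_def u3_def t_def b_scale_right)
  have prod: "g1 \<otimes> g2 \<otimes> g3 = \<one>"
  proof (rule ccontr)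
    assume "g1 \<otimes> g2 \<otimes> g3 \<noteq> \<one>"
    then have "b (mul u1 u2) u3 = 0"
      by (intro b_orthogonal[of "g1 \<otimes> g2" g3]) (use g uW mul_closed in auto)
    then show False using one by simp
  qed
  interpret S: good_system scale mul e1 e2 "E.peirce_u u1 u2 u3" "E.peirce_v u1 u2 u3"
    by (rule E.peirce_good_system[OF uP one])
  define \<gamma> :: "3 \<Rightarrow> 'g" where "\<gamma> j = (if j = 1 then g1 else if j = 2 then g2 else g3)" for j
  have \<gamma>v: "\<gamma> 1 = g1" "\<gamma> 2 = g2" "\<gamma> 0 = g3" by (simp_all add: \<gamma>_def)
  have triple: "triple_of_product_one G \<gamma>"
    unfolding triple_of_product_one_def using g prod by (auto simp: \<gamma>_def)
  have inv: "inv g1 = g2 \<otimes> g3" "inv g2 = g3 \<otimes> g1" "inv g3 = g1 \<otimes> g2"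
    by (rule G.inv_equality; use g prod in \<open>simp add: G.m_ac\<close>)+
  have degW: "S.bs i \<in> W (good_degree G \<gamma> i)" for i
  proof (cases i)
    case (Ix_u j)
    then show ?thesis using exhaust3[of j] uW by (auto simp: \<gamma>v E.peirce_u_def)
  next
    case (Ix_v j)
    have "mul u2 u3 \<in> W (g2 \<otimes> g3)" "mul u3 u1 \<in> W (g3 \<otimes> g1)" "mul u1 u2 \<in> W (g1 \<otimes> g2)"
      by (intro mul_closed g uW)+
    then show ?thesis using Ix_v exhaust3[of j] by (auto simp: \<gamma>v inv E.peirce_u_def E.peirce_v_def)
  qed (use e1W e2W in auto)
  have degc: "good_degree G \<gamma> i \<in> carrier G" for i
    by (cases i) (use triple in \<open>auto simp: triple_of_product_one_def\<close>)
  have image: "S.F ` Gamma_split G \<gamma> h = W h" if h: "h \<in> carrier G" for h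
    unfolding S.image_Gamma_split
  proof
    show "span {S.bs i |i. good_degree G \<gamma> i = h} \<subseteq> W h"
      by (rule span_minimal[OF _ sub[OF h]]) (use degW in auto)
    show "W h \<subseteq> span {S.bs i |i. good_degree G \<gamma> i = h}"
    proof
      fix y assume y: "y \<in> W h"
      obtain c where c: "y = S.F c" using S.bij_F by (metis bij_pointE)
      have "y = comp y h" using comp_homogeneous[OF h y] by simp
      also have "\<dots> = (\<Sum>i\<in>UNIV. comp (scale (c $ i) (S.bs i)) h)"
        unfolding c good_combination_def by (rule comp_sum_distrib)
      also have "\<dots> = (\<Sum>i\<in>UNIV. if good_degree G \<gamma> i = h then scale (c $ i) (S.bs i) else 0)"
      proof (rule sum.cong[OF refl])
        fix i
        have "scale (c $ i) (S.bs i) \<in> W (good_degree G \<gamma> i)"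
          using degW sub[OF degc] by (simp add: subspace_scale)
        from comp_homogeneous[OF degc this]
        show "comp (scale (c $ i) (S.bs i)) h = (if good_degree G \<gamma> i = h then scale (c $ i) (S.bs i) else 0)"
          by auto
      qed
      also have "\<dots> \<in> span {S.bs i |i. good_degree G \<gamma> i = h}"
        by (intro span_sum) (auto intro: span_scale span_base span_zero)
      finally show "y \<in> span {S.bs i |i. good_degree G \<gamma> i = h}" .
    qed
  qed
  have "isomorphic_gradings G (*s) split_mul (Gamma_split G \<gamma>) scale mul W"
    unfolding isomorphic_gradings_def using S.iso_F image by blast
  moreover have "\<gamma> \<noteq> (\<lambda>_. \<one>)"
  proof
    assume \<gamma>: "\<gamma> = (\<lambda>_. \<one>)"
    have "good_degree G \<gamma> i = \<one>" for i by (cases i) (simp_all add: \<gamma>)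
    then have "Gamma_split G \<gamma> \<one> = vec.span (cart_basis :: ('f ^ good_index) set)"
      unfolding Gamma_split_def cart_basis_def by simp
    then have "W \<one> = range S.F" using image[of \<one>] vec.span_Basis by simp
    then have "W \<one> = UNIV" using S.bij_F by (simp add: bij_def)
    then show False using nontriv by (simp add: trivial_grading_def)
  qed
  ultimately show ?thesis using triple isomorphic_gradings_sym by blast
qed

end

section \<open>Division gradings on the whole algebra\<close>

lemma divisors_of_8: "k * d = (8::nat) \<Longrightarrow> k = 1 \<or> k = 2 \<or> k = 4 \<or> k = 8"
proof -
  assume kd: "k * d = 8"
  then have "k dvd 8" by (metis dvd_triv_left)
  then have "k \<le> 8" by (rule dvd_imp_le) simp
  then have "k = 0 \<or> k = 1 \<or> k = 2 \<or> k = 3 \<or> k = 4 \<or> k = 5 \<or> k = 6 \<or> k = 7 \<or> k = 8" by linarith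
  then show ?thesis using kd by (elim disjE; simp; presburger?)
qed

context division_grading
begin

lemma one_component_scalar: "dim (U \<one>) = 1 \<Longrightarrow> U \<one> = span {one}"
proof -
  assume dim: "dim (U \<one>) = 1"
  have "span {one} \<subseteq> U \<one>" using one_in sub[of \<one>] by (intro span_minimal) auto
  moreover have "dim (span {one}) = 1" by simp
  ultimately show ?thesis
    using fd.subspace_dim_equal[of "span {one}" "U \<one>"] sub[of \<one>] dim by simp
qed

lemma component_span:
  assumes U1: "U \<one> = span {one}" and h: "h \<in> H" and x: "x \<in> U h" "x \<noteq> 0"
  shows "U h = span {x}"
  using component_eq_one[OF h x] by (simp add: U1 span_mul_image one_mul)

lemma is_doubling_grading_K:
  assumes H: "card H = 4" and full: "total = UNIV"
  shows "\<exists>\<mu>. admissible_K scale n G (U \<one>) H \<mu> \<and>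
    doubling_grading_K mul n G (U \<one>) H \<mu> (\<lambda>g. if g \<in> H then U g else {0})"
proof -
  obtain x where x: "\<And>t. t \<in> H \<Longrightarrow> x t \<in> U t" "\<And>t. t \<in> H \<Longrightarrow> x t \<noteq> 0" and x1: "x \<one> = one"
    using transversal by blast
  define \<mu> where "\<mu> t = N #>\<^bsub>field_units\<^esub> n (x t)" for t
  have adm: "admissible_K scale n G (U \<one>) H \<mu>"
    unfolding \<mu>_def by (rule admissible_K[OF x full x1])
  have m: "n (x t) \<in> \<mu> t" if "t \<in> H" for t unfolding \<mu>_def by (rule norm_in_coset[OF x that])
  obtain t1 t2 where t: "t1 \<in> H" "t2 \<in> H" and Heq: "H = {\<one>, t1, t2, t1 \<otimes> t2}"
    using G.klein_generators[OF H_subgroup H H_square] by metis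
  have t12: "t1 \<otimes> t2 \<in> H" using t by simp
  have "card (set [\<one>, t1, t2, t1 \<otimes> t2]) = length [\<one>, t1, t2, t1 \<otimes> t2]"
    using H unfolding Heq by simp
  then have dist: "distinct [\<one>, t1, t2, t1 \<otimes> t2]" by (rule card_distinct)
  let ?u = "x t1" and ?v = "x t2"
  have uv: "mul ?u ?v \<in> U (t1 \<otimes> t2)" by (rule mul_closed[OF t x(1)[OF t(1)] x(1)[OF t(2)]])
  have nuv: "n ?u \<noteq> 0" "n ?v \<noteq> 0" using norm_x[OF x] t by auto
  then have "n (mul ?u ?v) \<noteq> 0" by (simp add: norm_mult)
  then have uv0: "mul ?u ?v \<noteq> 0" by auto
  note c1 = component_eq_one[OF t(1) x(1)[OF t(1)] x(2)[OF t(1)]]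
  note c2 = component_eq_one[OF t(2) x(1)[OF t(2)] x(2)[OF t(2)]]
  note c12 = component_eq_one[OF t12 uv uv0]
  have "doubling_grading_K mul n G (U \<one>) H \<mu> (\<lambda>g. if g \<in> H then U g else {0})"
    unfolding doubling_grading_K_def
  proof (intro exI conjI)
    show "H = {\<one>, t1, t2, t1 \<otimes> t2}" by (rule Heq)
    show "?u \<in> perp n (U \<one>)"
      unfolding perp_def using orthogonal[OF t(1) H.one_closed _ x(1)[OF t(1)]] dist by auto
    show "?v \<in> perp n (U \<one> \<union> (\<lambda>x. mul x ?u) ` U \<one>)"
      unfolding c1[symmetric] perp_def
      using orthogonal[OF t(2) H.one_closed _ x(1)[OF t(2)]] orthogonal[OF t(2,1) _ x(1)[OF t(2)]] dist by auto
    show "n ?u \<in> \<mu> t1" "n ?v \<in> \<mu> t2" by (rule m[OF t(1)], rule m[OF t(2)])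
    show "(\<lambda>g. if g \<in> H then U g else {0}) = (\<lambda>g. if g = \<one> then U \<one>
        else if g = t1 then (\<lambda>x. mul x ?u) ` U \<one>
        else if g = t2 then (\<lambda>x. mul x ?v) ` U \<one>
        else if g = t1 \<otimes> t2 then (\<lambda>x. mul x (mul ?u ?v)) ` U \<one> else {0})"
      unfolding c1[symmetric] c2[symmetric] c12[symmetric]
    proof (rule ext)
      fix g
      have "g \<in> H \<longleftrightarrow> g = \<one> \<or> g = t1 \<or> g = t2 \<or> g = t1 \<otimes> t2" unfolding Heq by blast
      then show "(if g \<in> H then U g else {0}) = (if g = \<one> then U \<one> else if g = t1 then U t1
        else if g = t2 then U t2 else if g = t1 \<otimes> t2 then U (t1 \<otimes> t2) else {0})"
        by presburger
    qed
  qed (use nuv in auto)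
  then show ?thesis using adm by blast
qed

lemma is_doubling_grading_F:
  assumes H: "card H = 8" and full: "total = UNIV" and U1: "U \<one> = span {one}"
  shows "\<exists>\<mu>. admissible_F scale n G H \<mu> \<and>
    doubling_grading_F scale mul one n G H \<mu> (\<lambda>g. if g \<in> H then U g else {0})"
proof -
  obtain x where x: "\<And>t. t \<in> H \<Longrightarrow> x t \<in> U t" "\<And>t. t \<in> H \<Longrightarrow> x t \<noteq> 0" and x1: "x \<one> = one"
    using transversal by blast
  define \<mu> where "\<mu> t = N #>\<^bsub>field_units\<^esub> n (x t)" for t
  have adm: "admissible_F scale n G H \<mu>"
    unfolding \<mu>_def by (rule admissible_F[OF x full x1 U1])
  have m: "n (x t) \<in> \<mu> t" if "t \<in> H" for t unfolding \<mu>_def by (rule norm_in_coset[OF x that])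
  obtain s1 s2 s3 where s: "s1 \<in> H" "s2 \<in> H" "s3 \<in> H" and gen: "generate G {s1, s2, s3} = H"
    using G.order8_generators[OF H_subgroup H H_square] by metis
  have T: "elementary_abelian_2_subgroup G 8 H"
    using H_subgroup H H_square by (simp add: elementary_abelian_2_subgroup_def)
  note facts = order8_subgroup[OF T s gen]
  let ?u = "x s1" and ?v = "x s2" and ?w = "x s3"
  have nz: "n ?u \<noteq> 0" "n ?v \<noteq> 0" "n ?w \<noteq> 0" using norm_x[OF x] s by auto
  note xu = x(1)[OF s(1)] and xv = x(1)[OF s(2)] and xw = x(1)[OF s(3)]
  have H12: "s1 \<otimes> s2 \<in> H" "s1 \<otimes> s3 \<in> H" "s2 \<otimes> s3 \<in> H" "s1 \<otimes> s2 \<otimes> s3 \<in> H" using s by simp_all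
  have uv: "mul ?u ?v \<in> U (s1 \<otimes> s2)" by (rule mul_closed[OF s(1,2) xu xv])
  have uw: "mul ?u ?w \<in> U (s1 \<otimes> s3)" by (rule mul_closed[OF s(1,3) xu xw])
  have vw: "mul ?v ?w \<in> U (s2 \<otimes> s3)" by (rule mul_closed[OF s(2,3) xv xw])
  have uvw: "mul (mul ?u ?v) ?w \<in> U (s1 \<otimes> s2 \<otimes> s3)" by (rule mul_closed[OF H12(1) s(3) uv xw])
  have nonz: "y \<noteq> 0" if "n y \<noteq> 0" for y using that by auto
  have cs: "U s1 = span {?u}" "U s2 = span {?v}" "U s3 = span {?w}" "U (s1 \<otimes> s2) = span {mul ?u ?v}"
    "U (s1 \<otimes> s3) = span {mul ?u ?w}" "U (s2 \<otimes> s3) = span {mul ?v ?w}"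
    "U (s1 \<otimes> s2 \<otimes> s3) = span {mul (mul ?u ?v) ?w}"
    by (rule component_span[OF U1 s(1) xu nonz] component_span[OF U1 s(2) xv nonz]
        component_span[OF U1 s(3) xw nonz] component_span[OF U1 H12(1) uv nonz]
        component_span[OF U1 H12(2) uw nonz] component_span[OF U1 H12(3) vw nonz]
        component_span[OF U1 H12(4) uvw nonz]; simp add: norm_mult nz)+
  define p where "p = doubling_pairs s1 s2 s3 ?u ?v ?w"
  note comps = doubling_pairs_components[OF facts(2), of ?u ?v ?w, folded p_def]
  have inside: "U g = span {y. (y, g) \<in> p}" if g: "g \<in> H" for g
    using g[unfolded facts(1)]
    by (elim insertE emptyE) (simp_all only: comps cs U1)
  have outside: "{0} = span {y. (y, g) \<in> p}" if "g \<notin> H" for g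
  proof -
    have "{y. (y, g) \<in> p} = {}" using that unfolding facts(1) p_def doubling_pairs_def by auto
    then show ?thesis by simp
  qed
  have Ueq: "(\<lambda>g. if g \<in> H then U g else {0}) = (\<lambda>g. span {y. (y, g) \<in> p})"
  proof (rule ext)
    fix g
    show "(if g \<in> H then U g else {0}) = span {y. (y, g) \<in> p}"
    proof (cases "g \<in> H")
      case True
      then show ?thesis by (simp only: if_True inside)
    next
      case False
      then show ?thesis by (simp only: if_False outside[OF False])
    qed
  qed
  have orth: "b y z = 0" if "g \<noteq> h" "g \<in> H" "h \<in> H" "y \<in> U g" "z \<in> U h" for g h y z
    by (rule orthogonal[OF that(2,3,1,4,5)])
  have d: "s1 \<noteq> \<one>" "s2 \<noteq> \<one>" "s2 \<noteq> s1" "s3 \<noteq> \<one>" "s3 \<noteq> s1" "s3 \<noteq> s2" "s3 \<noteq> s1 \<otimes> s2"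
    using facts(2) by (simp_all only: distinct.simps list.set insert_iff de_Morgan_disj) blast+
  note one1 = H.one_closed
  have "doubling_grading_F scale mul one n G H \<mu> (\<lambda>g. if g \<in> H then U g else {0})"
    unfolding doubling_grading_F_def doubling_pairs_def[symmetric]
  proof (intro exI conjI)
    show "?u \<in> perp n {one}" unfolding perp_def using orth[OF d(1) s(1) one1 xu one_in] by simp
    show "?v \<in> perp n {one, ?u}" unfolding perp_def
      using orth[OF d(2) s(2) one1 xv one_in] orth[OF d(3) s(2,1) xv xu] by simp
    show "?w \<in> perp n {one, ?u, ?v, mul ?u ?v}" unfolding perp_def
      using orth[OF d(4) s(3) one1 xw one_in] orth[OF d(5) s(3,1) xw xu] orth[OF d(6) s(3,2) xw xv]
        orth[OF d(7) s(3) H12(1) xw uv] by simp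
    show "n ?u \<in> \<mu> s1" "n ?v \<in> \<mu> s2" "n ?w \<in> \<mu> s3" by (rule m[OF s(1)], rule m[OF s(2)], rule m[OF s(3)])
    show "(\<lambda>g. if g \<in> H then U g else {0}) = (\<lambda>g. span {y. (y, g) \<in> doubling_pairs s1 s2 s3 ?u ?v ?w})"
      using Ueq by (simp only: p_def)
  qed (rule s gen nz)+
  then show ?thesis using adm by blast
qed

end

context cayley_grading_group
begin

text \<open>The idempotents of the good basis are zero divisors of degree \<open>\<one>\<close>.\<close>

lemma split_not_division:
  assumes U: "supported T U"
  shows "\<not> isomorphic_gradings G ((*s) :: 'f \<Rightarrow> _) split_mul (Gamma_split G \<gamma>) scale mul U"
proof
  assume "isomorphic_gradings G ((*s) :: 'f \<Rightarrow> _) split_mul (Gamma_split G \<gamma>) scale mul U"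
  then obtain F where F: "algebra_iso_on ((*s) :: 'f \<Rightarrow> _) split_mul UNIV scale mul UNIV F"
    "F ` Gamma_split G \<gamma> \<one> = U \<one>"
    by (auto simp: isomorphic_gradings_def)
  have inj: "inj F" and hom: "\<And>x y. F (split_mul x y) = mul (F x) (F y)"
    and sc: "\<And>a x. F (a *s x) = scale a (F x)"
    using F(1) by (auto simp: algebra_iso_on_def linear_iso_on_def bij_def)
  have F0: "F 0 = 0" using sc[of 0 0] by simp
  let ?e1 = "axis Ix_e1 1 :: 'f ^ good_index" and ?e2 = "axis Ix_e2 1 :: 'f ^ good_index"
  have "(axis i 1 :: 'f ^ good_index) \<in> Gamma_split G \<gamma> \<one>" if "good_degree G \<gamma> i = \<one>" for i
    unfolding Gamma_split_def by (rule vec.span_base) (use that in blast)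
  then have "?e1 \<in> Gamma_split G \<gamma> \<one>" "?e2 \<in> Gamma_split G \<gamma> \<one>" by simp_all
  then have mem: "F ?e1 \<in> U \<one>" "F ?e2 \<in> U \<one>" using F(2) by auto
  have "?e1 \<noteq> 0" "?e2 \<noteq> 0" by (simp_all add: axis_eq_0_iff)
  then have "F ?e1 \<noteq> 0" "F ?e2 \<noteq> 0" using inj F0 by (metis injD)+
  then have "n (F ?e1) \<noteq> 0" "n (F ?e2) \<noteq> 0"
    using supported_one_subalgebra(2)[OF U] mem by blast+
  moreover have "mul (F ?e1) (F ?e2) = 0" using hom[of ?e1 ?e2] F0 by (simp add: split_mul_axis)
  ultimately show False using norm_mult[of "F ?e1" "F ?e2"] by simp
qed

section \<open>Comparison of the four families\<close>

lemma Gamma_K_spec: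
  assumes K: "quadratic_separable_subfield scale mul one K"
    and T: "elementary_abelian_2_subgroup G 4 T" and adm: "admissible_K scale n G K T \<mu>"
  shows "supported T (Gamma_K mul n G K T \<mu>)" "Gamma_K mul n G K T \<mu> \<one> = K"
    "norm_typed T \<mu> (Gamma_K mul n G K T \<mu>)"
    "card T * dim K = 8"
    "\<And>t. t \<in> T \<Longrightarrow> \<mu> t \<in> carrier (field_units Mod norm_group n K)"
proof -
  have dbl: "doubling_grading_K mul n G K T \<mu> (Gamma_K mul n G K T \<mu>)"
    unfolding Gamma_K_def using doubling_grading_K_exists[OF K T adm] by (rule someI_ex)
  have \<mu>: "\<mu> \<in> hom (G\<lparr>carrier := T\<rparr>) (field_units Mod norm_group n K)"
    using adm by (simp add: admissible_K_def)
  note sp = doubling_grading_K_supported[OF K T \<mu> dbl]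
  show "supported T (Gamma_K mul n G K T \<mu>)" "Gamma_K mul n G K T \<mu> \<one> = K"
    "norm_typed T \<mu> (Gamma_K mul n G K T \<mu>)" by (fact sp)+
  show "card T * dim K = 8"
    using K elementary_abelianD(2)[OF T] by (simp add: quadratic_separable_subfield_def)
  show "\<mu> t \<in> carrier (field_units Mod norm_group n K)" if "t \<in> T" for t
    by (rule hom_coset_carrier[OF \<mu> that])
qed

lemma Gamma_F_spec:
  assumes char: "CHAR('f) \<noteq> 2"
    and T: "elementary_abelian_2_subgroup G 8 T" and adm: "admissible_F scale n G T \<mu>"
  shows "supported T (Gamma_F scale mul one n G T \<mu>)" "Gamma_F scale mul one n G T \<mu> \<one> = span {one}"
    "norm_typed T \<mu> (Gamma_F scale mul one n G T \<mu>)"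
    "card T * dim (span {one}) = 8"
    "\<And>t. t \<in> T \<Longrightarrow> \<mu> t \<in> carrier (field_units Mod norm_group n (span {one}))"
proof -
  have dbl: "doubling_grading_F scale mul one n G T \<mu> (Gamma_F scale mul one n G T \<mu>)"
    unfolding Gamma_F_def using doubling_grading_F_exists[OF char T adm] by (rule someI_ex)
  have \<mu>: "\<mu> \<in> hom (G\<lparr>carrier := T\<rparr>) (field_units Mod square_group)"
    using adm by (simp add: admissible_F_def)
  note sp = doubling_grading_F_supported[OF char T \<mu> dbl]
  show "supported T (Gamma_F scale mul one n G T \<mu>)" "Gamma_F scale mul one n G T \<mu> \<one> = span {one}"
    "norm_typed T \<mu> (Gamma_F scale mul one n G T \<mu>)" by (fact sp)+
  show "card T * dim (span {one}) = 8"
    using elementary_abelianD(2)[OF T] by simp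
  show "\<mu> t \<in> carrier (field_units Mod norm_group n (span {one}))" if "t \<in> T" for t
    using hom_coset_carrier[OF \<mu> that] by (simp add: square_group_eq)
qed

lemma Gamma_Q_isomorphic_iff:
  assumes Q: "quaternion_division_subalgebra scale mul one n Q" and T: "subgroup T G" "card T = 2"
    and Q': "quaternion_division_subalgebra scale mul one n Q'" and T': "subgroup T' G" "card T' = 2"
  shows "isomorphic_gradings G scale mul (Gamma_Q G n Q T) scale mul (Gamma_Q G n Q' T')
    \<longleftrightarrow> isomorphic_subalgebras scale mul Q Q' \<and> T = T'"
proof
  assume "isomorphic_gradings G scale mul (Gamma_Q G n Q T) scale mul (Gamma_Q G n Q' T')"
  from isomorphic_supports[OF Gamma_Q_supported[OF Q T] Gamma_Q_supported[OF Q' T'] this]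
  show "isomorphic_subalgebras scale mul Q Q' \<and> T = T'" by (simp add: Gamma_Q_one)
next
  assume R: "isomorphic_subalgebras scale mul Q Q' \<and> T = T'"
  then obtain f where f: "algebra_iso_on scale mul Q scale mul Q' f"
    by (auto simp: isomorphic_subalgebras_def)
  have sub: "subspace Q" "subspace Q'" and one: "one \<in> Q" "one \<in> Q'" and dim: "dim Q = 4" "dim Q' = 4"
    using Q Q' by (auto simp: quaternion_division_subalgebra_def unital_subalgebra_def)
  let ?S = "{x + y |x y. x \<in> Q \<and> y \<in> Q'}"
  \<comment> \<open>both subalgebras contain \<open>one\<close>, so some nonzero vector is orthogonal to both\<close>
  have "dim {one} \<le> dim (Q \<inter> Q')" by (rule fd.dim_subset) (use one in auto)
  then have "dim ?S < 8" using fd.dim_sums_Int[OF sub] dim by simp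
  then obtain u where u: "u \<in> perp n ?S" "u \<noteq> 0" using nonzero_perp_exists by blast
  have "Q \<subseteq> ?S" "Q' \<subseteq> ?S" using subspace_0[OF sub(1)] subspace_0[OF sub(2)] by force+
  then have perp: "u \<in> perp n Q" "u \<in> perp n Q'" using u(1) unfolding perp_def by blast+
  obtain t where t: "T = {\<one>, t}" "t \<noteq> \<one>" using order2_subgroup[OF T] by metis
  interpret division_grading scale mul one n G T "Gamma_Q G n Q T"
    using Gamma_Q_supported[OF Q T] by (simp add: supported_def)
  have nu: "n u \<noteq> 0"
    using anisotropic[of t u] perp u t by (simp add: Gamma_Q_def)
  show "isomorphic_gradings G scale mul (Gamma_Q G n Q T) scale mul (Gamma_Q G n Q' T')"
  proof (rule supported_isomorphic[where T = T])
    show "supported T (Gamma_Q G n Q T)" by (rule Gamma_Q_supported[OF Q T])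
    show "supported T (Gamma_Q G n Q' T')" using Gamma_Q_supported[OF Q' T'] R by simp
    show "algebra_iso_on scale mul (Gamma_Q G n Q T \<one>) scale mul (Gamma_Q G n Q' T' \<one>) f"
      using f by (simp add: Gamma_Q_one)
    show "\<exists>x\<in>Gamma_Q G n Q T s. \<exists>x'\<in>Gamma_Q G n Q' T' s. n x \<noteq> 0 \<and> n x' = n x" if "s \<in> T" for s
    proof (cases "s = \<one>")
      case True
      then show ?thesis using one by (intro bexI[of _ one]) (auto simp: Gamma_Q_one)
    next
      case False
      then show ?thesis using that perp nu R by (intro bexI[of _ u]) (auto simp: Gamma_Q_def)
    qed
  qed (use dim T in \<open>simp_all add: Gamma_Q_one\<close>)
qed

lemma Gamma_K_isomorphic_iff:
  assumes K: "quadratic_separable_subfield scale mul one K"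
    "elementary_abelian_2_subgroup G 4 T" "admissible_K scale n G K T \<mu>"
    and K': "quadratic_separable_subfield scale mul one K'"
    "elementary_abelian_2_subgroup G 4 T'" "admissible_K scale n G K' T' \<mu>'"
  shows "isomorphic_gradings G scale mul (Gamma_K mul n G K T \<mu>) scale mul (Gamma_K mul n G K' T' \<mu>')
    \<longleftrightarrow> isomorphic_subalgebras scale mul K K' \<and> T = T' \<and> (\<forall>t\<in>T. \<mu> t = \<mu>' t)"
proof
  note sp = Gamma_K_spec[OF K] and sp' = Gamma_K_spec[OF K']
  assume iso: "isomorphic_gradings G scale mul (Gamma_K mul n G K T \<mu>) scale mul (Gamma_K mul n G K' T' \<mu>')"
  have "T = T'" "isomorphic_subalgebras scale mul K K'"
    using isomorphic_supports[OF sp(1) sp'(1) iso, unfolded sp(2) sp'(2)] .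
  moreover have "\<mu> t = \<mu>' t" if "t \<in> T" for t
    by (rule isomorphic_types[OF sp(1,3) sp'(1,3) _ _ iso that]) (simp_all add: sp(2,5) sp'(2,5))
  ultimately show "isomorphic_subalgebras scale mul K K' \<and> T = T' \<and> (\<forall>t\<in>T. \<mu> t = \<mu>' t)" by blast
next
  note sp = Gamma_K_spec[OF K] and sp' = Gamma_K_spec[OF K']
  assume R: "isomorphic_subalgebras scale mul K K' \<and> T = T' \<and> (\<forall>t\<in>T. \<mu> t = \<mu>' t)"
  then obtain f where f: "algebra_iso_on scale mul K scale mul K' f"
    by (auto simp: isomorphic_subalgebras_def)
  show "isomorphic_gradings G scale mul (Gamma_K mul n G K T \<mu>) scale mul (Gamma_K mul n G K' T' \<mu>')"
  proof (rule typed_isomorphic[OF sp(1,3)])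
    show "supported T (Gamma_K mul n G K' T' \<mu>')" using sp'(1) R by simp
    show "norm_typed T \<mu> (Gamma_K mul n G K' T' \<mu>')" using sp'(3) R by (simp add: norm_typed_def)
    show "\<mu> t \<in> carrier (field_units Mod norm_group n (Gamma_K mul n G K' T' \<mu>' \<one>))" if "t \<in> T" for t
      using sp'(5)[of t] that R by (simp add: sp'(2))
    show "card T * dim (Gamma_K mul n G K' T' \<mu>' \<one>) = 8" using sp'(4) R by (simp add: sp'(2))
  qed (use f sp(4) in \<open>simp_all add: sp(2) sp'(2)\<close>)
qed

lemma algebra_iso_id: "algebra_iso_on scale mul A scale mul A id"
  by (simp add: algebra_iso_on_def linear_iso_on_def)

lemma Gamma_F_isomorphic_iff:
  assumes char: "CHAR('f) \<noteq> 2"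
    and T: "elementary_abelian_2_subgroup G 8 T" "admissible_F scale n G T \<mu>"
    and T': "elementary_abelian_2_subgroup G 8 T'" "admissible_F scale n G T' \<mu>'"
  shows "isomorphic_gradings G scale mul (Gamma_F scale mul one n G T \<mu>) scale mul (Gamma_F scale mul one n G T' \<mu>')
    \<longleftrightarrow> T = T' \<and> (\<forall>t\<in>T. \<mu> t = \<mu>' t)"
proof
  note sp = Gamma_F_spec[OF char T] and sp' = Gamma_F_spec[OF char T']
  assume iso: "isomorphic_gradings G scale mul (Gamma_F scale mul one n G T \<mu>) scale mul (Gamma_F scale mul one n G T' \<mu>')"
  have "T = T'"
    using isomorphic_supports[OF sp(1) sp'(1) iso] by simp
  moreover have "\<mu> t = \<mu>' t" if "t \<in> T" for t
    by (rule isomorphic_types[OF sp(1,3) sp'(1,3) _ _ iso that]) (simp_all only: sp(2,5) sp'(2,5))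
  ultimately show "T = T' \<and> (\<forall>t\<in>T. \<mu> t = \<mu>' t)" by blast
next
  note sp = Gamma_F_spec[OF char T] and sp' = Gamma_F_spec[OF char T']
  assume R: "T = T' \<and> (\<forall>t\<in>T. \<mu> t = \<mu>' t)"
  show "isomorphic_gradings G scale mul (Gamma_F scale mul one n G T \<mu>) scale mul (Gamma_F scale mul one n G T' \<mu>')"
  proof (rule typed_isomorphic[OF sp(1,3)])
    show "supported T (Gamma_F scale mul one n G T' \<mu>')" using sp'(1) R by simp
    show "norm_typed T \<mu> (Gamma_F scale mul one n G T' \<mu>')" using sp'(3) R by (simp add: norm_typed_def)
    show "\<mu> t \<in> carrier (field_units Mod norm_group n (Gamma_F scale mul one n G T' \<mu>' \<one>))" if "t \<in> T" for t
      using sp'(5)[of t] that R by (simp only: sp'(2))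
    show "card T * dim (Gamma_F scale mul one n G T' \<mu>' \<one>) = 8" using sp'(4) R by (simp only: sp'(2))
    show "card T * dim (Gamma_F scale mul one n G T \<mu> \<one>) = 8" using sp(4) by (simp only: sp(2))
    show "algebra_iso_on scale mul (Gamma_F scale mul one n G T \<mu> \<one>) scale mul (Gamma_F scale mul one n G T' \<mu>' \<one>) id"
      by (simp only: sp(2) sp'(2) algebra_iso_id)
  qed
qed

end

section \<open>Classification\<close>

context cayley_graded
begin

lemma classification:
  assumes nontriv: "\<not> trivial_grading G W"
  shows "(is_split n \<and>
          (\<exists>\<gamma>. triple_of_product_one G \<gamma> \<and> \<gamma> \<noteq> (\<lambda>_. \<one>) \<and>
             isomorphic_gradings G scale mul W (*s) split_mul (Gamma_split G \<gamma>)))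
      \<or> (\<exists>Q T. quaternion_division_subalgebra scale mul one n Q \<and>
             subgroup T G \<and> card T = 2 \<and>
             isomorphic_gradings G scale mul W scale mul (Gamma_Q G n Q T))
      \<or> (\<exists>K T \<mu>. quadratic_separable_subfield scale mul one K \<and>
             elementary_abelian_2_subgroup G 4 T \<and> admissible_K scale n G K T \<mu> \<and>
             isomorphic_gradings G scale mul W scale mul (Gamma_K mul n G K T \<mu>))
      \<or> (CHAR('f) \<noteq> 2 \<and>
          (\<exists>T \<mu>. elementary_abelian_2_subgroup G 8 T \<and> admissible_F scale n G T \<mu> \<and>
             isomorphic_gradings G scale mul W scale mul (Gamma_F scale mul one n G T \<mu>)))"
    (is "?split \<or> ?Q \<or> ?K \<or> ?F")
proof (cases "\<exists>x\<in>W \<one>. x \<noteq> 0 \<and> n x = 0")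
  case True
  then obtain x where x: "x \<in> W \<one>" "x \<noteq> 0" "n x = 0" by blast
  then have "is_split n" unfolding is_split_def by blast
  then show ?thesis using split_grading[OF nontriv x] by blast
next
  case False
  then have aniso: "\<And>x. x \<in> W \<one> \<Longrightarrow> x \<noteq> 0 \<Longrightarrow> n x \<noteq> 0" by blast
  interpret D: division_grading scale mul one n G support W by (rule division_grading_support[OF aniso])
  have full: "D.total = UNIV" unfolding D.total_def by (rule span_support)
  then have card: "card support * dim (W \<one>) = 8" by (simp add: D.total_eq_UNIV)
  have outside: "W g = {0}" if "g \<in> carrier G" "g \<notin> support" for g
  proof -
    have "x = 0" if "x \<in> W g" for x
      using that \<open>g \<in> carrier G\<close> \<open>g \<notin> support\<close> unfolding support_def by blast
    then show ?thesis using subspace_0[OF sub[OF that(1)]] by blast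
  qed
  \<comment> \<open>agrees with \<open>W\<close> on the group and is \<open>{0}\<close> off it, as the explicit gradings are\<close>
  define W' where "W' g = (if g \<in> support then W g else {0})" for g
  have WW': "W g = W' g" if "g \<in> carrier G" for g
    using outside that by (simp add: W'_def)
  note cong = isomorphic_gradings_cong[OF WW', of G]
  have W'1: "W' \<one> = W \<one>" by (simp add: W'_def)
  note nondeg1 = D.nondeg_one
  consider "card support = 1" | "card support = 2" | "card support = 4" | "card support = 8"
    using divisors_of_8[OF card] by blast
  then show ?thesis
  proof cases
    case 1
    then obtain g where "support = {g}" by (auto simp: card_1_singleton_iff)
    moreover have "\<one> \<in> support" by (rule D.H.one_closed)
    ultimately have "support = {\<one>}" by simp
    then have "span (W \<one>) = UNIV" using span_support by simp
    moreover have "span (W \<one>) = W \<one>" using sub[of \<one>] by (simp only: span_eq_iff G.one_closed)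
    ultimately show ?thesis using nontriv by (simp add: trivial_grading_def)
  next
    case 2
    then have dim: "dim (W \<one>) = 4" using card by simp
    have Q: "quaternion_division_subalgebra scale mul one n (W \<one>)"
      unfolding quaternion_division_subalgebra_def
      using D.one_subalgebra dim nondeg1 invertible_anisotropic[OF D.one_subalgebra aniso] by blast
    have "W g = Gamma_Q G n (W \<one>) support g" if g: "g \<in> carrier G" for g
    proof (cases "g \<in> support - {\<one>}")
      case True
      then obtain x where x: "x \<in> W g" "x \<noteq> 0" using D.nonzero by blast
      have xp: "x \<in> perp n (W \<one>)"
        unfolding perp_def using D.orthogonal[of g \<one> x] True x by auto
      have "perp n (W \<one>) = (\<lambda>y. mul y x) ` W \<one>"
      proof (rule double_perp[OF D.one_subalgebra _ dim xp])
        show "n x \<noteq> 0" using D.anisotropic[of g x] True x by blast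
      qed (rule nondeg1)
      then show ?thesis using D.component_eq_one[of g x] True x by (simp add: Gamma_Q_def)
    next
      case False
      show ?thesis
      proof (cases "g = \<one>")
        case True
        then show ?thesis by (simp add: Gamma_Q_def)
      next
        case ne: False
        then have "g \<notin> support" using False by blast
        with ne outside[OF g this] show ?thesis by (simp add: Gamma_Q_def)
      qed
    qed
    then have "isomorphic_gradings G scale mul W scale mul (Gamma_Q G n (W \<one>) support)"
      by (rule isomorphic_gradings_refl)
    then have ?Q using Q D.H_subgroup 2 by blast
    then show ?thesis by blast
  next
    case 3
    then have dim: "dim (W \<one>) = 2" using card by simp
    have K: "quadratic_separable_subfield scale mul one (W \<one>)"
      by (rule quadratic_subfieldI[OF D.one_subalgebra dim aniso nondeg1])
    have T: "elementary_abelian_2_subgroup G 4 support"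
      using D.H_subgroup D.H_square 3 by (simp add: elementary_abelian_2_subgroup_def)
    obtain \<mu> where \<mu>: "admissible_K scale n G (W \<one>) support \<mu>"
      "doubling_grading_K mul n G (W \<one>) support \<mu> W'"
      using D.is_doubling_grading_K[OF 3 full] unfolding W'_def by blast
    have hom: "\<mu> \<in> hom (G\<lparr>carrier := support\<rparr>) (field_units Mod norm_group n (W \<one>))"
      using \<mu>(1) by (simp add: admissible_K_def)
    note sp = Gamma_K_spec[OF K T \<mu>(1)] and sp' = doubling_grading_K_supported[OF K T hom \<mu>(2)]
    have "isomorphic_gradings G scale mul W' scale mul (Gamma_K mul n G (W \<one>) support \<mu>)"
      by (rule typed_isomorphic[OF sp'(1,3) sp(1,3), where f = id])
        (use card sp(5) in \<open>simp_all add: W'1 sp(2) algebra_iso_id\<close>)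
    then have "isomorphic_gradings G scale mul W scale mul (Gamma_K mul n G (W \<one>) support \<mu>)"
      by (simp only: cong)
    then have ?K using K T \<mu>(1) by blast
    then show ?thesis by blast
  next
    case 4
    then have "dim (W \<one>) = 1" using card by simp
    then have W1: "W \<one> = span {one}" by (rule D.one_component_scalar)
    \<comment> \<open>in characteristic 2 the polar form vanishes on the scalars\<close>
    have char: "CHAR('f) \<noteq> 2"
    proof
      assume "CHAR('f) = 2"
      then have "(2::'f) = 0" using of_nat_CHAR[where 'a = 'f] by simp
      then have "b one y = 0" if "y \<in> W \<one>" for y
        using that unfolding W1 by (auto simp: span_singleton b_simps b_one_one)
      then have "one = 0" using nondeg1[of one] one_in by blast
      then show False by simp
    qed
    have T: "elementary_abelian_2_subgroup G 8 support"
      using D.H_subgroup D.H_square 4 by (simp add: elementary_abelian_2_subgroup_def)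
    obtain \<mu> where \<mu>: "admissible_F scale n G support \<mu>"
      "doubling_grading_F scale mul one n G support \<mu> W'"
      using D.is_doubling_grading_F[OF 4 full W1] unfolding W'_def by blast
    have hom: "\<mu> \<in> hom (G\<lparr>carrier := support\<rparr>) (field_units Mod square_group)"
      using \<mu>(1) by (simp add: admissible_F_def)
    note sp = Gamma_F_spec[OF char T \<mu>(1)] and sp' = doubling_grading_F_supported[OF char T hom \<mu>(2)]
    have "isomorphic_gradings G scale mul W' scale mul (Gamma_F scale mul one n G support \<mu>)"
      by (rule typed_isomorphic[OF sp'(1,3) sp(1,3), where f = id])
        (use sp(4,5) in \<open>simp_all only: sp'(2) sp(2) algebra_iso_id\<close>)
    then have "isomorphic_gradings G scale mul W scale mul (Gamma_F scale mul one n G support \<mu>)"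
      by (simp only: cong)
    then have ?F using char T \<mu>(1) by blast
    then show ?thesis by blast
  qed
qed

end

context cayley_grading_group
begin

lemma isomorphic_same_order:
  assumes "supported T U" "supported T' V" "isomorphic_gradings G scale mul U scale mul V"
  shows "card T = card T'"
  using isomorphic_supports(1)[OF assms] by simp

lemma Gamma_Q_not_Gamma_K:
  assumes Q: "quaternion_division_subalgebra scale mul one n Q" "subgroup T G" "card T = 2"
    and K: "quadratic_separable_subfield scale mul one K"
    "elementary_abelian_2_subgroup G 4 T'" "admissible_K scale n G K T' \<mu>'"
  shows "\<not> isomorphic_gradings G scale mul (Gamma_Q G n Q T) scale mul (Gamma_K mul n G K T' \<mu>')"
  using isomorphic_same_order[OF Gamma_Q_supported[OF Q] Gamma_K_spec(1)[OF K]]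
    Q(3) elementary_abelianD(2)[OF K(2)] by auto

lemma Gamma_Q_not_Gamma_F:
  assumes char: "CHAR('f) \<noteq> 2"
    and Q: "quaternion_division_subalgebra scale mul one n Q" "subgroup T G" "card T = 2"
    and T': "elementary_abelian_2_subgroup G 8 T'" "admissible_F scale n G T' \<mu>'"
  shows "\<not> isomorphic_gradings G scale mul (Gamma_Q G n Q T) scale mul (Gamma_F scale mul one n G T' \<mu>')"
  using isomorphic_same_order[OF Gamma_Q_supported[OF Q] Gamma_F_spec(1)[OF char T']]
    Q(3) elementary_abelianD(2)[OF T'(1)] by auto

lemma Gamma_K_not_Gamma_F:
  assumes char: "CHAR('f) \<noteq> 2"
    and K: "quadratic_separable_subfield scale mul one K"
    "elementary_abelian_2_subgroup G 4 T" "admissible_K scale n G K T \<mu>"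
    and T': "elementary_abelian_2_subgroup G 8 T'" "admissible_F scale n G T' \<mu>'"
  shows "\<not> isomorphic_gradings G scale mul (Gamma_K mul n G K T \<mu>) scale mul (Gamma_F scale mul one n G T' \<mu>')"
  using isomorphic_same_order[OF Gamma_K_spec(1)[OF K] Gamma_F_spec(1)[OF char T']]
    elementary_abelianD(2)[OF K(2)] elementary_abelianD(2)[OF T'(1)] by auto

lemma Gamma_split_isomorphic_iff:
  assumes "triple_of_product_one G \<gamma>" "triple_of_product_one G \<gamma>'"
  shows "isomorphic_gradings G ((*s) :: 'f \<Rightarrow> _) split_mul (Gamma_split G \<gamma>) (*s) split_mul (Gamma_split G \<gamma>')
    \<longleftrightarrow> triple_equiv G \<gamma> \<gamma>'"
  using Gamma_split_isomorphic_equiv[OF G.comm_group_axioms assms, where 'f = 'f]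
    Gamma_split_equiv_isomorphic[OF G.group_axioms, of \<gamma> \<gamma>', where 'f = 'f] assms(1)
  by (auto simp: triple_of_product_one_def)

end

theorem theorem10:
  fixes scale :: "'f::field \<Rightarrow> 'c::ab_group_add \<Rightarrow> 'c"
    and mul :: "'c \<Rightarrow> 'c \<Rightarrow> 'c" and one :: 'c and n :: "'c \<Rightarrow> 'f"
    and G :: "('g, 'z) monoid_scheme"
  assumes "cayley_algebra scale mul one n"
    and "comm_group G"
  shows
    \<comment> \<open>every nontrivial grading occurs in one of the items (1)--(4)\<close>
    "(\<forall>W. is_grading G scale mul W \<and> \<not> trivial_grading G W \<longrightarrow>
        (is_split n \<and>
          (\<exists>\<gamma>. triple_of_product_one G \<gamma> \<and> \<gamma> \<noteq> (\<lambda>_. \<one>\<^bsub>G\<^esub>) \<and>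
             isomorphic_gradings G scale mul W vector_scalar_mult split_mul (Gamma_split G \<gamma>)))
      \<or> (\<exists>Q T. quaternion_division_subalgebra scale mul one n Q \<and>
             subgroup T G \<and> card T = 2 \<and>
             isomorphic_gradings G scale mul W scale mul (Gamma_Q G n Q T))
      \<or> (\<exists>K T \<mu>. quadratic_separable_subfield scale mul one K \<and>
             elementary_abelian_2_subgroup G 4 T \<and> admissible_K scale n G K T \<mu> \<and>
             isomorphic_gradings G scale mul W scale mul (Gamma_K mul n G K T \<mu>))
      \<or> (CHAR('f) \<noteq> 2 \<and>
          (\<exists>T \<mu>. elementary_abelian_2_subgroup G 8 T \<and> admissible_F scale n G T \<mu> \<and>
             isomorphic_gradings G scale mul W scale mul (Gamma_F scale mul one n G T \<mu>))))
    \<and>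
    \<comment> \<open>gradings in different items are not isomorphic\<close>
    (\<forall>\<gamma> Q T. triple_of_product_one G \<gamma> \<and> \<gamma> \<noteq> (\<lambda>_. \<one>\<^bsub>G\<^esub>) \<and>
        quaternion_division_subalgebra scale mul one n Q \<and> subgroup T G \<and> card T = 2 \<longrightarrow>
        \<not> isomorphic_gradings G (vector_scalar_mult :: 'f \<Rightarrow> _) split_mul (Gamma_split G \<gamma>)
             scale mul (Gamma_Q G n Q T)) \<and>
    (\<forall>\<gamma> K T \<mu>. triple_of_product_one G \<gamma> \<and> \<gamma> \<noteq> (\<lambda>_. \<one>\<^bsub>G\<^esub>) \<and>
        quadratic_separable_subfield scale mul one K \<and>
        elementary_abelian_2_subgroup G 4 T \<and> admissible_K scale n G K T \<mu> \<longrightarrow>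
        \<not> isomorphic_gradings G (vector_scalar_mult :: 'f \<Rightarrow> _) split_mul (Gamma_split G \<gamma>)
             scale mul (Gamma_K mul n G K T \<mu>)) \<and>
    (\<forall>\<gamma> T \<mu>. CHAR('f) \<noteq> 2 \<and> triple_of_product_one G \<gamma> \<and> \<gamma> \<noteq> (\<lambda>_. \<one>\<^bsub>G\<^esub>) \<and>
        elementary_abelian_2_subgroup G 8 T \<and> admissible_F scale n G T \<mu> \<longrightarrow>
        \<not> isomorphic_gradings G (vector_scalar_mult :: 'f \<Rightarrow> _) split_mul (Gamma_split G \<gamma>)
             scale mul (Gamma_F scale mul one n G T \<mu>)) \<and>
    (\<forall>Q T K T' \<mu>'. quaternion_division_subalgebra scale mul one n Q \<and>
        subgroup T G \<and> card T = 2 \<and>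
        quadratic_separable_subfield scale mul one K \<and>
        elementary_abelian_2_subgroup G 4 T' \<and> admissible_K scale n G K T' \<mu>' \<longrightarrow>
        \<not> isomorphic_gradings G scale mul (Gamma_Q G n Q T)
             scale mul (Gamma_K mul n G K T' \<mu>')) \<and>
    (\<forall>Q T T' \<mu>'. CHAR('f) \<noteq> 2 \<and> quaternion_division_subalgebra scale mul one n Q \<and>
        subgroup T G \<and> card T = 2 \<and>
        elementary_abelian_2_subgroup G 8 T' \<and> admissible_F scale n G T' \<mu>' \<longrightarrow>
        \<not> isomorphic_gradings G scale mul (Gamma_Q G n Q T)
             scale mul (Gamma_F scale mul one n G T' \<mu>')) \<and>
    (\<forall>K T \<mu> T' \<mu>'. CHAR('f) \<noteq> 2 \<and> quadratic_separable_subfield scale mul one K \<and>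
        elementary_abelian_2_subgroup G 4 T \<and> admissible_K scale n G K T \<mu> \<and>
        elementary_abelian_2_subgroup G 8 T' \<and> admissible_F scale n G T' \<mu>' \<longrightarrow>
        \<not> isomorphic_gradings G scale mul (Gamma_K mul n G K T \<mu>)
             scale mul (Gamma_F scale mul one n G T' \<mu>'))
    \<and>
    \<comment> \<open>(1')\<close>
    (\<forall>\<gamma> \<gamma>'. triple_of_product_one G \<gamma> \<and> triple_of_product_one G \<gamma>' \<longrightarrow>
        (isomorphic_gradings G (vector_scalar_mult :: 'f \<Rightarrow> _) split_mul (Gamma_split G \<gamma>)
             vector_scalar_mult split_mul (Gamma_split G \<gamma>')
         \<longleftrightarrow> triple_equiv G \<gamma> \<gamma>'))
    \<and>
    \<comment> \<open>(2')\<close>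
    (\<forall>Q T Q' T'. quaternion_division_subalgebra scale mul one n Q \<and>
        subgroup T G \<and> card T = 2 \<and>
        quaternion_division_subalgebra scale mul one n Q' \<and>
        subgroup T' G \<and> card T' = 2 \<longrightarrow>
        (isomorphic_gradings G scale mul (Gamma_Q G n Q T) scale mul (Gamma_Q G n Q' T')
         \<longleftrightarrow> isomorphic_subalgebras scale mul Q Q' \<and> T = T'))
    \<and>
    \<comment> \<open>(3')\<close>
    (\<forall>K T \<mu> K' T' \<mu>'. quadratic_separable_subfield scale mul one K \<and>
        elementary_abelian_2_subgroup G 4 T \<and> admissible_K scale n G K T \<mu> \<and>
        quadratic_separable_subfield scale mul one K' \<and>
        elementary_abelian_2_subgroup G 4 T' \<and> admissible_K scale n G K' T' \<mu>' \<longrightarrow>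
        (isomorphic_gradings G scale mul (Gamma_K mul n G K T \<mu>)
             scale mul (Gamma_K mul n G K' T' \<mu>')
         \<longleftrightarrow> isomorphic_subalgebras scale mul K K' \<and> T = T' \<and> (\<forall>t\<in>T. \<mu> t = \<mu>' t)))
    \<and>
    \<comment> \<open>(4')\<close>
    (\<forall>T \<mu> T' \<mu>'. CHAR('f) \<noteq> 2 \<and>
        elementary_abelian_2_subgroup G 8 T \<and> admissible_F scale n G T \<mu> \<and>
        elementary_abelian_2_subgroup G 8 T' \<and> admissible_F scale n G T' \<mu>' \<longrightarrow>
        (isomorphic_gradings G scale mul (Gamma_F scale mul one n G T \<mu>)
             scale mul (Gamma_F scale mul one n G T' \<mu>')
         \<longleftrightarrow> T = T' \<and> (\<forall>t\<in>T. \<mu> t = \<mu>' t)))"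
proof -
  interpret cayley_grading_group scale mul one n G
    using assms by (rule cayley_grading_group.intro)
  note classify = cayley_graded.classification[OF cayley_graded.intro[OF cayley_grading_group_axioms
      cayley_graded_axioms.intro]]
  note different = split_not_division[OF Gamma_Q_supported] split_not_division[OF Gamma_K_spec(1)]
    split_not_division[OF Gamma_F_spec(1)] Gamma_Q_not_Gamma_K Gamma_Q_not_Gamma_F Gamma_K_not_Gamma_F
  note iff = Gamma_split_isomorphic_iff Gamma_Q_isomorphic_iff Gamma_K_isomorphic_iff Gamma_F_isomorphic_iff
  show ?thesis
    by (intro conjI allI impI; elim conjE; rule classify different iff; assumption)
qed

end
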